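(* Let $p\in\{2,3\}$. For $\sigma_u$ sufficiently large and $\sigma_F>0$, there exists a constant $c>0$, independent of the interface location, such that $$a_h(v,v)\ge c\,\|v\|_h^2\qquad\text{for all }v\in S_h^p(\Omega).$$
   Context: Setting. $\Omega\subset\mathbb R^2$ is a bounded open polygonal domain, separated by a closed, regular, simple $C^2$ interface curve $\Gamma$ into $\Omega^+,\Omega^-$, with $\overline\Omega=\overline{\Omega^+\cup\Omega^-\cup\Gamma}$. $\beta=\beta^\pm>0$ (constants) on $\Omega^\pm$. $\mathcal T_h$ is a shape-regular triangular mesh of $\Omega$, $h=\max_Th_T$, $h_T=\operatorname{diam}T$. Assumptions: for every edge $e$, $\Gamma\cap e$ is at most one isolated point unless $e\subset\Gamma$; for every element $K$, $\Gamma$ meets $\partial K$ on at most two distinct edges (vertex intersections allowed; two vertex intersections are regarded as lying on two distinct edges); $h<r/2$, where $r>0$ is such that the segments of length $2r$ centered at $X\in\Gamma$ and perpendicular to $\Gamma$ are pairwise disjoint for distinct $X\in\Gamma$. "Independent of the interface location" means that the constant can be chosen uniformly over all interfaces admissible in this sense. $\mathcal T_h^i=\{T:T\cap\Gamma\neq\emptyset\}$ (interface elements), $\mathcal T_h^n=\mathcal T_h\setminus\mathcal T_h^i$; $T^\pm=T\cap\Omega^\pm$, $\Gamma_T=\Gamma\cap T$. $\mathcal E_h$: all edges; $\mathcal E_h^i$: interface edges (those cut by $\Gamma$), $\mathcal E_h^n=\mathcal E_h\setminus\mathcal E_h^i$; a ring ($\mathring{\mathcal E}_h,\mathring{\mathcal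 E}_h^i,\mathring{\mathcal E}_h^n$) denotes restriction to interior edges; $\mathcal F_h^i$: edges of interface elements. For $e\in\mathcal E_h^i$, $e^\pm=e\cap\Omega^\pm$. On an interior edge $e$ shared by $T_e^1,T_e^2$: $[\![w]\!]=w|_{T_e^1}-w|_{T_e^2}$, $\{\!\{w\}\!\}=\frac12(w|_{T_e^1}+w|_{T_e^2})$, and $n$ is the unit normal pointing from $T_e^1$ to $T_e^2$; on $\Gamma_T$, $[\![w]\!]=w^+-w^-$ and $n$ is the unit normal to $\Gamma$. $\partial_nv=\sum_in_i\partial_iv$, $\partial_{nn}v=\sum_{i,j}n_in_j\partial_{ij}v$. In penalty terms, $\{\!\{\beta\}\!\}=(\beta^++\beta^-)/2$. All derivatives are taken piecewise (on each $T\in\mathcal T_h^n$ and each $T^\pm$, $T\in\mathcal T_h^i$), and $\beta\|\nabla^2v\|^2_{L^2(T)}$ means $\int_T\beta|\nabla^2v|^2dX$. IFE space. $\{A_i\}_{i\in\mathcal I_p}$ are the degree-$p$ Lagrange nodes of $T$, $\psi^p_{i,T}\in\mathcal P_p(T)$ the Lagrange shape functions. For $T\in\mathcal T_h^n$, $S_h^p(T)=\mathcal P_p(T)$. For $T\in\mathcal T_h^i$, split $\mathcal I_p=\mathcal I_p^+\sqcup\mathcal I_p^-$ according to $A_i\in T^\pm$ (nodes on $\Gamma$ assigned to one side), and in $\mathcal P_p(T)\times\mathcal P_p(T)$ set $\xi_i=(\psi^p_{i,T},0),\ \eta_i=(0,\psi^p_{i,T})$ if $i\in\mathcal I_p^+$,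 and $\xi_i=(0,\psi^p_{i,T}),\ \eta_i=(\psi^p_{i,T},0)$ if $i\in\mathcal I_p^-$. With $\lambda>1$, $T_\lambda$ the dilation of $T$ by $\lambda$ about its barycenter, $\Gamma_T^\lambda=T_\lambda\cap\Gamma$, weights $\omega_j>0$, polynomials extended to $\mathbb R^2$, $[\![Du]\!]=Du_1-Du_2$, $[\![\beta Du]\!]=\beta^+Du_1-\beta^-Du_2$ for $u=(u_1,u_2)$, and $\partial_{ntt}v=\sum n_it_jt_k\partial_{ijk}v$ ($n,t$ unit normal and tangent to $\Gamma$), let $$\mathcal J(u,v)=\int_{\Gamma_T^\lambda}\big(\omega_0[\![u]\!][\![v]\!]+\omega_1h^2[\![\partial_nu]\!][\![\partial_nv]\!]+\omega_2h^4[\![\beta\partial_{nn}u]\!][\![\beta\partial_{nn}v]\!]+\omega_3h^6[\![\beta(\partial_n\Delta u+\partial_{ntt}u)]\!][\![\beta(\partial_n\Delta v+\partial_{ntt}v)]\!]\big)ds.$$ For $p\in\{2,3\}$ and each $j\in\mathcal I_p$ there is a unique $\varphi_j=\xi_j+\sum_ic_i\eta_i$ with $\mathcal J(\varphi_j,\eta_i)=0$ for all $i$; $\phi^p_{j,T}$ is the function equal to the first component of $\varphi_j$ on $T^+$ and the second on $T^-$, and $S_h^p(T)=\operatorname{span}\{\phi^p_{j,T}:j\in\mathcal I_p\}$. The global space $S_h^p(\Omega)$ (also written $S_h^p$) consists of all $u\in L^2(\Omega)$ such that $u|_T\in S_h^p(T)$ for all $T$, $u$ is continuous on every $e\in\mathcal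 E_h^n$, $u$ is continuous at all Lagrange nodes, and $u|_{\partial\Omega}=0$. Bilinear form. With penalty parameters $\sigma_u,\sigma_F,\sigma_n>0$, $a_h=A_h+J_{h,u}+J_{h,n}$, where $A_h(u,v)=\sum_{T\in\mathcal T_h}\int_T\beta\nabla^2u:\nabla^2v\,dX$, $$J_{h,u}(u,v)=-\sum_{e\in\mathring{\mathcal E}_h}\int_e\{\!\{\beta\partial_{nn}u\}\!\}[\![\partial_nv]\!]ds-\sum_{e\in\mathring{\mathcal E}_h}\int_e\{\!\{\beta\partial_{nn}v\}\!\}[\![\partial_nu]\!]ds+\sum_{e\in\mathring{\mathcal E}_h^n}\frac{\sigma_u\beta}{|e|}\int_e[\![\partial_nu]\!][\![\partial_nv]\!]ds$$ $$+\sum_{e\in\mathring{\mathcal E}_h^i}\sum_{s=\pm}\frac{\sigma_u\beta^s}{|e^s|}\int_{e^s}[\![\partial_nu]\!][\![\partial_nv]\!]ds+\sum_{T\in\mathcal T_h^i}\frac{\sigma_u\{\!\{\beta\}\!\}}{h_T}\int_{\Gamma_T}[\![\partial_nu]\!][\![\partial_nv]\!]ds,$$ $$J_{h,n}(u,v)=\sum_{e\in\mathring{\mathcal E}_h^i}\sum_{s=\pm}\sigma_F|e^s|\beta^s\int_{e^s}[\![\partial_{nn}u]\!][\![\partial_{nn}v]\!]ds+\sum_{e\in\mathring{\mathcal E}_h^n\cap\mathcal F_h^i}\sigma_F|e|\beta\int_e[\![\partial_{nn}u]\!][\![\partial_{nn}v]\!]ds$$ $$+\sum_{e\in\mathring{\mathcal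 E}_h^i}\frac{\sigma_n\{\!\{\beta\}\!\}}{|e|^3}\int_e[\![u]\!][\![v]\!]ds+\sum_{T\in\mathcal T_h^i}\frac{\sigma_n\{\!\{\beta\}\!\}}{h_T^3}\int_{\Gamma_T}[\![u]\!][\![v]\!]ds.$$ Norm. $$\|v\|_h^2=\sum_{T\in\mathcal T_h}\beta\|\nabla^2v\|^2_{L^2(T)}+\sum_{e\in\mathring{\mathcal E}_h^n}\frac{\sigma_u\beta}{|e|}\|[\![\partial_nv]\!]\|^2_{L^2(e)}+\sum_{T\in\mathcal T_h^i}\frac{\sigma_u\{\!\{\beta\}\!\}}{h_T}\|[\![\partial_nv]\!]\|^2_{L^2(\Gamma_T)}+\sum_{e\in\mathring{\mathcal E}_h^i}\sum_{s=\pm}\frac{\sigma_u\beta^s}{|e^s|}\|[\![\partial_nv]\!]\|^2_{L^2(e^s)}$$ $$+\sum_{e\in\mathring{\mathcal E}_h^n\cap\mathcal F_h^i}\sigma_F|e|\beta\|[\![\partial_{nn}v]\!]\|^2_{L^2(e)}+\sum_{e\in\mathring{\mathcal E}_h^i}\sum_{s=\pm}\sigma_F|e^s|\beta^s\|[\![\partial_{nn}v]\!]\|^2_{L^2(e^s)}+\sum_{e\in\mathring{\mathcal E}_h^i}\frac{\sigma_n\{\!\{\beta\}\!\}}{|e|^3}\|[\![v]\!]\|^2_{L^2(e)}+\sum_{T\in\mathcal T_h^i}\frac{\sigma_n\{\!\{\beta\}\!\}}{h_T^3}\|[\![v]\!]\|^2_{L^2(\Gamma_T)}.$$ *)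

theory Defs
  imports "HOL-Analysis.Analysis"
begin

datatype side = Plus | Minus

(* The interface is given by a parametrization of period 1 together with the labelling of the two
   subdomains that it creates: side_dom at Plus and Minus is Omega^+ and Omega^-. *)
record interface =
  curve :: "real \<Rightarrow> real^2"
  side_dom :: "side \<Rightarrow> (real^2) set"

definition Gam :: "interface \<Rightarrow> (real^2) set" where
  "Gam \<Gamma> = range (curve \<Gamma>)"


section \<open>Domain and mesh\<close>

definition polygonal_domain :: "(real^2) set \<Rightarrow> bool" where
  "polygonal_domain \<Omega> \<longleftrightarrow>
     open \<Omega> \<and> connected \<Omega> \<and> bounded \<Omega> \<and> \<Omega> \<noteq> {} \<and> interior (closure \<Omega>) = \<Omega> \<and>
     (\<exists>S. finite S \<and> frontier \<Omega> = (\<Union>(a, b)\<in>S. closed_segment a b))"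

(* Elements are closed triangles; the library predicate triangulation says that any two of them
   meet in a common face. *)
definition triangular_mesh :: "(real^2) set \<Rightarrow> (real^2) set set \<Rightarrow> bool" where
  "triangular_mesh \<Omega> \<T> \<longleftrightarrow> triangulation \<T> \<and> (\<forall>T\<in>\<T>. 2 simplex T) \<and> \<Union>\<T> = closure \<Omega>"

definition shape_regular :: "real \<Rightarrow> (real^2) set set \<Rightarrow> bool" where
  "shape_regular \<kappa> \<T> \<longleftrightarrow> (\<forall>T\<in>\<T>. \<exists>z r. 0 < r \<and> cball z r \<subseteq> T \<and> diameter T \<le> \<kappa> * r)"

definition mesh_size :: "(real^2) set set \<Rightarrow> real" where
  "mesh_size \<T> = Max (diameter ` \<T>)"

definition vertices :: "(real^2) set \<Rightarrow> (real^2) set" where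
  "vertices T = {a. a extreme_point_of T}"

definition edges :: "(real^2) set set \<Rightarrow> (real^2) set set" where
  "edges \<T> = {e. \<exists>T\<in>\<T>. e facet_of T}"

definition int_edges :: "(real^2) set \<Rightarrow> (real^2) set set \<Rightarrow> (real^2) set set" where
  "int_edges \<Omega> \<T> = {e \<in> edges \<T>. \<not> e \<subseteq> frontier \<Omega>}"

definition skeleton :: "(real^2) set set \<Rightarrow> (real^2) set" where
  "skeleton \<T> = (\<Union>T\<in>\<T>. frontier T)"

definition iface_elems :: "(real^2) set set \<Rightarrow> interface \<Rightarrow> (real^2) set set" where
  "iface_elems \<T> \<Gamma> = {T \<in> \<T>. T \<inter> Gam \<Gamma> \<noteq> {}}"

(* Like the elements, an edge counts as cut as soon as it meets the curve, so that the coefficient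
   is constant along every edge that is not an interface edge. *)
definition iface_edges :: "(real^2) set set \<Rightarrow> interface \<Rightarrow> (real^2) set set" where
  "iface_edges \<T> \<Gamma> = {e \<in> edges \<T>. e \<inter> Gam \<Gamma> \<noteq> {}}"

definition edges_of_iface_elems :: "(real^2) set set \<Rightarrow> interface \<Rightarrow> (real^2) set set" where
  "edges_of_iface_elems \<T> \<Gamma> = edges (iface_elems \<T> \<Gamma>)"


section \<open>Interface geometry\<close>

definition gtangent :: "interface \<Rightarrow> real^2 \<Rightarrow> real^2" where
  "gtangent \<Gamma> x = (let w = vector_derivative (curve \<Gamma>) (at (inv_into {0..<1} (curve \<Gamma>) x))
                   in w /\<^sub>R norm w)"

(* The orientation of this normal is immaterial: it enters all forms below an even number of times. *)
definition gnormal :: "interface \<Rightarrow> real^2 \<Rightarrow> real^2" where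
  "gnormal \<Gamma> x = vector [- (gtangent \<Gamma> x $ 2), gtangent \<Gamma> x $ 1]"

definition closed_regular_simple_C2 :: "(real \<Rightarrow> real^2) \<Rightarrow> bool" where
  "closed_regular_simple_C2 g \<longleftrightarrow>
     (\<forall>t. g (t + 1) = g t) \<and> inj_on g {0..<1} \<and>
     g C1_differentiable_on UNIV \<and>
     (\<lambda>t. vector_derivative g (at t)) C1_differentiable_on UNIV \<and>
     (\<forall>t. vector_derivative g (at t) \<noteq> 0)"

(* Two edges e1, e2 of K have to account for all points where the curve meets the boundary of K;
   a vertex on the curve may be attributed to either of the two edges of K that contain it. *)
definition admissible :: "(real^2) set \<Rightarrow> (real^2) set set \<Rightarrow> interface \<Rightarrow> bool" where
  "admissible \<Omega> \<T> \<Gamma> \<longleftrightarrow>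
     closed_regular_simple_C2 (curve \<Gamma>) \<and> Gam \<Gamma> \<subseteq> \<Omega> \<and>
     side_dom \<Gamma> Plus \<noteq> side_dom \<Gamma> Minus \<and>
     components (\<Omega> - Gam \<Gamma>) = {side_dom \<Gamma> Plus, side_dom \<Gamma> Minus} \<and>
     (\<forall>e\<in>edges \<T>. e \<subseteq> Gam \<Gamma> \<or> (\<exists>x. Gam \<Gamma> \<inter> e \<subseteq> {x})) \<and>
     (\<forall>K\<in>\<T>. \<exists>e1 e2. e1 facet_of K \<and> e2 facet_of K \<and> Gam \<Gamma> \<inter> frontier K \<subseteq> e1 \<union> e2) \<and>
     (\<exists>r>0. mesh_size \<T> < r / 2 \<and>
        (\<forall>x\<in>Gam \<Gamma>. \<forall>y\<in>Gam \<Gamma>. x \<noteq> y \<longrightarrow>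
           closed_segment (x - r *\<^sub>R gnormal \<Gamma> x) (x + r *\<^sub>R gnormal \<Gamma> x) \<inter>
           closed_segment (y - r *\<^sub>R gnormal \<Gamma> y) (y + r *\<^sub>R gnormal \<Gamma> y) = {}))"


section \<open>Derivatives, traces and line integrals\<close>

definition pd :: "2 \<Rightarrow> (real^2 \<Rightarrow> real) \<Rightarrow> real^2 \<Rightarrow> real" where
  "pd i f x = frechet_derivative f (at x) (axis i 1)"

definition dn :: "real^2 \<Rightarrow> (real^2 \<Rightarrow> real) \<Rightarrow> real^2 \<Rightarrow> real" where
  "dn n f x = (\<Sum>i\<in>UNIV. n $ i * pd i f x)"

definition dnn :: "real^2 \<Rightarrow> (real^2 \<Rightarrow> real) \<Rightarrow> real^2 \<Rightarrow> real" where
  "dnn n f x = (\<Sum>i\<in>UNIV. \<Sum>j\<in>UNIV. n $ i * n $ j * pd i (pd j f) x)"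

definition dntt :: "real^2 \<Rightarrow> real^2 \<Rightarrow> (real^2 \<Rightarrow> real) \<Rightarrow> real^2 \<Rightarrow> real" where
  "dntt n t f x =
     (\<Sum>i\<in>UNIV. \<Sum>j\<in>UNIV. \<Sum>k\<in>UNIV. n $ i * t $ j * t $ k * pd i (pd j (pd k f)) x)"

definition laplacian :: "(real^2 \<Rightarrow> real) \<Rightarrow> real^2 \<Rightarrow> real" where
  "laplacian f x = (\<Sum>i\<in>UNIV. pd i (pd i f) x)"

definition hess_inner :: "(real^2 \<Rightarrow> real) \<Rightarrow> (real^2 \<Rightarrow> real) \<Rightarrow> real^2 \<Rightarrow> real" where
  "hess_inner u v x = (\<Sum>i\<in>UNIV. \<Sum>j\<in>UNIV. pd i (pd j u) x * pd i (pd j v) x)"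

(* The value on the curve, a null set, is irrelevant. *)
definition coef :: "interface \<Rightarrow> (side \<Rightarrow> real) \<Rightarrow> real^2 \<Rightarrow> real" where
  "coef \<Gamma> \<beta> x =
     (if x \<in> side_dom \<Gamma> Plus then \<beta> Plus else if x \<in> side_dom \<Gamma> Minus then \<beta> Minus else 0)"

(* Piecewise smooth functions on Omega are represented by functions on the plane of which only the
   values off the skeleton and off the curve matter. Their derivatives are taken there; their
   values on an edge or on the curve are one-sided limits. *)
definition etrace :: "interface \<Rightarrow> (real^2) set \<Rightarrow> (real^2 \<Rightarrow> real) \<Rightarrow> real^2 \<Rightarrow> real" where
  "etrace \<Gamma> T f x = Lim (at x within (interior T - Gam \<Gamma>)) f"

definition gtrace ::
  "(real^2) set set \<Rightarrow> interface \<Rightarrow> side \<Rightarrow> (real^2 \<Rightarrow> real) \<Rightarrow> real^2 \<Rightarrow> real" where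
  "gtrace \<T> \<Gamma> s f x = Lim (at x within (side_dom \<Gamma> s - skeleton \<T>)) f"

(* T_e^1 and T_e^2; jumps of normal derivatives, and products of jumps, do not depend on which of
   the two elements comes first. *)
definition elems_of :: "(real^2) set set \<Rightarrow> (real^2) set \<Rightarrow> (real^2) set \<times> (real^2) set" where
  "elems_of \<T> e =
     (SOME (T1, T2). T1 \<in> \<T> \<and> T2 \<in> \<T> \<and> T1 \<noteq> T2 \<and> e facet_of T1 \<and> e facet_of T2)"

(* unit normal of e pointing out of T_e^1, that is, from T_e^1 to T_e^2 *)
definition enormal :: "(real^2) set set \<Rightarrow> (real^2) set \<Rightarrow> real^2" where
  "enormal \<T> e = (THE n. norm n = 1 \<and> (\<forall>x\<in>e. \<forall>y\<in>e. n \<bullet> (y - x) = 0) \<and>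
                        (\<forall>x\<in>e. \<forall>y\<in>fst (elems_of \<T> e). n \<bullet> (y - x) \<le> 0))"

definition ejump ::
  "(real^2) set set \<Rightarrow> interface \<Rightarrow> (real^2) set \<Rightarrow> (real^2 \<Rightarrow> real) \<Rightarrow> real^2 \<Rightarrow> real" where
  "ejump \<T> \<Gamma> e f x =
     etrace \<Gamma> (fst (elems_of \<T> e)) f x - etrace \<Gamma> (snd (elems_of \<T> e)) f x"

definition eavg ::
  "(real^2) set set \<Rightarrow> interface \<Rightarrow> (real^2) set \<Rightarrow> (real^2 \<Rightarrow> real) \<Rightarrow> real^2 \<Rightarrow> real" where
  "eavg \<T> \<Gamma> e f x =
     (etrace \<Gamma> (fst (elems_of \<T> e)) f x + etrace \<Gamma> (snd (elems_of \<T> e)) f x) / 2"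

definition ejump_n where
  "ejump_n \<T> \<Gamma> e v x = ejump \<T> \<Gamma> e (dn (enormal \<T> e) v) x"

definition ejump_nn where
  "ejump_nn \<T> \<Gamma> e v x = ejump \<T> \<Gamma> e (dnn (enormal \<T> e) v) x"

definition eavg_bnn where
  "eavg_bnn \<T> \<Gamma> \<beta> e v x = eavg \<T> \<Gamma> e (\<lambda>y. coef \<Gamma> \<beta> y * dnn (enormal \<T> e) v y) x"

definition gjump ::
  "(real^2) set set \<Rightarrow> interface \<Rightarrow> (real^2 \<Rightarrow> real) \<Rightarrow> real^2 \<Rightarrow> real" where
  "gjump \<T> \<Gamma> f x = gtrace \<T> \<Gamma> Plus f x - gtrace \<T> \<Gamma> Minus f x"

definition gjump_n where
  "gjump_n \<T> \<Gamma> v x = gjump \<T> \<Gamma> (dn (gnormal \<Gamma> x) v) x"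

(* arc-length integral over the part of the segment e lying in S *)
definition eint :: "(real^2) set \<Rightarrow> (real^2) set \<Rightarrow> (real^2 \<Rightarrow> real) \<Rightarrow> real" where
  "eint e S f =
     (let (a, b) = (SOME (a, b). e = closed_segment a b) in
      LINT t:{0..1}|lebesgue. indicat_real S (a + t *\<^sub>R (b - a)) * f (a + t *\<^sub>R (b - a)) * dist a b)"

(* arc-length integral over the part of the interface lying in S *)
definition gint :: "interface \<Rightarrow> (real^2) set \<Rightarrow> (real^2 \<Rightarrow> real) \<Rightarrow> real" where
  "gint \<Gamma> S f =
     (LINT t:{0..1}|lebesgue. indicat_real S (curve \<Gamma> t) * f (curve \<Gamma> t) *
        norm (vector_derivative (curve \<Gamma>) (at t)))"

definition elen :: "(real^2) set \<Rightarrow> (real^2) set \<Rightarrow> real" where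
  "elen e S = eint e S (\<lambda>_. 1)"


section \<open>Immersed finite element space\<close>

definition poly2 :: "nat \<Rightarrow> (real^2 \<Rightarrow> real) set" where
  "poly2 p = {f. \<exists>a. f = (\<lambda>x. \<Sum>i\<le>p. \<Sum>j\<le>p - i. a i j * (x $ 1) ^ i * (x $ 2) ^ j)}"

definition nodes :: "nat \<Rightarrow> (real^2) set \<Rightarrow> (real^2) set" where
  "nodes p T = {\<Sum>a\<in>vertices T. (real (k a) / real p) *\<^sub>R a |k. (\<Sum>a\<in>vertices T. k a) = p}"

(* Shape functions are indexed by the nodes themselves and live on the whole plane. *)
definition lagrange :: "nat \<Rightarrow> (real^2) set \<Rightarrow> real^2 \<Rightarrow> real^2 \<Rightarrow> real" where
  "lagrange p T A = (THE f. f \<in> poly2 p \<and> (\<forall>B\<in>nodes p T. f B = (if B = A then 1 else 0)))"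

(* nu assigns the nodes on the curve to a side. A node on the boundary of Omega lies in neither
   open subdomain; its side is the one of the element near it. *)
definition node_side :: "interface \<Rightarrow> (real^2 \<Rightarrow> side) \<Rightarrow> (real^2) set \<Rightarrow> real^2 \<Rightarrow> side" where
  "node_side \<Gamma> \<nu> T A =
     (if A \<in> Gam \<Gamma> then \<nu> A
      else if A \<in> closure (interior T \<inter> side_dom \<Gamma> Plus) then Plus else Minus)"

type_synonym fpair = "side \<Rightarrow> real^2 \<Rightarrow> real"

definition xi :: "interface \<Rightarrow> (real^2 \<Rightarrow> side) \<Rightarrow> nat \<Rightarrow> (real^2) set \<Rightarrow> real^2 \<Rightarrow> fpair" where
  "xi \<Gamma> \<nu> p T A = (\<lambda>s. if s = node_side \<Gamma> \<nu> T A then lagrange p T A else (\<lambda>_. 0))"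

definition eta :: "interface \<Rightarrow> (real^2 \<Rightarrow> side) \<Rightarrow> nat \<Rightarrow> (real^2) set \<Rightarrow> real^2 \<Rightarrow> fpair" where
  "eta \<Gamma> \<nu> p T A = (\<lambda>s. if s = node_side \<Gamma> \<nu> T A then (\<lambda>_. 0) else lagrange p T A)"

definition barycenter :: "(real^2) set \<Rightarrow> real^2" where
  "barycenter T = (\<Sum>a\<in>vertices T. a) /\<^sub>R 3"

definition dilate :: "real \<Rightarrow> (real^2) set \<Rightarrow> (real^2) set" where
  "dilate \<mu> T = (\<lambda>x. barycenter T + \<mu> *\<^sub>R (x - barycenter T)) ` T"

definition pjump ::
  "((real^2 \<Rightarrow> real) \<Rightarrow> real^2 \<Rightarrow> real) \<Rightarrow> fpair \<Rightarrow> real^2 \<Rightarrow> real" where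
  "pjump D u x = D (u Plus) x - D (u Minus) x"

definition bpjump ::
  "(side \<Rightarrow> real) \<Rightarrow> ((real^2 \<Rightarrow> real) \<Rightarrow> real^2 \<Rightarrow> real) \<Rightarrow> fpair \<Rightarrow> real^2 \<Rightarrow> real" where
  "bpjump \<beta> D u x = \<beta> Plus * D (u Plus) x - \<beta> Minus * D (u Minus) x"

definition Jform ::
  "(real^2) set set \<Rightarrow> interface \<Rightarrow> (side \<Rightarrow> real) \<Rightarrow> real \<Rightarrow> (nat \<Rightarrow> real) \<Rightarrow> (real^2) set \<Rightarrow>
   fpair \<Rightarrow> fpair \<Rightarrow> real" where
  "Jform \<T> \<Gamma> \<beta> \<mu> \<omega> T u v =
     gint \<Gamma> (dilate \<mu> T) (\<lambda>x.
       (let n = gnormal \<Gamma> x; t = gtangent \<Gamma> x; h = mesh_size \<T>;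
            D3 = (\<lambda>f y. dn n (laplacian f) y + dntt n t f y)
        in \<omega> 0 * pjump (\<lambda>f. f) u x * pjump (\<lambda>f. f) v x
         + \<omega> 1 * h ^ 2 * pjump (dn n) u x * pjump (dn n) v x
         + \<omega> 2 * h ^ 4 * bpjump \<beta> (dnn n) u x * bpjump \<beta> (dnn n) v x
         + \<omega> 3 * h ^ 6 * bpjump \<beta> D3 u x * bpjump \<beta> D3 v x))"

definition is_ife_shape ::
  "nat \<Rightarrow> (real^2) set set \<Rightarrow> interface \<Rightarrow> (real^2 \<Rightarrow> side) \<Rightarrow> (side \<Rightarrow> real) \<Rightarrow> real \<Rightarrow>
   (nat \<Rightarrow> real) \<Rightarrow> (real^2) set \<Rightarrow> real^2 \<Rightarrow> fpair \<Rightarrow> bool" where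
  "is_ife_shape p \<T> \<Gamma> \<nu> \<beta> \<mu> \<omega> T A \<phi> \<longleftrightarrow>
     (\<exists>c. \<phi> = (\<lambda>s x. xi \<Gamma> \<nu> p T A s x + (\<Sum>B\<in>nodes p T. c B * eta \<Gamma> \<nu> p T B s x))) \<and>
     (\<forall>B\<in>nodes p T. Jform \<T> \<Gamma> \<beta> \<mu> \<omega> T \<phi> (eta \<Gamma> \<nu> p T B) = 0)"

definition glue :: "interface \<Rightarrow> fpair \<Rightarrow> real^2 \<Rightarrow> real" where
  "glue \<Gamma> u x = (if x \<in> side_dom \<Gamma> Plus then u Plus x else u Minus x)"

definition local_space ::
  "nat \<Rightarrow> (real^2) set set \<Rightarrow> interface \<Rightarrow> (real^2 \<Rightarrow> side) \<Rightarrow> (side \<Rightarrow> real) \<Rightarrow> real \<Rightarrow>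
   (nat \<Rightarrow> real) \<Rightarrow> (real^2) set \<Rightarrow> (real^2 \<Rightarrow> real) set" where
  "local_space p \<T> \<Gamma> \<nu> \<beta> \<mu> \<omega> T =
     (if T \<in> iface_elems \<T> \<Gamma>
      then {w. \<exists>\<phi> a. (\<forall>A\<in>nodes p T. is_ife_shape p \<T> \<Gamma> \<nu> \<beta> \<mu> \<omega> T A (\<phi> A)) \<and>
                     w = (\<lambda>x. \<Sum>A\<in>nodes p T. a A * glue \<Gamma> (\<phi> A) x)}
      else poly2 p)"

(* Continuity is continuity of the extension from the open pieces. At a node on the curve it is
   required on the side to which the node is assigned, since the functions of local_space are in
   general discontinuous across the curve. *)
definition ife_space ::
  "nat \<Rightarrow> (real^2) set \<Rightarrow> (real^2) set set \<Rightarrow> interface \<Rightarrow> (real^2 \<Rightarrow> side) \<Rightarrow> (side \<Rightarrow> real) \<Rightarrow>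
   real \<Rightarrow> (nat \<Rightarrow> real) \<Rightarrow> (real^2 \<Rightarrow> real) set" where
  "ife_space p \<Omega> \<T> \<Gamma> \<nu> \<beta> \<mu> \<omega> =
     {v. v \<in> borel_measurable (lebesgue_on \<Omega>) \<and> integrable (lebesgue_on \<Omega>) (\<lambda>x. (v x)\<^sup>2) \<and>
         (\<forall>T\<in>\<T>. \<exists>w\<in>local_space p \<T> \<Gamma> \<nu> \<beta> \<mu> \<omega> T. \<forall>x\<in>interior T - Gam \<Gamma>. v x = w x) \<and>
         (\<forall>e\<in>edges \<T> - iface_edges \<T> \<Gamma>. \<forall>x\<in>e.
            \<exists>l. (v \<longlongrightarrow> l) (at x within ((\<Union>T\<in>{T\<in>\<T>. e facet_of T}. interior T) - Gam \<Gamma>))) \<and>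
         (\<forall>A\<in>(\<Union>T\<in>\<T>. nodes p T).
            \<exists>l. (v \<longlongrightarrow> l)
              (at A within ((if A \<in> Gam \<Gamma> then side_dom \<Gamma> (\<nu> A) else \<Omega> - Gam \<Gamma>) - skeleton \<T>))) \<and>
         (\<forall>x\<in>frontier \<Omega>. (v \<longlongrightarrow> 0) (at x within (\<Omega> - Gam \<Gamma> - skeleton \<T>)))}"


section \<open>Bilinear form and energy norm\<close>

definition beta_avg :: "(side \<Rightarrow> real) \<Rightarrow> real" where
  "beta_avg \<beta> = (\<beta> Plus + \<beta> Minus) / 2"

definition A_h ::
  "(real^2) set set \<Rightarrow> interface \<Rightarrow> (side \<Rightarrow> real) \<Rightarrow> (real^2 \<Rightarrow> real) \<Rightarrow> (real^2 \<Rightarrow> real) \<Rightarrow> real" where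
  "A_h \<T> \<Gamma> \<beta> u v = (\<Sum>T\<in>\<T>. LINT x:T|lebesgue. coef \<Gamma> \<beta> x * hess_inner u v x)"

(* On edges off the interface the coefficient is constant and stands under the integral. If e lies
   (up to a point) on one side s of the curve, the part of e on the other side is empty or a null
   set; the term for that part is 0, division by zero being 0. *)
definition J_hu ::
  "(real^2) set \<Rightarrow> (real^2) set set \<Rightarrow> interface \<Rightarrow> (side \<Rightarrow> real) \<Rightarrow> real \<Rightarrow>
   (real^2 \<Rightarrow> real) \<Rightarrow> (real^2 \<Rightarrow> real) \<Rightarrow> real" where
  "J_hu \<Omega> \<T> \<Gamma> \<beta> \<sigma>u u v =
     - (\<Sum>e\<in>int_edges \<Omega> \<T>. eint e UNIV (\<lambda>x. eavg_bnn \<T> \<Gamma> \<beta> e u x * ejump_n \<T> \<Gamma> e v x))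
     - (\<Sum>e\<in>int_edges \<Omega> \<T>. eint e UNIV (\<lambda>x. eavg_bnn \<T> \<Gamma> \<beta> e v x * ejump_n \<T> \<Gamma> e u x))
     + (\<Sum>e\<in>int_edges \<Omega> \<T> - iface_edges \<T> \<Gamma>.
          \<sigma>u / diameter e *
            eint e UNIV (\<lambda>x. coef \<Gamma> \<beta> x * ejump_n \<T> \<Gamma> e u x * ejump_n \<T> \<Gamma> e v x))
     + (\<Sum>e\<in>int_edges \<Omega> \<T> \<inter> iface_edges \<T> \<Gamma>. \<Sum>s\<in>{Plus, Minus}.
          \<sigma>u * \<beta> s / elen e (side_dom \<Gamma> s) *
            eint e (side_dom \<Gamma> s) (\<lambda>x. ejump_n \<T> \<Gamma> e u x * ejump_n \<T> \<Gamma> e v x))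
     + (\<Sum>T\<in>iface_elems \<T> \<Gamma>.
          \<sigma>u * beta_avg \<beta> / diameter T * gint \<Gamma> T (\<lambda>x. gjump_n \<T> \<Gamma> u x * gjump_n \<T> \<Gamma> v x))"

definition J_hn ::
  "(real^2) set \<Rightarrow> (real^2) set set \<Rightarrow> interface \<Rightarrow> (side \<Rightarrow> real) \<Rightarrow> real \<Rightarrow> real \<Rightarrow>
   (real^2 \<Rightarrow> real) \<Rightarrow> (real^2 \<Rightarrow> real) \<Rightarrow> real" where
  "J_hn \<Omega> \<T> \<Gamma> \<beta> \<sigma>F \<sigma>n u v =
     (\<Sum>e\<in>int_edges \<Omega> \<T> \<inter> iface_edges \<T> \<Gamma>. \<Sum>s\<in>{Plus, Minus}.
          \<sigma>F * elen e (side_dom \<Gamma> s) * \<beta> s *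
            eint e (side_dom \<Gamma> s) (\<lambda>x. ejump_nn \<T> \<Gamma> e u x * ejump_nn \<T> \<Gamma> e v x))
     + (\<Sum>e\<in>(int_edges \<Omega> \<T> - iface_edges \<T> \<Gamma>) \<inter> edges_of_iface_elems \<T> \<Gamma>.
          \<sigma>F * diameter e *
            eint e UNIV (\<lambda>x. coef \<Gamma> \<beta> x * ejump_nn \<T> \<Gamma> e u x * ejump_nn \<T> \<Gamma> e v x))
     + (\<Sum>e\<in>int_edges \<Omega> \<T> \<inter> iface_edges \<T> \<Gamma>.
          \<sigma>n * beta_avg \<beta> / diameter e ^ 3 *
            eint e UNIV (\<lambda>x. ejump \<T> \<Gamma> e u x * ejump \<T> \<Gamma> e v x))
     + (\<Sum>T\<in>iface_elems \<T> \<Gamma>.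
          \<sigma>n * beta_avg \<beta> / diameter T ^ 3 *
            gint \<Gamma> T (\<lambda>x. gjump \<T> \<Gamma> u x * gjump \<T> \<Gamma> v x))"

definition a_h ::
  "(real^2) set \<Rightarrow> (real^2) set set \<Rightarrow> interface \<Rightarrow> (side \<Rightarrow> real) \<Rightarrow> real \<Rightarrow> real \<Rightarrow> real \<Rightarrow>
   (real^2 \<Rightarrow> real) \<Rightarrow> (real^2 \<Rightarrow> real) \<Rightarrow> real" where
  "a_h \<Omega> \<T> \<Gamma> \<beta> \<sigma>u \<sigma>F \<sigma>n u v =
     A_h \<T> \<Gamma> \<beta> u v + J_hu \<Omega> \<T> \<Gamma> \<beta> \<sigma>u u v + J_hn \<Omega> \<T> \<Gamma> \<beta> \<sigma>F \<sigma>n u v"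

definition norm_h ::
  "(real^2) set \<Rightarrow> (real^2) set set \<Rightarrow> interface \<Rightarrow> (side \<Rightarrow> real) \<Rightarrow> real \<Rightarrow> real \<Rightarrow> real \<Rightarrow>
   (real^2 \<Rightarrow> real) \<Rightarrow> real" where
  "norm_h \<Omega> \<T> \<Gamma> \<beta> \<sigma>u \<sigma>F \<sigma>n v = sqrt (
     (\<Sum>T\<in>\<T>. LINT x:T|lebesgue. coef \<Gamma> \<beta> x * hess_inner v v x)
     + (\<Sum>e\<in>int_edges \<Omega> \<T> - iface_edges \<T> \<Gamma>.
          \<sigma>u / diameter e * eint e UNIV (\<lambda>x. coef \<Gamma> \<beta> x * (ejump_n \<T> \<Gamma> e v x)\<^sup>2))
     + (\<Sum>T\<in>iface_elems \<T> \<Gamma>.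
          \<sigma>u * beta_avg \<beta> / diameter T * gint \<Gamma> T (\<lambda>x. (gjump_n \<T> \<Gamma> v x)\<^sup>2))
     + (\<Sum>e\<in>int_edges \<Omega> \<T> \<inter> iface_edges \<T> \<Gamma>. \<Sum>s\<in>{Plus, Minus}.
          \<sigma>u * \<beta> s / elen e (side_dom \<Gamma> s) *
            eint e (side_dom \<Gamma> s) (\<lambda>x. (ejump_n \<T> \<Gamma> e v x)\<^sup>2))
     + (\<Sum>e\<in>(int_edges \<Omega> \<T> - iface_edges \<T> \<Gamma>) \<inter> edges_of_iface_elems \<T> \<Gamma>.
          \<sigma>F * diameter e * eint e UNIV (\<lambda>x. coef \<Gamma> \<beta> x * (ejump_nn \<T> \<Gamma> e v x)\<^sup>2))
     + (\<Sum>e\<in>int_edges \<Omega> \<T> \<inter> iface_edges \<T> \<Gamma>. \<Sum>s\<in>{Plus, Minus}.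
          \<sigma>F * elen e (side_dom \<Gamma> s) * \<beta> s *
            eint e (side_dom \<Gamma> s) (\<lambda>x. (ejump_nn \<T> \<Gamma> e v x)\<^sup>2))
     + (\<Sum>e\<in>int_edges \<Omega> \<T> \<inter> iface_edges \<T> \<Gamma>.
          \<sigma>n * beta_avg \<beta> / diameter e ^ 3 * eint e UNIV (\<lambda>x. (ejump \<T> \<Gamma> e v x)\<^sup>2))
     + (\<Sum>T\<in>iface_elems \<T> \<Gamma>.
          \<sigma>n * beta_avg \<beta> / diameter T ^ 3 * gint \<Gamma> T (\<lambda>x. (gjump \<T> \<Gamma> v x)\<^sup>2)))"

end

theory Submission
  imports Defs
begin

text \<open>
  The mesh is fixed, so all constants may depend on it; what has to be uniform is the dependence on
  the interface. By Young's inequality it suffices to control the average of \<open>\<beta> \<partial>\<^sub>n\<^sub>n v\<close> on every edge,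
  or on the part of it on one side of \<open>\<Gamma>\<close>, by the energy and the jump penalties. As \<open>p \<le> 3\<close>, the function
  \<open>\<partial>\<^sub>n\<^sub>n v\<close> is piecewise affine, and an affine function on a segment is controlled by its square integral
  over a flat triangle (a tent) erected over the segment, whatever the length of the segment. The
  disjointness of the normal segments of length \<open>2r\<close> gives \<open>\<Gamma>\<close> reach \<open>r\<close>, hence \<open>\<Gamma>\<close> cannot meet the tents
  on both sides of a segment that it does not cut. So one of the two elements controls its trace
  independently of how \<open>\<Gamma>\<close> cuts it, and the other trace differs from this one by a jump that is penalized
  with the weight \<open>\<sigma>F\<close>. If an edge is contained in \<open>\<Gamma>\<close>, both tents avoid \<open>\<Gamma>\<close> and lie, by the Jordan curve
  theorem, on different sides of it; then both traces are controlled, and the jump of \<open>\<partial>\<^sub>n v\<close> across the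
  edge is the one penalized along \<open>\<Gamma>\<close>.
\<close>

section \<open>Polynomials of two variables\<close>

text \<open>Pieces of cut edges may be arbitrarily short, so the weights have to match: the tent
  estimate loses the inverse square of the length of a piece, Young's inequality with weight
  \<delta> times that length regains it, and the penalty weights of the norm are what remains. The
  slope of the tents depends on the mesh alone, which makes the constants uniform in the interface.

  Each edge term is bounded by the whole norm rather than by the neighbouring elements; summation
  then costs the number of interior edges, again a constant of the mesh. The bound has the form
  \<open>\<delta> * C1 + C2 / (\<delta> * \<sigma>u)\<close> with \<open>1 / \<sigma>F\<close>
  inside \<open>C1\<close>: a small \<delta> absorbs any positive \<open>\<sigma>F\<close>, at the
  price of a larger \<open>\<sigma>u\<close>.

  Traces are given by \<open>Lim\<close> and penalties by Lebesgue integrals, both total functions.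
  Traces must therefore be identified with continuous functions, and integrability established,
  before a penalty can be used as an upper bound. This is laborious for edges on \<Gamma>, whose
  jump is penalized through the parametrization of \<Gamma> and not through that of the
  edge.\<close>

lemma poly2_monom:
  assumes "i + j \<le> p"
  shows "(\<lambda>x. c * (x$1)^i * (x$2)^j) \<in> poly2 p"
proof -
  have "(\<Sum>k\<le>p. \<Sum>l\<le>p-k. (if k = i \<and> l = j then c else 0) * y^k * z^l) = c * y^i * z^j" for y z :: real
  proof -
    have "(\<Sum>l\<le>p-k. (if k = i \<and> l = j then c else 0) * y^k * z^l) =
        (if k = i then c * y^i * z^j else 0)" for k
    proof (cases "k = i")
      case True
      have "(\<Sum>l\<le>p-k. (if k = i \<and> l = j then c else 0) * y^k * z^l) =
          (\<Sum>l\<le>p-k. if l = j then c * y^i * z^j else 0)"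
        using True by (intro sum.cong) auto
      also have "\<dots> = c * y^i * z^j" using True assms by (subst sum.delta) auto
      finally show ?thesis using True by simp
    qed auto
    then show ?thesis using assms by simp
  qed
  then show ?thesis unfolding poly2_def
    by (intro CollectI exI[of _ "\<lambda>k l. if k = i \<and> l = j then c else 0"]) (simp add: fun_eq_iff)
qed

lemma poly2_add: "f \<in> poly2 p \<Longrightarrow> g \<in> poly2 p \<Longrightarrow> (\<lambda>x. f x + g x) \<in> poly2 p"
proof -
  assume "f \<in> poly2 p" "g \<in> poly2 p"
  then obtain a b where
    f: "f = (\<lambda>x. \<Sum>i\<le>p. \<Sum>j\<le>p - i. a i j * (x $ 1) ^ i * (x $ 2) ^ j)" and
    g: "g = (\<lambda>x. \<Sum>i\<le>p. \<Sum>j\<le>p - i. b i j * (x $ 1) ^ i * (x $ 2) ^ j)"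
    unfolding poly2_def by blast
  have "(\<lambda>x. f x + g x) =
      (\<lambda>x. \<Sum>i\<le>p. \<Sum>j\<le>p - i. (a i j + b i j) * (x $ 1) ^ i * (x $ 2) ^ j)"
    unfolding f g by (simp add: sum.distrib algebra_simps)
  then show ?thesis unfolding poly2_def by (intro CollectI exI)
qed

lemma poly2_const: "(\<lambda>x. c) \<in> poly2 p"
  using poly2_monom[of 0 0 p c] by simp

lemma poly2_sum: "(\<And>i. i \<in> I \<Longrightarrow> f i \<in> poly2 p) \<Longrightarrow> (\<lambda>x. \<Sum>i\<in>I. f i x) \<in> poly2 p"
proof (induction I rule: infinite_finite_induct)
  case (insert i I)
  then show ?case using poly2_add[of "f i" p "\<lambda>x. \<Sum>i\<in>I. f i x"] by simp
qed (auto simp: poly2_const)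

text \<open>The monomials carry their coefficient, so scalar multiples need no case of their own and
  the zero polynomial is the monomial with coefficient 0.\<close>

lemma poly2_induct:
  assumes "f \<in> poly2 p"
    and mono: "\<And>c i j. i + j \<le> p \<Longrightarrow> P (\<lambda>x. c * (x$1)^i * (x$2)^j)"
    and add: "\<And>f g. P f \<Longrightarrow> P g \<Longrightarrow> P (\<lambda>x. f x + g x)"
  shows "P f"
proof -
  have zero: "P (\<lambda>x. 0)" using mono[of 0 0 0] by simp
  have S: "P (\<lambda>x. \<Sum>i\<in>I. g i x)" if "finite I" "\<And>i. i \<in> I \<Longrightarrow> P (g i)"
    for I :: "nat set" and g :: "nat \<Rightarrow> real^2 \<Rightarrow> real"
    using that
  proof (induction I rule: finite_induct)
    case (insert i I)
    then show ?case using add[of "g i" "\<lambda>x. \<Sum>i\<in>I. g i x"] by simp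
  qed (simp add: zero)
  from assms(1) obtain a where
    f: "f = (\<lambda>x. \<Sum>i\<le>p. \<Sum>j\<le>p - i. a i j * (x $ 1) ^ i * (x $ 2) ^ j)"
    unfolding poly2_def by blast
  show ?thesis unfolding f
    by (intro S mono) auto
qed

lemma poly2_mono: "f \<in> poly2 p \<Longrightarrow> p \<le> q \<Longrightarrow> f \<in> poly2 q"
  by (erule poly2_induct) (auto intro: poly2_monom poly2_add)

lemma poly2_mult: "f \<in> poly2 p \<Longrightarrow> g \<in> poly2 q \<Longrightarrow> (\<lambda>x. f x * g x) \<in> poly2 (p + q)"
proof (induction f rule: poly2_induct[consumes 1])
  case (1 c i j)
  from 1(2) show ?case
  proof (induction g rule: poly2_induct[consumes 1])
    case (1 d k l)
    have "(\<lambda>x::real^2. (c * d) * (x$1)^(i+k) * (x$2)^(j+l)) \<in> poly2 (p+q)"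
      using 1 \<open>i + j \<le> p\<close> by (intro poly2_monom) auto
    then show ?case by (simp add: power_add mult_ac)
  next
    case (2 f g)
    then show ?case using poly2_add[OF 2] by (simp add: distrib_left)
  qed
next
  case (2 f1 f2)
  then show ?case using poly2_add[of "\<lambda>x. f1 x * g x" "p+q" "\<lambda>x. f2 x * g x"]
    by (simp add: distrib_right)
qed

lemma poly2_cmult: "f \<in> poly2 p \<Longrightarrow> (\<lambda>x. c * f x) \<in> poly2 p"
  using poly2_mult[OF poly2_const[of c 0]] by simp

lemma poly2_power: "f \<in> poly2 p \<Longrightarrow> (\<lambda>x. f x ^ n) \<in> poly2 (n * p)"
  by (induction n) (auto simp: poly2_const intro: poly2_mult)

lemma poly2_affine: "(\<lambda>x. c + d * x$1 + e * x$2) \<in> poly2 1"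
  using poly2_add[OF poly2_add[OF poly2_const[of c 1] poly2_monom[of 1 0 1 d]] poly2_monom[of 0 1 1 e]]
  by simp

lemma poly2_1E:
  assumes "f \<in> poly2 1"
  obtains c d e where "f = (\<lambda>x. c + d * x$1 + e * x$2)"
proof -
  from assms obtain a where
    f: "f = (\<lambda>x. \<Sum>i\<le>(1::nat). \<Sum>j\<le>1 - i. a i j * (x $ 1) ^ i * (x $ 2) ^ j)"
    unfolding poly2_def by blast
  show ?thesis
    by (rule that[of "a 0 0" "a 1 0" "a 0 1"]) (simp add: f fun_eq_iff)
qed

text \<open>Pulls a polynomial back to the reference triangle, which reduces uniqueness of the
  Lagrange shape functions to fixed nodes.\<close>

lemma poly2_compose_affine:
  assumes "f \<in> poly2 p"
  shows "(\<lambda>y. f (a + y$1 *\<^sub>R b + y$2 *\<^sub>R c)) \<in> poly2 p"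
  using assms
proof (induction f rule: poly2_induct[consumes 1])
  case (1 k i j)
  have "(\<lambda>y::real^2. (a$1 + b$1 * y$1 + c$1 * y$2)^i) \<in> poly2 i"
    using poly2_power[OF poly2_affine] by simp
  moreover have "(\<lambda>y::real^2. (a$2 + b$2 * y$1 + c$2 * y$2)^j) \<in> poly2 j"
    using poly2_power[OF poly2_affine] by simp
  ultimately have "(\<lambda>y::real^2. k * ((a$1 + b$1 * y$1 + c$1 * y$2)^i * (a$2 + b$2 * y$1 + c$2 * y$2)^j)) \<in> poly2 p"
    using 1 by (intro poly2_cmult poly2_mono[OF poly2_mult])
  then show ?case by (simp add: mult_ac)
qed (rule poly2_add)

lemma poly2_derivatives:
  assumes "f \<in> poly2 p"
  shows "(\<forall>x. f differentiable (at x)) \<and> (\<forall>i. pd i f \<in> poly2 (p - 1))"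
  using assms
proof (induction f rule: poly2_induct[consumes 1])
  case (1 c i j)
  let ?f = "\<lambda>x::real^2. c * (x$1)^i * (x$2)^j"
  have D: "(?f has_derivative (\<lambda>h. c * (real i * h$1 * (x$1)^(i-1)) * (x$2)^j
        + c * (x$1)^i * (real j * h$2 * (x$2)^(j-1)))) (at x)" for x
    by (auto intro!: derivative_eq_intros bounded_linear_imp_has_derivative[OF bounded_linear_vec_nth]
        simp: fun_eq_iff algebra_simps)
  have fd: "frechet_derivative ?f (at x) = (\<lambda>h. c * (real i * h$1 * (x$1)^(i-1)) * (x$2)^j
        + c * (x$1)^i * (real j * h$2 * (x$2)^(j-1)))" for x
    using frechet_derivative_at[OF D] by simp
  have p1: "pd 1 ?f = (\<lambda>x. (c * real i) * (x$1)^(i-1) * (x$2)^j)"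
    by (simp add: pd_def fd fun_eq_iff axis_def)
  have p2: "pd 2 ?f = (\<lambda>x. (c * real j) * (x$1)^i * (x$2)^(j-1))"
    by (simp add: pd_def fd fun_eq_iff axis_def)
  \<comment> \<open>For \<open>i = 0\<close> the truncated exponent \<open>i - 1\<close> would not
    lower the degree, but then the coefficient \<open>c * real i\<close> vanishes; hence the
    split.\<close>
  have "pd 1 ?f \<in> poly2 (p - 1)"
    unfolding p1 using 1 poly2_const[of 0 "p - 1"] poly2_monom[of "i - 1" j "p - 1" "c * real i"]
    by (cases "i = 0") auto
  moreover have "pd 2 ?f \<in> poly2 (p - 1)"
    unfolding p2 using 1 poly2_const[of 0 "p - 1"] poly2_monom[of i "j - 1" "p - 1" "c * real j"]
    by (cases "j = 0") auto
  moreover have "\<forall>x. ?f differentiable (at x)"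
    using D by (auto simp: differentiable_def)
  ultimately show ?case by (auto simp: forall_2)
next
  case (2 f g)
  have "pd i (\<lambda>x. f x + g x) = (\<lambda>x. pd i f x + pd i g x)" for i
  proof
    fix x
    have "((\<lambda>x. f x + g x) has_derivative (\<lambda>h. frechet_derivative f (at x) h + frechet_derivative g (at x) h)) (at x)"
      using 2 by (intro has_derivative_add) (auto simp: frechet_derivative_works[symmetric])
    from frechet_derivative_at[OF this] show "pd i (\<lambda>x. f x + g x) x = pd i f x + pd i g x"
      by (simp add: pd_def fun_eq_iff)
  qed
  with 2 show ?case by (auto intro: poly2_add differentiable_add)
qed

lemma poly2_pd: "f \<in> poly2 p \<Longrightarrow> pd i f \<in> poly2 (p - 1)"
  using poly2_derivatives by blast

lemma poly2_continuous: "f \<in> poly2 p \<Longrightarrow> continuous_on UNIV f"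
  using poly2_derivatives by (simp add: continuous_at_imp_continuous_on differentiable_imp_continuous_within)

lemma poly2_dnn:
  assumes "f \<in> poly2 p" "p \<le> 3" shows "dnn n f \<in> poly2 1"
proof -
  have "pd i (pd j f) \<in> poly2 1" for i j
    by (rule poly2_mono[OF poly2_pd[OF poly2_pd[OF assms(1)]]]) (use assms(2) in auto)
  then have "(\<lambda>x. \<Sum>i\<in>UNIV. \<Sum>j\<in>UNIV. n $ i * n $ j * pd i (pd j f) x) \<in> poly2 1"
    by (intro poly2_sum poly2_cmult)
  then show ?thesis unfolding dnn_def .
qed

lemma poly2_dn: "f \<in> poly2 p \<Longrightarrow> continuous_on UNIV (dn n f)"
  unfolding dn_def
  by (intro continuous_intros poly2_continuous[OF poly2_pd])

lemma poly2_hess: "f \<in> poly2 p \<Longrightarrow> continuous_on UNIV (hess_inner f f)"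
  unfolding hess_inner_def
  by (intro continuous_intros poly2_continuous[OF poly2_pd[OF poly2_pd]])

text \<open>Cauchy-Schwarz for the Frobenius product of the Hessian with the matrix of entries
  \<open>n $ i * n $ j\<close>, whose Frobenius norm is the squared length of \<open>n\<close>. The
  four entries are nested pairs so that the inner product of product spaces applies.\<close>

lemma dnn_sq_le_hess:
  assumes "norm n = 1"
  shows "(dnn n f x)\<^sup>2 \<le> hess_inner f f x"
proof -
  have n: "(n$1)\<^sup>2 + (n$2)\<^sup>2 = 1"
    using assms by (simp add: norm_vec_def L2_set_def sum_2)
  define A where "A = (\<lambda>i j. pd i (pd j f) x)"
  have "(dnn n f x) = (n$1)\<^sup>2 * A 1 1 + n$1*n$2 * A 1 2 + n$2*n$1 * A 2 1 + (n$2)\<^sup>2 * A 2 2"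
    by (simp add: dnn_def sum_2 A_def power2_eq_square)
  also have "\<dots> = ((n$1)\<^sup>2, n$1*n$2, n$2*n$1, (n$2)\<^sup>2) \<bullet> (A 1 1, A 1 2, A 2 1, A 2 2)"
    by (simp add: inner_prod_def)
  finally have "(dnn n f x)\<^sup>2 \<le> (norm ((n$1)\<^sup>2, n$1*n$2, n$2*n$1, (n$2)\<^sup>2))\<^sup>2 * (norm (A 1 1, A 1 2, A 2 1, A 2 2))\<^sup>2"
    by (metis Cauchy_Schwarz_ineq power2_norm_eq_inner)
  also have "(norm ((n$1)\<^sup>2, n$1*n$2, n$2*n$1, (n$2)\<^sup>2))\<^sup>2 = ((n$1)\<^sup>2 + (n$2)\<^sup>2)\<^sup>2"
    by (simp add: power2_norm_eq_inner inner_prod_def) (simp add: power2_eq_square power4_eq_xxxx algebra_simps)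
  also have "(norm (A 1 1, A 1 2, A 2 1, A 2 2))\<^sup>2 = hess_inner f f x"
    by (simp add: power2_norm_eq_inner inner_prod_def hess_inner_def sum_2 A_def)
  finally show ?thesis by (simp add: n)
qed

text \<open>\<open>frechet_derivative\<close> chooses among the derivatives at the point, so it is
  enough that both functions have the same ones. The conclusion holds at every point of
  \<open>S\<close> and can therefore be iterated.\<close>

lemma pd_cong_open:
  assumes "open S" "x \<in> S" "\<And>y. y \<in> S \<Longrightarrow> f y = g y"
  shows "pd i f x = pd i g x"
proof -
  have "(f has_derivative D) (at x) \<longleftrightarrow> (g has_derivative D) (at x)" for D
  proof
    assume "(f has_derivative D) (at x)"
    then show "(g has_derivative D) (at x)"
      by (rule has_derivative_transform_within_open[OF _ assms(1,2)]) (simp add: assms(3))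
  next
    assume "(g has_derivative D) (at x)"
    then show "(f has_derivative D) (at x)"
      by (rule has_derivative_transform_within_open[OF _ assms(1,2)]) (simp add: assms(3))
  qed
  then show ?thesis by (simp add: pd_def frechet_derivative_def)
qed

lemma dn_cong_open:
  assumes "open S" "x \<in> S" "\<And>y. y \<in> S \<Longrightarrow> f y = g y"
  shows "dn n f x = dn n g x"
  using pd_cong_open[OF assms] by (simp add: dn_def)

lemma pd_pd_cong_open:
  assumes "open S" "x \<in> S" "\<And>y. y \<in> S \<Longrightarrow> f y = g y"
  shows "pd i (pd j f) x = pd i (pd j g) x"
  by (rule pd_cong_open[OF assms(1,2)]) (rule pd_cong_open[OF assms(1) _ assms(3)])

lemma dnn_cong_open:
  assumes "open S" "x \<in> S" "\<And>y. y \<in> S \<Longrightarrow> f y = g y"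
  shows "dnn n f x = dnn n g x"
  using pd_pd_cong_open[OF assms] by (simp add: dnn_def)

lemma hess_cong_open:
  assumes "open S" "x \<in> S" "\<And>y. y \<in> S \<Longrightarrow> f y = g y"
  shows "hess_inner f f x = hess_inner g g x"
  using pd_pd_cong_open[OF assms] by (simp add: hess_inner_def)

lemma hess_inner_nonneg: "0 \<le> hess_inner f f x"
  unfolding hess_inner_def by (intro sum_nonneg) simp

section \<open>Triangles and Lagrange interpolation\<close>

text \<open>The determinant of the matrix with columns \<open>u\<close> and
  \<open>v\<close>.\<close>

definition crs :: "real^2 \<Rightarrow> real^2 \<Rightarrow> real" where
  "crs u v = u$1 * v$2 - u$2 * v$1"

lemma crs_cramer: "crs u v *\<^sub>R w = crs w v *\<^sub>R u + crs u w *\<^sub>R v"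
  by (simp add: vec_eq_iff forall_2 crs_def algebra_simps)

lemma crs_zero_parallel:
  assumes "crs u w = 0" "u \<noteq> 0" shows "\<exists>k. w = k *\<^sub>R u"
proof (cases "u$1 = 0")
  case True
  then have "u$2 \<noteq> 0" using assms by (auto simp: vec_eq_iff forall_2)
  with True assms show ?thesis
    by (intro exI[of _ "w$2/u$2"]) (auto simp: crs_def vec_eq_iff forall_2)
next
  case False
  then show ?thesis using assms
    by (intro exI[of _ "w$1/u$1"]) (auto simp: crs_def vec_eq_iff forall_2 field_simps)
qed

lemma crs_zero_collinear:
  assumes "crs (b - a) (c - a) = 0" shows "collinear {a, b, c}"
proof (cases "b = a")
  case False
  obtain k where "c - a = k *\<^sub>R (b - a)"
    using crs_zero_parallel[OF assms] False by auto
  then have "c = a + k *\<^sub>R (b - a)" by (simp add: algebra_simps)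
  then show ?thesis
    unfolding collinear_alt
    by (intro exI[of _ a] exI[of _ "b - a"]) (auto intro: exI[of _ 0] exI[of _ 1])
qed simp

lemma two_simplexE:
  assumes "2 simplex (T :: (real^2) set)"
  obtains a b c where "T = convex hull {a, b, c}" "crs (b - a) (c - a) \<noteq> 0" "vertices T = {a, b, c}"
    "a \<noteq> b" "a \<noteq> c" "b \<noteq> c" "\<not> affine_dependent {a, b, c}"
proof -
  obtain C where C: "finite C" "\<not> affine_dependent C" "int (card C) = 3" "T = convex hull C"
    using assms unfolding simplex by auto
  then have "card C = 3" by simp
  then obtain a b c where abc: "C = {a, b, c}" "a \<noteq> b" "a \<noteq> c" "b \<noteq> c"
    by (auto simp: card_3_iff)
  have nc: "\<not> collinear {a, b, c}"
    using C(2) abc by (simp add: collinear_3_eq_affine_dependent)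
  have "vertices T = {a, b, c}"
    unfolding vertices_def C(4) using extreme_point_of_convex_hull_affine_independent[OF C(2)] abc
    by auto
  then show ?thesis
    using that[of a b c] nc abc C crs_zero_collinear[where a = a and b = b and c = c] by auto
qed

text \<open>The nodal conditions form a linear system for six or ten coefficients, small enough to
  be solved outright. In degree three the nodes on the axes first eliminate the pure powers, and the
  three remaining nodes then determine the mixed ones.\<close>

lemma lagrange_unisolvent_ref:
  assumes F: "F \<in> poly2 p" and p: "p = 2 \<or> p = 3"
    and z: "\<And>i j. i + j \<le> p \<Longrightarrow> F (vector [real i / real p, real j / real p]) = 0"
  shows "F x = 0"
proof -
  from F obtain a where
    F: "F = (\<lambda>x. \<Sum>i\<le>p. \<Sum>j\<le>p - i. a i j * (x $ 1) ^ i * (x $ 2) ^ j)"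
    unfolding poly2_def by blast
  have z': "(\<Sum>k\<le>p. \<Sum>l\<le>p - k. a k l * (real i / real p) ^ k * (real j / real p) ^ l) = 0"
    if "i + j \<le> p" for i j
    using z[OF that] unfolding F by simp
  from p show ?thesis
  proof
    assume p: "p = 2"
    have *: "i + j \<le> 2 \<Longrightarrow> a 0 0 + a 0 1 * (real j / 2) + a 0 2 * (real j / 2)^2 + a 1 0 * (real i / 2)
        + a 1 1 * (real i / 2) * (real j / 2) + a 2 0 * (real i / 2)^2 = 0" for i j
      using z'[of i j] unfolding p by (simp add: eval_nat_numeral algebra_simps)
    note E = *[of 0 0, simplified] *[of 1 0, simplified] *[of 2 0, simplified]
       *[of 0 1, simplified] *[of 0 2, simplified] *[of 1 1, simplified]
    have "a 0 0 = 0" "a 0 1 = 0" "a 1 0 = 0" "a 2 0 = 0" "a 0 2 = 0" "a 1 1 = 0"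
      using E by (simp_all add: power2_eq_square)
    then show ?thesis unfolding F p by (simp add: eval_nat_numeral)
  next
    assume p: "p = 3"
    have *: "i + j \<le> 3 \<Longrightarrow> a 0 0 + a 0 1 * (real j / 3) + a 0 2 * (real j / 3)^2 + a 0 3 * (real j / 3)^3
        + a 1 0 * (real i / 3) + a 1 1 * (real i / 3) * (real j / 3) + a 1 2 * (real i / 3) * (real j / 3)^2
        + a 2 0 * (real i / 3)^2 + a 2 1 * (real i / 3)^2 * (real j / 3) + a 3 0 * (real i / 3)^3 = 0" for i j
      using z'[of i j] unfolding p by (simp add: eval_nat_numeral algebra_simps)
    have a0: "a 0 0 = 0" using *[of 0 0] by simp
    have a1: "a 1 0 = 0" "a 2 0 = 0" "a 3 0 = 0"
      using *[of 1 0] *[of 2 0] *[of 3 0] a0 by (simp_all add: power2_eq_square power3_eq_cube)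
    have a2: "a 0 1 = 0" "a 0 2 = 0" "a 0 3 = 0"
      using *[of 0 1] *[of 0 2] *[of 0 3] a0 by (simp_all add: power2_eq_square power3_eq_cube)
    have a3: "a 1 1 = 0" "a 1 2 = 0" "a 2 1 = 0"
      using *[of 1 1] *[of 1 2] *[of 2 1] a0 a1 a2 by (simp_all add: power2_eq_square power3_eq_cube)
    show ?thesis unfolding F p using a0 a1 a2 a3 by (simp add: eval_nat_numeral)
  qed
qed

text \<open>The product formula in barycentric coordinates: each factor \<open>g\<close> equals 1 on
  its own level and vanishes on all lower ones. As the indices of a node add up to \<open>p\<close>,
  a different node has a smaller index in some coordinate, and that factor is zero.\<close>

lemma lagrange_basis:
  assumes "i + j + k = p" "0 < p"
    and "l1 \<in> poly2 1" "l2 \<in> poly2 1" "l3 \<in> poly2 1"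
  obtains f where "f \<in> poly2 p"
    "\<And>x i' j' k'. l1 x = real i' / p \<Longrightarrow> l2 x = real j' / p \<Longrightarrow> l3 x = real k' / p \<Longrightarrow> i' + j' + k' = p
       \<Longrightarrow> f x = (if i' = i \<and> j' = j then 1 else 0)"
proof -
  define g where "g = (\<lambda>n l (x::real^2). \<Prod>m<n. (real p * l x - real m) / (real n - real m))"
  have gp: "g n l \<in> poly2 n" if "l \<in> poly2 1" for n l
  proof -
    have "(\<lambda>x. \<Prod>m<n'. (real p * l x - real m) / (real n - real m)) \<in> poly2 n'" for n'
    proof (induction n')
      case (Suc n')
      have "(\<lambda>x. (real p * l x - real n') / (real n - real n')) \<in> poly2 1"
        using poly2_add[OF poly2_cmult[OF that, of "real p / (real n - real n')"]
            poly2_const[of "- real n' / (real n - real n')"]]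
        by (simp add: diff_divide_distrib)
      from poly2_mult[OF Suc this] show ?case by simp
    qed (simp add: poly2_const)
    then show ?thesis unfolding g_def .
  qed
  have gv: "g n l x = 1" if "l x = real n / p" for n l x
    unfolding g_def using that \<open>0 < p\<close> by (intro prod.neutral) auto
  have g0: "g n l x = 0" if "l x = real n' / p" "n' < n" for n n' l x
    unfolding g_def using that \<open>0 < p\<close> by (intro prod_zero bexI[of _ n']) auto
  show ?thesis
  proof (rule that[of "\<lambda>x. g i l1 x * g j l2 x * g k l3 x"])
    show "(\<lambda>x. g i l1 x * g j l2 x * g k l3 x) \<in> poly2 p"
      using poly2_mult[OF poly2_mult[OF gp[OF assms(3)] gp[OF assms(4)]] gp[OF assms(5)]] assms(1) by auto
    fix x i' j' k' assume a: "l1 x = real i' / p" "l2 x = real j' / p" "l3 x = real k' / p" "i' + j' + k' = p"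
    consider "i' = i \<and> j' = j \<and> k' = k" | "\<not> (i' = i \<and> j' = j)" "i' < i" |
       "\<not> (i' = i \<and> j' = j)" "j' < j" | "\<not> (i' = i \<and> j' = j)" "k' < k"
      using a(4) assms(1) by linarith
    then show "g i l1 x * g j l2 x * g k l3 x = (if i' = i \<and> j' = j then 1 else 0)"
    proof cases
      case 1
      then show ?thesis using gv[of l1 x i] gv[of l2 x j] gv[of l3 x k] a by simp
    next
      case 2
      then show ?thesis using g0[of l1 x i' i] a(1) 2(2) by simp
    next
      case 3
      then show ?thesis using g0[of l2 x j' j] a(2) 3(2) by simp
    next
      case 4
      then show ?thesis using g0[of l3 x k' k] a(3) 4(2) by simp
    qed
  qed
qed

text \<open>\<open>lagrange\<close> is a definite description, so both existence and uniqueness of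
  the shape function have to be established before anything is known about it.\<close>

lemma lagrange_poly2:
  assumes T: "2 simplex T" and p: "p \<in> {2, 3}" and A: "A \<in> nodes p T"
  shows "lagrange p T A \<in> poly2 p"
proof -
  obtain a b c where abc: "T = convex hull {a, b, c}" and D0: "crs (b - a) (c - a) \<noteq> 0"
    and V: "vertices T = {a, b, c}" and ne: "a \<noteq> b" "a \<noteq> c" "b \<noteq> c"
    using two_simplexE[OF T] .
  define D where "D = crs (b - a) (c - a)"
  \<comment> \<open>Barycentric coordinates of \<open>b\<close> and \<open>c\<close> by Cramer's
    rule; the one of \<open>a\<close> completes their sum to 1.\<close>
  define lb where "lb = (\<lambda>x. crs (x - a) (c - a) / D)"
  define lc where "lc = (\<lambda>x. crs (b - a) (x - a) / D)"
  define la where "la = (\<lambda>x. 1 - lb x - lc x)"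
  have p0: "0 < p" using p by auto
  have lbp: "lb \<in> poly2 1"
  proof -
    have "lb = (\<lambda>x. (- a$1 * (c-a)$2 + a$2 * (c-a)$1)/D + ((c-a)$2 / D) * x$1 + (- (c-a)$1 / D) * x$2)"
      by (simp add: lb_def crs_def fun_eq_iff diff_divide_distrib add_divide_distrib algebra_simps)
    then show ?thesis by (simp only: poly2_affine)
  qed
  have lcp: "lc \<in> poly2 1"
  proof -
    have "lc = (\<lambda>x. (- a$2 * (b-a)$1 + a$1 * (b-a)$2)/D + (- (b-a)$2 / D) * x$1 + ((b-a)$1 / D) * x$2)"
      by (simp add: lc_def crs_def fun_eq_iff diff_divide_distrib add_divide_distrib algebra_simps)
    then show ?thesis by (simp only: poly2_affine)
  qed
  have lap: "la \<in> poly2 1"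
    using poly2_add[OF poly2_const[of 1 1] poly2_add[OF poly2_cmult[OF lbp, of "-1"] poly2_cmult[OF lcp, of "-1"]]]
    by (simp add: la_def algebra_simps)
  have rep: "a + lb x *\<^sub>R (b - a) + lc x *\<^sub>R (c - a) = x" for x
  proof -
    have "x - a = (1/D) *\<^sub>R (D *\<^sub>R (x - a))" using D0 D_def by simp
    also have "\<dots> = lb x *\<^sub>R (b - a) + lc x *\<^sub>R (c - a)"
      unfolding D_def crs_cramer[of "b-a" "c-a" "x-a"] by (simp add: lb_def lc_def D_def scaleR_add_right)
    finally show ?thesis by (simp add: algebra_simps)
  qed
  have lbv: "lb (a + s *\<^sub>R (b - a) + t *\<^sub>R (c - a)) = s" for s t
  proof -
    have "crs (s *\<^sub>R (b - a) + t *\<^sub>R (c - a)) (c - a) = s * D"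
      by (simp add: crs_def D_def algebra_simps)
    then show ?thesis using D0 by (simp add: lb_def D_def add.assoc)
  qed
  have lcv: "lc (a + s *\<^sub>R (b - a) + t *\<^sub>R (c - a)) = t" for s t
  proof -
    have "crs (b - a) (s *\<^sub>R (b - a) + t *\<^sub>R (c - a)) = t * D"
      by (simp add: crs_def D_def algebra_simps)
    then show ?thesis using D0 by (simp add: lc_def D_def add.assoc)
  qed
  define nd where "nd = (\<lambda>i j. a + (real i / p) *\<^sub>R (b - a) + (real j / p) *\<^sub>R (c - a))"
  have N: "nodes p T = {nd i j | i j. i + j \<le> p}"
  proof -
    have eq: "(\<Sum>v\<in>vertices T. (real (k v) / real p) *\<^sub>R v) = nd (k b) (k c)" if "k a + k b + k c = p" for k
    proof -
      have "real (k a) = real p - real (k b) - real (k c)" using that by linarith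
      then have "real (k a) / p = 1 - real (k b) / p - real (k c) / p"
        using p0 by (simp add: diff_divide_distrib)
      moreover have "(\<Sum>v\<in>vertices T. (real (k v) / real p) *\<^sub>R v) =
          (real (k a) / p) *\<^sub>R a + (real (k b) / p) *\<^sub>R b + (real (k c) / p) *\<^sub>R c"
        unfolding V using ne by simp
      ultimately show ?thesis by (simp add: nd_def scaleR_diff_left scaleR_diff_right)
    qed
    have s: "(\<Sum>v\<in>vertices T. k v) = k a + k b + k c" for k :: "real^2 \<Rightarrow> nat"
      unfolding V using ne by simp
    show ?thesis
    proof (intro equalityI subsetI)
      fix x assume "x \<in> nodes p T"
      then obtain k where k: "x = (\<Sum>v\<in>vertices T. (real (k v) / real p) *\<^sub>R v)" "k a + k b + k c = p"
        unfolding nodes_def s by blast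
      then have "x = nd (k b) (k c)" "k b + k c \<le> p" using eq[OF k(2)] by auto
      then show "x \<in> {nd i j | i j. i + j \<le> p}" by blast
    next
      fix x assume "x \<in> {nd i j | i j. i + j \<le> p}"
      then obtain i j where ij: "x = nd i j" "i + j \<le> p" by blast
      define k where "k = (\<lambda>v. if v = a then p - i - j else if v = b then i else j)"
      have "k a + k b + k c = p" "k b = i" "k c = j" using ne ij by (auto simp: k_def)
      then show "x \<in> nodes p T"
        unfolding nodes_def s using eq[of k] ij by (auto intro!: exI[of _ k])
    qed
  qed
  obtain i j where ij: "A = nd i j" "i + j \<le> p" using A N by blast
  have ndv: "lb (nd i j) = real i / p" "lc (nd i j) = real j / p" for i j
    by (simp_all add: nd_def lbv lcv)
  have nda: "la (nd i j) = real (p - i - j) / p" if "i + j \<le> p" for i j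
    using that p0 by (simp add: la_def ndv of_nat_diff field_simps)
  have nd_eq: "nd i' j' = nd i j \<longleftrightarrow> i' = i \<and> j' = j" for i' j' i j
    using ndv[of i j] ndv[of i' j'] p0 by auto
  obtain f where f: "f \<in> poly2 p" and fv: "\<And>x i' j' k'. lb x = real i' / p \<Longrightarrow> lc x = real j' / p \<Longrightarrow>
       la x = real k' / p \<Longrightarrow> i' + j' + k' = p \<Longrightarrow> f x = (if i' = i \<and> j' = j then 1 else 0)"
    using lagrange_basis[of i j "p - i - j" p lb lc la] ij(2) p0 lbp lcp lap by (smt (verit) le_add_diff_inverse diff_diff_left)
  have fB: "f B = (if B = A then 1 else 0)" if "B \<in> nodes p T" for B
  proof -
    obtain i' j' where B: "B = nd i' j'" "i' + j' \<le> p" using \<open>B \<in> nodes p T\<close> N by blast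
    show ?thesis using fv[of B i' j' "p - i' - j'"] B nda ndv nd_eq ij by auto
  qed
  have uniq: "g = f" if g: "g \<in> poly2 p" "\<And>B. B \<in> nodes p T \<Longrightarrow> g B = (if B = A then 1 else 0)" for g
  proof
    fix x
    \<comment> \<open>The difference of the two candidates in reference coordinates, where it
      vanishes at all lattice points.\<close>
    define F where "F = (\<lambda>y::real^2. g (a + y$1 *\<^sub>R (b - a) + y$2 *\<^sub>R (c - a))
         - f (a + y$1 *\<^sub>R (b - a) + y$2 *\<^sub>R (c - a)))"
    have "F \<in> poly2 p"
      using poly2_add[OF poly2_compose_affine[OF g(1)] poly2_cmult[OF poly2_compose_affine[OF f], of "-1"]]
      by (simp add: F_def)
    moreover have "F (vector [real i / real p, real j / real p]) = 0" if "i + j \<le> p" for i j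
    proof -
      have "nd i j \<in> nodes p T" using that N by blast
      then have "g (nd i j) = f (nd i j)" using g(2) fB by simp
      then show ?thesis by (simp add: F_def nd_def)
    qed
    ultimately have "F (vector [lb x, lc x]) = 0"
      using lagrange_unisolvent_ref p by auto
    then show "g x = f x" by (simp add: F_def rep)
  qed
  have "lagrange p T A = f"
    unfolding lagrange_def
  proof (rule the_equality)
    show "f \<in> poly2 p \<and> (\<forall>B\<in>nodes p T. f B = (if B = A then 1 else 0))"
      using f fB by simp
    fix g assume "g \<in> poly2 p \<and> (\<forall>B\<in>nodes p T. g B = (if B = A then 1 else 0))"
    then show "g = f" by (intro uniq) auto
  qed
  then show ?thesis using f by simp
qed

section \<open>Tents over segments and the trace inequality\<close>

text \<open>For \<open>m\<close> orthogonal to \<open>b - a\<close> and of the same length this is the open triangle with base \<open>a b\<close>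
  and height \<open>d * norm (b - a) / 2\<close>, on the side of \<open>m\<close>.\<close>

definition tent :: "real^2 \<Rightarrow> real^2 \<Rightarrow> real^2 \<Rightarrow> real \<Rightarrow> (real^2) set" where
  "tent a b m d = {a + s *\<^sub>R (b - a) + t *\<^sub>R m | s t. 0 < t \<and> t < d * s \<and> t < d * (1 - s)}"

lemma tentI:
  assumes "x = a + s *\<^sub>R (b - a) + t *\<^sub>R m" "0 < t" "t < d * s" "t < d * (1 - s)"
  shows "x \<in> tent a b m d"
  unfolding tent_def using assms by blast

text \<open>Used through connectedness: a tent inside the domain that misses the curve lies in one
  of the two subdomains.\<close>

lemma tent_convex: "convex (tent a b m d)"
proof (rule convexI)
  fix x y and u v :: real
  assume xy: "x \<in> tent a b m d" "y \<in> tent a b m d" and uv: "0 \<le> u" "0 \<le> v" "u + v = 1"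
  obtain s t where x: "x = a + s *\<^sub>R (b - a) + t *\<^sub>R m" "0 < t" "t < d * s" "t < d * (1 - s)"
    using xy(1) unfolding tent_def by blast
  obtain s' t' where y: "y = a + s' *\<^sub>R (b - a) + t' *\<^sub>R m" "0 < t'" "t' < d * s'" "t' < d * (1 - s')"
    using xy(2) unfolding tent_def by blast
  have u: "u = 1 - v" using uv by simp
  have mix: "u * p + v * q < u * p' + v * q'" if "p < p'" "q < q'" for p q p' q'
  proof (cases "u = 0")
    case False
    then have "u * p < u * p'" using that uv by simp
    moreover have "v * q \<le> v * q'" using that uv by (simp add: mult_left_mono)
    ultimately show ?thesis by linarith
  qed (use that uv in simp)
  have "u *\<^sub>R x + v *\<^sub>R y = a + (u * s + v * s') *\<^sub>R (b - a) + (u * t + v * t') *\<^sub>R m"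
    unfolding x(1) y(1) u by (simp add: algebra_simps)
  moreover have "0 < u * t + v * t'" using mix[of 0 t 0 t'] x y by simp
  moreover have "u * t + v * t' < d * (u * s + v * s')"
    using mix[of t "d * s" t' "d * s'"] x y by (simp add: algebra_simps)
  moreover have "u * t + v * t' < d * (1 - (u * s + v * s'))"
  proof -
    have "u * (d * (1 - s)) + v * (d * (1 - s')) = d * (1 - (u * s + v * s'))"
      unfolding u by (simp add: algebra_simps)
    then show ?thesis using mix[of t "d * (1 - s)" t' "d * (1 - s')"] x y by simp
  qed
  ultimately show "u *\<^sub>R x + v *\<^sub>R y \<in> tent a b m d" by (rule tentI)
qed

lemma tent_param:
  assumes "x \<in> tent a b m d" "0 < d"
  obtains s t where "x = a + s *\<^sub>R (b - a) + t *\<^sub>R m" "0 < s" "s < 1" "0 < t" "t < d * s" "t < d * (1 - s)"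
proof -
  obtain s t where st: "x = a + s *\<^sub>R (b - a) + t *\<^sub>R m" "0 < t" "t < d * s" "t < d * (1 - s)"
    using assms(1) unfolding tent_def by blast
  have "0 < d * s" "0 < d * (1 - s)" using st by linarith+
  then have "0 < s" "s < 1" using assms(2) by (simp_all add: zero_less_mult_iff)
  with st that show ?thesis by blast
qed

text \<open>Shrinking \<open>m\<close> together with the base keeps the slope \<open>d\<close>, so
  the tent over a subsegment is a scaled copy sitting below the roof of the large one.\<close>

lemma tent_sub:
  assumes "0 \<le> t0" "t0 < t1" "t1 \<le> 1" "0 < d"
  shows "tent (a + t0 *\<^sub>R (b - a)) (a + t1 *\<^sub>R (b - a)) ((t1 - t0) *\<^sub>R m) d \<subseteq> tent a b m d"
proof
  fix x assume "x \<in> tent (a + t0 *\<^sub>R (b - a)) (a + t1 *\<^sub>R (b - a)) ((t1 - t0) *\<^sub>R m) d"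
  then obtain s t where
    x: "x = a + t0 *\<^sub>R (b - a) + s *\<^sub>R (a + t1 *\<^sub>R (b - a) - (a + t0 *\<^sub>R (b - a))) + t *\<^sub>R (t1 - t0) *\<^sub>R m"
      "0 < t" "t < d * s" "t < d * (1 - s)" unfolding tent_def by blast
  let ?l = "t1 - t0"
  have "x = a + (t0 + s * ?l) *\<^sub>R (b - a) + (t * ?l) *\<^sub>R m"
    unfolding x(1) by (simp add: algebra_simps)
  moreover have "0 < t * ?l" using x assms by simp
  moreover have "t * ?l < d * (t0 + s * ?l)"
  proof -
    have "t * ?l < (d * s) * ?l" using x assms by simp
    moreover have "0 \<le> d * t0" using assms by simp
    ultimately show ?thesis by (simp add: algebra_simps)
  qed
  moreover have "t * ?l < d * (1 - (t0 + s * ?l))"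
  proof -
    have "t * ?l < (d * (1 - s)) * ?l" using x assms by simp
    moreover have "0 \<le> d * (1 - t1)" using assms by simp
    ultimately show ?thesis by (simp add: algebra_simps)
  qed
  ultimately show "x \<in> tent a b m d" by (rule tentI)
qed

lemma orthogonal_frame:
  fixes v m :: "real^2"
  assumes "v \<bullet> m = 0" "norm m = norm v" "v \<noteq> 0"
  shows "\<exists>s t. y = s *\<^sub>R v + t *\<^sub>R m \<and> \<bar>s\<bar> * norm v \<le> norm y \<and> \<bar>t\<bar> * norm v \<le> norm y
    \<and> (norm y)\<^sup>2 = (s\<^sup>2 + t\<^sup>2) * (norm v)\<^sup>2"
proof -
  have m0: "m \<noteq> 0" using assms by auto
  have "crs v m \<noteq> 0"
  proof
    assume "crs v m = 0"
    from crs_zero_parallel[OF this assms(3)] obtain k where "m = k *\<^sub>R v" by blast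
    with assms(1,3) m0 show False by auto
  qed
  then have "y = (1 / crs v m) *\<^sub>R (crs v m *\<^sub>R y)" by simp
  also have "\<dots> = (crs y m / crs v m) *\<^sub>R v + (crs v y / crs v m) *\<^sub>R m"
    unfolding crs_cramer[of v m y] by (simp add: scaleR_add_right)
  finally obtain s t where y: "y = s *\<^sub>R v + t *\<^sub>R m" by blast
  have n: "(norm y)\<^sup>2 = (s\<^sup>2 + t\<^sup>2) * (norm v)\<^sup>2"
  proof -
    have "(norm y)\<^sup>2 = s\<^sup>2 * (norm v)\<^sup>2 + t\<^sup>2 * (norm m)\<^sup>2"
      unfolding y power2_norm_eq_inner using assms(1)
      by (simp add: inner_add_left inner_add_right inner_commute power2_eq_square)
    then show ?thesis using assms(2) by (simp add: algebra_simps)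
  qed
  have "(\<bar>s\<bar> * norm v)\<^sup>2 \<le> (norm y)\<^sup>2" "(\<bar>t\<bar> * norm v)\<^sup>2 \<le> (norm y)\<^sup>2"
    unfolding n by (simp_all add: power_mult_distrib mult_right_mono)
  then have "\<bar>s\<bar> * norm v \<le> norm y" "\<bar>t\<bar> * norm v \<le> norm y"
    by (auto intro: power2_le_imp_le)
  with y n show ?thesis by blast
qed

text \<open>The centres are two points at height \<open>d / 8\<close> and one, above the midpoint,
  at height \<open>d / 4\<close>. The radius carries the factor \<open>d\<close> because the tent is
  flat; 1/16 leaves room below the roof and above the base at all three.\<close>

lemma tent_cball:
  assumes "(b - a) \<bullet> m = 0" "norm m = norm (b - a)" "a \<noteq> b" "0 < d" "d \<le> 1/4"
    and "(s, t) \<in> {(3/8, d/8), (5/8, d/8), (1/2, d/4)}"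
  shows "cball (a + s *\<^sub>R (b - a) + t *\<^sub>R m) (norm (b - a) * d / 16) \<subseteq> tent a b m d"
proof
  fix x assume x: "x \<in> cball (a + s *\<^sub>R (b - a) + t *\<^sub>R m) (norm (b - a) * d / 16)"
  let ?y = "x - (a + s *\<^sub>R (b - a) + t *\<^sub>R m)"
  have l0: "0 < norm (b - a)" using assms by simp
  have ny: "norm ?y \<le> norm (b - a) * d / 16" using x by (simp add: dist_norm norm_minus_commute)
  have "b - a \<noteq> 0" using assms(3) by simp
  from orthogonal_frame[OF assms(1,2) this, of ?y]
  obtain s' t' where y: "?y = s' *\<^sub>R (b - a) + t' *\<^sub>R m"
    and bd: "\<bar>s'\<bar> * norm (b - a) \<le> norm ?y" "\<bar>t'\<bar> * norm (b - a) \<le> norm ?y"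
    by blast
  have "\<bar>s'\<bar> * norm (b - a) \<le> (d / 16) * norm (b - a)" "\<bar>t'\<bar> * norm (b - a) \<le> (d / 16) * norm (b - a)"
    using bd ny by (simp_all add: algebra_simps)
  then have st': "\<bar>s'\<bar> \<le> d / 16" "\<bar>t'\<bar> \<le> d / 16" using l0 by (simp_all only: mult_le_cancel_right_pos)
  have "x = ?y + (a + s *\<^sub>R (b - a) + t *\<^sub>R m)" by simp
  then have x_eq: "x = a + (s + s') *\<^sub>R (b - a) + (t + t') *\<^sub>R m"
    unfolding y by (simp add: algebra_simps)
  have ss: "11/32 \<le> s + s'" "s + s' \<le> 21/32" using assms st' by auto
  have *: "0 < t + t' \<and> t + t' < d * (s + s') \<and> t + t' < d * (1 - (s + s'))"
  proof (cases "s = 1/2")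
    case True
    then have "31/64 \<le> s + s'" "s + s' \<le> 33/64" "t = d / 4" using assms st' by auto
    then have "d * (31/64) \<le> d * (s + s')" "d * (31/64) \<le> d * (1 - (s + s'))"
      using assms by (auto intro!: mult_left_mono)
    then show ?thesis using \<open>t = d/4\<close> st' assms by linarith
  next
    case False
    then have "t = d / 8" using assms by auto
    have "d * (11/32) \<le> d * (s + s')" "d * (11/32) \<le> d * (1 - (s + s'))"
      using ss assms by (auto intro!: mult_left_mono)
    then show ?thesis using \<open>t = d/8\<close> st' assms by linarith
  qed
  then show "x \<in> tent a b m d" by (intro tentI[OF x_eq]) auto
qed

text \<open>The value of an affine function at the centre is the mean of its values at
  \<open>x\<close> and at the reflected point \<open>2 *\<^sub>R c - x\<close>. The square of a mean
  is at most the mean of the squares, and the reflection preserves the ball and Lebesgue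
  measure.\<close>

lemma cball_mean_square:
  fixes q :: "real^2 \<Rightarrow> real"
  assumes q: "q \<in> poly2 1" and "0 < \<rho>"
  shows "(q c)\<^sup>2 * (pi * \<rho>\<^sup>2) \<le> (LINT x:cball c \<rho>|lebesgue. (q x)\<^sup>2)"
proof -
  obtain c0 e1 e2 where q_eq: "q = (\<lambda>x. c0 + e1 * x$1 + e2 * x$2)" using poly2_1E[OF q] .
  have cq: "continuous_on S q" for S
    using poly2_continuous[OF q] continuous_on_subset by blast
  let ?B = "cball c \<rho>"
  define f where "f = (\<lambda>x. indicator ?B x *\<^sub>R (q x)\<^sup>2)"
  define f' where "f' = (\<lambda>x. indicator ?B x *\<^sub>R (q (2 *\<^sub>R c - x))\<^sup>2)"
  have i1: "integrable lborel f" unfolding f_def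
    by (intro borel_integrable_compact continuous_intros cq) auto
  have i2: "integrable lborel f'" unfolding f'_def
    by (intro borel_integrable_compact continuous_intros continuous_on_compose2[OF cq[of UNIV]]) auto
  have i3: "integrable lborel (\<lambda>x. indicator ?B x *\<^sub>R (q c)\<^sup>2)"
    by (intro borel_integrable_compact continuous_intros) auto
  have refl: "distr lborel borel (\<lambda>x. 2 *\<^sub>R c - x) = (lborel :: (real^2) measure)"
  proof -
    have "(lborel :: (real^2) measure) = density (distr lborel borel (\<lambda>x. 2 *\<^sub>R c + (-1) *\<^sub>R x)) (\<lambda>_. ennreal (\<bar>-1\<bar> ^ DIM(real^2)))"
      by (rule lborel_affine) simp
    also have "\<dots> = distr lborel borel (\<lambda>x. 2 *\<^sub>R c - x)" by (simp add: density_1)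
    finally show ?thesis by simp
  qed
  have "integral\<^sup>L lborel f = integral\<^sup>L (distr lborel borel (\<lambda>x. 2 *\<^sub>R c - x)) f" by (simp add: refl)
  also have "\<dots> = integral\<^sup>L lborel (\<lambda>x. f (2 *\<^sub>R c - x))"
    using i1 by (intro integral_distr) auto
  also have "(\<lambda>x. f (2 *\<^sub>R c - x)) = f'"
  proof
    fix x
    have "dist c (2 *\<^sub>R c - x) = dist c x"
    proof -
      have "c - (2 *\<^sub>R c - x) = - (c - x)" by (simp add: algebra_simps scaleR_2)
      then show ?thesis unfolding dist_norm by (metis norm_minus_cancel)
    qed
    then have "(2 *\<^sub>R c - x) \<in> ?B \<longleftrightarrow> x \<in> ?B" by simp
    then show "f (2 *\<^sub>R c - x) = f' x" by (simp add: f_def f'_def indicator_def)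
  qed
  finally have ff': "integral\<^sup>L lborel f = integral\<^sup>L lborel f'" .
  have "2 * integral\<^sup>L lborel (\<lambda>x. indicator ?B x *\<^sub>R (q c)\<^sup>2) = integral\<^sup>L lborel (\<lambda>x. 2 * (indicator ?B x *\<^sub>R (q c)\<^sup>2))"
    by simp
  also have "\<dots> \<le> integral\<^sup>L lborel (\<lambda>x. f x + f' x)"
  proof (rule integral_mono)
    show "integrable lborel (\<lambda>x. 2 * (indicator ?B x *\<^sub>R (q c)\<^sup>2))" using i3 by simp
    show "integrable lborel (\<lambda>x. f x + f' x)" using i1 i2 by simp
    fix x
    have "q c = (q x + q (2 *\<^sub>R c - x)) / 2" by (simp add: q_eq algebra_simps)
    then have e: "q (2 *\<^sub>R c - x) = 2 * q c - q x" by simp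
    have "0 \<le> (q x - q c)\<^sup>2" by simp
    then have "2 * (q c)\<^sup>2 \<le> (q x)\<^sup>2 + (q (2 *\<^sub>R c - x))\<^sup>2"
      unfolding e by (simp add: power2_eq_square algebra_simps)
    then show "2 * (indicator ?B x *\<^sub>R (q c)\<^sup>2) \<le> f x + f' x"
      by (simp add: f_def f'_def indicator_def)
  qed
  also have "\<dots> = 2 * integral\<^sup>L lborel f" using i1 i2 ff' by simp
  finally have "integral\<^sup>L lborel (\<lambda>x. indicator ?B x *\<^sub>R (q c)\<^sup>2) \<le> integral\<^sup>L lborel f" by simp
  moreover have "integral\<^sup>L lborel (\<lambda>x. indicator ?B x *\<^sub>R (q c)\<^sup>2) = (q c)\<^sup>2 * (pi * \<rho>\<^sup>2)"
    using content_cball[of \<rho> c] assms(2)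
    by (simp add: unit_ball_vol_2 mult.commute[of "(q c)\<^sup>2"] measure_completion)
  moreover have "integral\<^sup>L lborel f = (LINT x:?B|lebesgue. (q x)\<^sup>2)"
    unfolding set_lebesgue_integral_def f_def[symmetric]
    using i1 by (intro integral_completion[symmetric]) auto
  ultimately show ?thesis by linarith
qed

text \<open>An affine function is determined by its values at the centres of three balls inside the tent,
  and each of these values is a mean value over the ball.\<close>

lemma tent_trace:
  assumes q: "q \<in> poly2 1" and "(b - a) \<bullet> m = 0" "norm m = norm (b - a)" "a \<noteq> b" "0 < d" "d \<le> 1/4"
    and E: "\<And>c \<rho>. cball c \<rho> \<subseteq> tent a b m d \<Longrightarrow> (LINT x:cball c \<rho>|lebesgue. (q x)\<^sup>2) \<le> E"
    and s: "-1 \<le> s" "s \<le> 2"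
  shows "(q (a + s *\<^sub>R (b - a)))\<^sup>2 \<le> 57600 / (pi * d\<^sup>2 * (norm (b - a))\<^sup>2) * E"
proof -
  obtain c0 e1 e2 where q_eq: "q = (\<lambda>x. c0 + e1 * x$1 + e2 * x$2)" using poly2_1E[OF q] .
  define \<rho> where "\<rho> = norm (b - a) * d / 16"
  have \<rho>: "0 < \<rho>" using assms by (simp add: \<rho>_def)
  define c where "c = (\<lambda>s t. a + s *\<^sub>R (b - a) + t *\<^sub>R m)"
  have qc: "(q (c s t))\<^sup>2 \<le> E / (pi * \<rho>\<^sup>2)" if "(s, t) \<in> {(3/8, d/8), (5/8, d/8), (1/2, d/4)}" for s t
  proof -
    have "(q (c s t))\<^sup>2 * (pi * \<rho>\<^sup>2) \<le> (LINT x:cball (c s t) \<rho>|lebesgue. (q x)\<^sup>2)"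
      by (rule cball_mean_square[OF q \<rho>])
    also have "\<dots> \<le> E" unfolding c_def \<rho>_def
      by (rule E tent_cball)+ (use assms that in auto)
    finally show ?thesis using \<rho> by (simp add: pos_le_divide_eq)
  qed
  define M where "M = sqrt (E / (pi * \<rho>\<^sup>2))"
  have bd: "\<bar>q (c (3/8) (d/8))\<bar> \<le> M" "\<bar>q (c (5/8) (d/8))\<bar> \<le> M" "\<bar>q (c (1/2) (d/4))\<bar> \<le> M"
    unfolding M_def using qc by (auto intro!: real_le_rsqrt)
  have M0: "0 \<le> M" using bd(1) by linarith
  let ?q1 = "q (c (3/8) (d/8))" and ?q2 = "q (c (5/8) (d/8))" and ?q3 = "q (c (1/2) (d/4))"
  \<comment> \<open>The combination \<open>?q1 + ?q2 - ?q3\<close> is the value at the midpoint of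
    the base, since the heights \<open>d/8 + d/8 - d/4\<close> cancel;
    \<open>4 * (?q2 - ?q1)\<close> is the slope along the base, since the first two centres are a
    quarter of it apart.\<close>
  have eq: "q (a + s *\<^sub>R (b - a)) = ?q1 + ?q2 - ?q3 + 4 * (s - 1/2) * (?q2 - ?q1)"
    by (simp add: q_eq c_def field_simps)
  have "\<bar>s - 1/2\<bar> \<le> 3/2" using s by arith
  moreover have "\<bar>?q2 - ?q1\<bar> \<le> 2 * M" using bd by linarith
  ultimately have "\<bar>4 * (s - 1/2) * (?q2 - ?q1)\<bar> \<le> 6 * (2 * M)"
    unfolding abs_mult by (intro mult_mono) auto
  \<comment> \<open>15 = 3 + 12, from the three values and from the slope term. With the factor 256
    coming from the radius, 225 * 256 gives 57600.\<close>
  then have "\<bar>q (a + s *\<^sub>R (b - a))\<bar> \<le> 15 * M" unfolding eq using bd by linarith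
  then have "(q (a + s *\<^sub>R (b - a)))\<^sup>2 \<le> (15 * M)\<^sup>2"
    using M0 by (intro abs_le_square_iff[THEN iffD1]) simp
  also have "\<dots> = 225 * (E / (pi * \<rho>\<^sup>2))"
  proof -
    have "0 \<le> E / (pi * \<rho>\<^sup>2)" by (rule order_trans[OF _ qc[of "3/8" "d/8"]]) auto
    then show ?thesis by (simp add: M_def power_mult_distrib)
  qed
  also have "\<dots> = 57600 / (pi * d\<^sup>2 * (norm (b - a))\<^sup>2) * E"
    by (simp add: \<rho>_def power_mult_distrib power_divide mult_ac)
  finally show ?thesis .
qed

section \<open>The tubular neighbourhood\<close>

text \<open>Separates the metric argument from the parametrization: the curve appears as a compact
  set with a unit normal field, and differentiability only through the fact that a point is reached
  from a nearest point along the normal.\<close>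

locale tubular =
  fixes G :: "(real^2) set" and n :: "real^2 \<Rightarrow> real^2" and r :: real
  assumes compact: "compact G" and G_ne: "G \<noteq> {}" and r0: "0 < r"
    and norm_n: "x \<in> G \<Longrightarrow> norm (n x) = 1"
    and nearest_normal: "g \<in> G \<Longrightarrow> (\<And>y. y \<in> G \<Longrightarrow> dist z g \<le> dist z y) \<Longrightarrow> \<exists>\<tau>. z = g + \<tau> *\<^sub>R n g"
    and segments_disjoint: "x \<in> G \<Longrightarrow> y \<in> G \<Longrightarrow> x \<noteq> y \<Longrightarrow>
       closed_segment (x - r *\<^sub>R n x) (x + r *\<^sub>R n x) \<inter> closed_segment (y - r *\<^sub>R n y) (y + r *\<^sub>R n y) = {}"
begin

lemma in_normal_segment:
  assumes "\<bar>\<tau>\<bar> \<le> r"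
  shows "g + \<tau> *\<^sub>R n g \<in> closed_segment (g - r *\<^sub>R n g) (g + r *\<^sub>R n g)"
proof -
  define u where "u = (\<tau> / r + 1) / 2"
  have "-1 \<le> \<tau> / r" "\<tau> / r \<le> 1" using assms r0 by (auto simp: field_simps)
  then have "0 \<le> u" "u \<le> 1" by (auto simp: u_def)
  moreover have "g + \<tau> *\<^sub>R n g = (1 - u) *\<^sub>R (g - r *\<^sub>R n g) + u *\<^sub>R (g + r *\<^sub>R n g)"
  proof -
    have "(1 - u) *\<^sub>R (g - r *\<^sub>R n g) + u *\<^sub>R (g + r *\<^sub>R n g) = g + ((2 * u - 1) * r) *\<^sub>R n g"
      by (simp add: algebra_simps scaleR_2[symmetric] flip: scaleR_2)
    also have "(2 * u - 1) * r = \<tau>" using r0 by (simp add: u_def field_simps)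
    finally show ?thesis by simp
  qed
  ultimately show ?thesis unfolding in_segment by blast
qed

text \<open>A point within distance \<open>r\<close> of the set lies on the normal segment of each
  of its nearest points, and two such segments are disjoint.\<close>

lemma nearest_unique:
  assumes "g \<in> G" "g' \<in> G" "\<And>y. y \<in> G \<Longrightarrow> dist z g \<le> dist z y" "dist z g' \<le> dist z g" "dist z g \<le> r"
  shows "g = g'"
proof (rule ccontr)
  assume ne: "g \<noteq> g'"
  have g': "dist z g' \<le> dist z y" if "y \<in> G" for y using assms(3)[OF that] assms(4) by simp
  obtain \<tau> where \<tau>: "z = g + \<tau> *\<^sub>R n g" using nearest_normal[OF assms(1,3)] by blast
  obtain \<tau>' where \<tau>': "z = g' + \<tau>' *\<^sub>R n g'" using nearest_normal[OF assms(2) g'] by blast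
  have "dist z g = \<bar>\<tau>\<bar>" "dist z g' = \<bar>\<tau>'\<bar>"
    using norm_n[OF assms(1)] norm_n[OF assms(2)] \<tau> \<tau>' by (metis add_diff_cancel_left' dist_norm norm_scaleR mult.right_neutral)+
  then have "\<bar>\<tau>\<bar> \<le> r" "\<bar>\<tau>'\<bar> \<le> r" using assms by auto
  then have "z \<in> closed_segment (g - r *\<^sub>R n g) (g + r *\<^sub>R n g)"
    "z \<in> closed_segment (g' - r *\<^sub>R n g') (g' + r *\<^sub>R n g')"
    using in_normal_segment \<tau> \<tau>' by metis+
  then show False using segments_disjoint[OF assms(1,2) ne] by blast
qed

lemma nearest_exists: obtains g where "g \<in> G" "\<And>y. y \<in> G \<Longrightarrow> dist z g \<le> dist z y"
  using distance_attains_inf[OF compact_imp_closed[OF compact] G_ne, of z] by blast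

text \<open>The end point of a normal segment has distance \<open>r\<close> from \<open>g\<close>,
  so its nearest point is no farther away and has a normal segment through it as well; disjointness
  makes that nearest point \<open>g\<close>. Thus the open balls of radius \<open>r\<close> touching
  at \<open>g\<close> contain no point of the set.\<close>

lemma reach_ball:
  assumes "g \<in> G" "y \<in> G" "\<bar>\<sigma>\<bar> = 1"
  shows "r \<le> dist (g + (\<sigma> * r) *\<^sub>R n g) y"
proof -
  let ?z = "g + (\<sigma> * r) *\<^sub>R n g"
  obtain g' where g': "g' \<in> G" "\<And>y. y \<in> G \<Longrightarrow> dist ?z g' \<le> dist ?z y"
    using nearest_exists[of ?z] by blast
  have zg: "dist ?z g = r" using norm_n[OF assms(1)] assms(3) r0 by (simp add: dist_norm abs_mult)
  obtain \<tau>' where \<tau>': "?z = g' + \<tau>' *\<^sub>R n g'" using nearest_normal[OF g'] by blast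
  have "dist ?z g' = \<bar>\<tau>'\<bar>"
    using norm_n[OF g'(1)] \<tau>' by (metis add_diff_cancel_left' dist_norm norm_scaleR mult.right_neutral)
  then have "\<bar>\<tau>'\<bar> \<le> r" using g'(2)[OF assms(1)] zg by simp
  then have 1: "?z \<in> closed_segment (g' - r *\<^sub>R n g') (g' + r *\<^sub>R n g')"
    using in_normal_segment \<tau>' by metis
  have "\<bar>\<sigma> * r\<bar> \<le> r" using assms(3) r0 by (simp add: abs_mult)
  then have 2: "?z \<in> closed_segment (g - r *\<^sub>R n g) (g + r *\<^sub>R n g)"
    by (rule in_normal_segment)
  have "g' = g" using 1 2 segments_disjoint[OF g'(1) assms(1)] by blast
  then show ?thesis using g'(2)[OF assms(2)] zg by simp
qed

text \<open>Expanding the squared distances of \<open>y\<close> from the centres of the two touching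
  balls at \<open>g\<close> gives Federer's inequality for sets of positive reach.\<close>

lemma reach:
  assumes "g \<in> G" "y \<in> G"
  shows "2 * r * \<bar>(y - g) \<bullet> n g\<bar> \<le> (norm (y - g))\<^sup>2"
proof -
  have *: "2 * r * (\<sigma> * ((y - g) \<bullet> n g)) \<le> (norm (y - g))\<^sup>2" if "\<bar>\<sigma>\<bar> = 1" for \<sigma>
  proof -
    have "r\<^sup>2 \<le> (dist (g + (\<sigma> * r) *\<^sub>R n g) y)\<^sup>2"
      using reach_ball[OF assms that] r0 by (intro power_mono) auto
    also have "dist (g + (\<sigma> * r) *\<^sub>R n g) y = norm ((y - g) - (\<sigma> * r) *\<^sub>R n g)"
      unfolding dist_norm by (metis (no_types, opaque_lifting) diff_diff_add norm_minus_commute)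
    also have "(norm ((y - g) - (\<sigma> * r) *\<^sub>R n g))\<^sup>2 =
        (norm (y - g))\<^sup>2 - 2 * r * (\<sigma> * ((y - g) \<bullet> n g)) + (\<sigma> * r)\<^sup>2 * (norm (n g))\<^sup>2"
      unfolding power2_norm_eq_inner
      by (simp add: inner_diff_left inner_diff_right inner_commute power2_eq_square algebra_simps)
    also have "(\<sigma> * r)\<^sup>2 * (norm (n g))\<^sup>2 = r\<^sup>2"
    proof -
      have "\<sigma>\<^sup>2 = 1" using that by (metis power2_abs one_power2)
      then show ?thesis using norm_n[OF assms(1)] by (simp add: power_mult_distrib)
    qed
    finally show ?thesis by simp
  qed
  show ?thesis using *[of 1] *[of "-1"] by (simp add: abs_if)
qed

end

text \<open>The numerical contradiction behind \<open>one_tent_avoids\<close>, with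
  \<open>Q\<close>, \<open>t\<close>, \<open>Q1\<close>, \<open>t1\<close> in units of
  \<open>l\<close>. Slopes of at most 1/4 produce the factors 15/16, 17/16 and 5/4; the premises
  then force \<open>15/8 * r\<close> below \<open>765/256 * l\<close>, which is less than
  \<open>3 * l\<close>, against \<open>2 * l < r\<close>.\<close>

lemma cone_arith:
  fixes Q Q1 t t1 l r :: real
  assumes "0 < Q" "0 < Q1" "\<bar>t\<bar> \<le> Q / 4" "\<bar>t1\<bar> \<le> Q1 / 4" "0 < l" "2 * l < r" "Q1 < 9/4"
    and "2 * r * (Q1 * Q - \<bar>t1\<bar> * \<bar>t\<bar>) \<le> l * (Q1\<^sup>2 + t1\<^sup>2) * (Q + \<bar>t\<bar>)"
  shows False
proof -
  have "\<bar>t1\<bar> * \<bar>t\<bar> \<le> (Q1 / 4) * (Q / 4)" using assms by (intro mult_mono) auto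
  then have "2 * r * (15/16 * (Q1 * Q)) \<le> 2 * r * (Q1 * Q - \<bar>t1\<bar> * \<bar>t\<bar>)"
    using assms by (intro mult_left_mono) (auto simp: mult.commute[of Q])
  also note assms(8)
  also have "l * (Q1\<^sup>2 + t1\<^sup>2) * (Q + \<bar>t\<bar>) \<le> l * (17/16 * Q1\<^sup>2) * (5/4 * Q)"
  proof (intro mult_mono)
    have "\<bar>t1\<bar> ^ 2 \<le> (Q1 / 4) ^ 2" using assms by (intro power_mono) auto
    then show "Q1\<^sup>2 + t1\<^sup>2 \<le> 17/16 * Q1\<^sup>2" by (simp add: power_divide)
  qed (use assms in auto)
  finally have "(Q1 * Q) * (15/8 * r) \<le> (Q1 * Q) * (85/64 * (l * Q1))"
    by (simp add: power2_eq_square mult_ac)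
  then have "15/8 * r \<le> 85/64 * (l * Q1)" using assms by simp
  moreover have "l * Q1 \<le> l * (9/4)" using assms by (intro mult_left_mono) auto
  ultimately show False using assms by linarith
qed

context tubular
begin

text \<open>Suppose that the curve had points \<open>y1\<close>, \<open>y2\<close> in the two tents. Along the segment from \<open>y1\<close> to \<open>y2\<close>
  the nearest point of the curve passes from one side of the line through \<open>a\<close>, \<open>b\<close> to the other, so for
  some \<open>z\<close> on it the nearest point lies on that line, but outside the open segment. The ball of
  radius \<open>r\<close> touching the curve there in the direction of \<open>z\<close> then contains \<open>y1\<close>.\<close>

lemma one_tent_avoids:
  assumes ab: "a \<noteq> b" and orth: "(b - a) \<bullet> m = 0" and nm: "norm m = norm (b - a)"
    and len: "2 * norm (b - a) < r" and d: "0 < d" "d \<le> 1/4"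
    and seg: "open_segment a b \<inter> G = {}"
  shows "tent a b m d \<inter> G = {} \<or> tent a b (- m) d \<inter> G = {}"
proof (rule ccontr)
  assume "\<not> ?thesis"
  then obtain y1 y2 where y1: "y1 \<in> tent a b m d" "y1 \<in> G" and y2: "y2 \<in> tent a b (-m) d" "y2 \<in> G"
    by blast
  define l where "l = norm (b - a)"
  have l0: "0 < l" using ab by (simp add: l_def)
  obtain s1 t1 where 1: "y1 = a + s1 *\<^sub>R (b - a) + t1 *\<^sub>R m" "0 < s1" "s1 < 1" "0 < t1" "t1 < d * s1" "t1 < d * (1 - s1)"
    using tent_param[OF y1(1) d(1)] .
  obtain s2 t2' where 2: "y2 = a + s2 *\<^sub>R (b - a) + t2' *\<^sub>R (- m)" "0 < s2" "s2 < 1" "0 < t2'" "t2' < d * s2" "t2' < d * (1 - s2)"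
    using tent_param[OF y2(1) d(1)] .
  define t2 where "t2 = - t2'"
  have h2: "y2 = a + s2 *\<^sub>R (b - a) + t2 *\<^sub>R m" "t2 < 0" "-t2 < d * s2" "-t2 < d * (1 - s2)"
    using 2 by (simp_all add: t2_def)
  define Y where "Y = (\<lambda>x. (x - a) \<bullet> m)"
  have mm: "m \<bullet> m = l\<^sup>2" using nm by (simp add: l_def power2_norm_eq_inner[symmetric])
  have Yv: "Y (a + s *\<^sub>R (b - a) + t *\<^sub>R m) = t * l\<^sup>2" for s t
    unfolding Y_def using orth mm by (simp add: inner_add_left add.assoc)
  define z where "z = (\<lambda>\<theta>. (1 - \<theta>) *\<^sub>R y1 + \<theta> *\<^sub>R y2)"
  \<comment> \<open>Parameters of points with a nearest point weakly above (\<sigma> = 1) or weakly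
    below (\<sigma> = -1) the base line. Both sets are closed by compactness of the curve and
    together cover the interval, so connectedness yields a common parameter.\<close>
  define S where "S = (\<lambda>\<sigma>::real. fst ` {(\<theta>, g) \<in> {0..1} \<times> G. 0 \<le> \<sigma> * Y g \<and> dist (z \<theta>) g \<le> infdist (z \<theta>) G})"
  have Scl: "closed (S \<sigma>)" for \<sigma>
  proof -
    let ?K = "({0..1} \<times> G) \<inter> ({p. 0 \<le> \<sigma> * Y (snd p)} \<inter> {p. dist (z (fst p)) (snd p) \<le> infdist (z (fst p)) G})"
    have "compact ?K"
    proof (intro compact_Int_closed compact_Times closed_Int compact)
      show "closed {p. 0 \<le> \<sigma> * Y (snd p)}"
        unfolding Y_def by (intro closed_Collect_le continuous_intros)
      show "closed {p. dist (z (fst p)) (snd p) \<le> infdist (z (fst p)) G}"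
        unfolding z_def by (intro closed_Collect_le continuous_intros)
    qed auto
    then have "compact (fst ` ?K)" by (intro compact_continuous_image continuous_intros)
    moreover have "S \<sigma> = fst ` ?K" unfolding S_def by (rule arg_cong[where f = "image fst"]) auto
    ultimately show ?thesis by (simp add: compact_imp_closed)
  qed
  have near: "\<exists>g\<in>G. infdist (z \<theta>) G = dist (z \<theta>) g" for \<theta>
    using infdist_attains_inf[OF compact_imp_closed[OF compact] G_ne] by metis
  have cover: "{0..1} \<subseteq> S 1 \<union> S (-1)"
  proof
    fix \<theta> :: real assume \<theta>: "\<theta> \<in> {0..1}"
    obtain g where g: "g \<in> G" "infdist (z \<theta>) G = dist (z \<theta>) g" using near by blast
    show "\<theta> \<in> S 1 \<union> S (-1)"
    proof (cases "0 \<le> Y g")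
      case True
      then have "\<theta> \<in> S 1" unfolding S_def using \<theta> g by (intro image_eqI[of _ _ "(\<theta>, g)"]) auto
      then show ?thesis by blast
    next
      case False
      then have "\<theta> \<in> S (-1)" unfolding S_def using \<theta> g by (intro image_eqI[of _ _ "(\<theta>, g)"]) auto
      then show ?thesis by blast
    qed
  qed
  have "0 \<in> S 1"
    unfolding S_def using y1(2) Yv[of s1 t1] 1 by (intro image_eqI[of _ _ "(0, y1)"]) (auto simp: z_def infdist_nonneg)
  moreover have "1 \<in> S (-1)"
    unfolding S_def using y2(2) Yv[of s2 t2] h2 by (intro image_eqI[of _ _ "(1, y2)"]) (auto simp: z_def infdist_nonneg mult_nonpos_nonneg)
  ultimately have "S 1 \<inter> S (-1) \<inter> {0..1} \<noteq> {}"
    using connected_closedD[OF connected_Icc[of 0 "1::real"], of "S 1" "S (-1)"] cover Scl by force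
  then obtain \<theta> g g' where \<theta>: "0 \<le> \<theta>" "\<theta> \<le> 1"
    and g: "g \<in> G" "0 \<le> Y g" "dist (z \<theta>) g \<le> infdist (z \<theta>) G"
    and g': "g' \<in> G" "Y g' \<le> 0" "dist (z \<theta>) g' \<le> infdist (z \<theta>) G"
    unfolding S_def by auto
  define s where "s = (1 - \<theta>) * s1 + \<theta> * s2"
  define t where "t = (1 - \<theta>) * t1 + \<theta> * t2"
  have z_eq: "z \<theta> = a + s *\<^sub>R (b - a) + t *\<^sub>R m"
    unfolding z_def 1(1) h2(1) s_def t_def by (simp add: algebra_simps)
  have cvx: "(1 - \<theta>) * p + \<theta> * q < (1 - \<theta>) * p' + \<theta> * q'" if "p < p'" "q < q'" for p q p' q'
  proof (cases "\<theta> = 1")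
    case False
    then have "(1 - \<theta>) * p < (1 - \<theta>) * p'" using that \<theta> by simp
    moreover have "\<theta> * q \<le> \<theta> * q'" using that \<theta> by (simp add: mult_left_mono)
    ultimately show ?thesis by linarith
  qed (use that in simp)
  have dm: "d * s1 \<le> 1/4 * s1" "d * (1 - s1) \<le> 1/4 * (1 - s1)" "d * s2 \<le> 1/4 * s2" "d * (1 - s2) \<le> 1/4 * (1 - s2)"
    using d 1 2 by (auto intro!: mult_right_mono)
  have tb: "t1 < s1 / 4" "- t1 < s1 / 4" "t1 < (1 - s1) / 4" "- t1 < (1 - s1) / 4"
      "t2 < s2 / 4" "- t2 < s2 / 4" "t2 < (1 - s2) / 4" "- t2 < (1 - s2) / 4"
    using dm 1(2-) 2(2-) h2(2-) by linarith+
  have s01: "0 < s" "s < 1" unfolding s_def using cvx[of 0 s1 0 s2] cvx[of s1 1 s2 1] 1 2 by auto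
  have ts: "t < 1/4 * s" "- t < 1/4 * s"
    unfolding s_def t_def using cvx[of t1 "s1 / 4" t2 "s2 / 4"] cvx[of "-t1" "s1 / 4" "-t2" "s2 / 4"] tb
    by (simp_all add: field_simps)
  have ts': "t < 1/4 * (1 - s)" "- t < 1/4 * (1 - s)"
  proof -
    have e: "(1 - \<theta>) * ((1 - s1) / 4) + \<theta> * ((1 - s2) / 4) = 1/4 * (1 - s)"
      unfolding s_def by (simp add: field_simps)
    show "t < 1/4 * (1 - s)" "- t < 1/4 * (1 - s)"
      unfolding e[symmetric] unfolding t_def
      using cvx[of t1 "(1 - s1) / 4" t2 "(1 - s2) / 4"] cvx[of "-t1" "(1 - s1) / 4" "-t2" "(1 - s2) / 4"] tb
      by simp_all
  qed
  \<comment> \<open>Together with \<open>2 * l < r\<close> this keeps the point within distance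
    \<open>r\<close> of the curve, where nearest points are unique.\<close>
  have zy1: "dist (z \<theta>) y1 \<le> 5/4 * l"
  proof -
    have "z \<theta> - y1 = (s - s1) *\<^sub>R (b - a) + (t - t1) *\<^sub>R m" unfolding z_eq 1(1) by (simp add: algebra_simps)
    then have "dist (z \<theta>) y1 \<le> \<bar>s - s1\<bar> * l + \<bar>t - t1\<bar> * l"
      unfolding dist_norm using norm_triangle_ineq nm by (metis l_def norm_scaleR)
    also have "\<dots> = (\<bar>s - s1\<bar> + \<bar>t - t1\<bar>) * l" by (simp add: algebra_simps)
    also have "\<dots> \<le> (5/4) * l"
    proof (rule mult_right_mono)
      have "\<bar>t\<bar> \<le> 1/8" "\<bar>t1\<bar> \<le> 1/8" using ts ts' tb by (simp_all add: abs_le_iff)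
      moreover have "\<bar>s - s1\<bar> \<le> 1" using s01 1 by auto
      ultimately show "\<bar>s - s1\<bar> + \<bar>t - t1\<bar> \<le> 5/4" by linarith
    qed (use l0 in auto)
    finally show ?thesis .
  qed
  have inf1: "infdist (z \<theta>) G \<le> dist (z \<theta>) y1" using y1(2) by (simp add: infdist_le)
  have gnear: "dist (z \<theta>) g \<le> dist (z \<theta>) y" if "y \<in> G" for y
    using g(3) infdist_le[OF that, of "z \<theta>"] by linarith
  \<comment> \<open>One nearest point is weakly above the base line and the other weakly below; once
    equal, they lie on it.\<close>
  have "g = g'"
  proof (rule nearest_unique[OF g(1) g'(1) gnear])
    show "dist (z \<theta>) g' \<le> dist (z \<theta>) g" using g'(3) infdist_le[OF g(1), of "z \<theta>"] by linarith
    show "dist (z \<theta>) g \<le> r" using gnear[OF y1(2)] zy1 len l0 unfolding l_def by linarith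
  qed auto
  then have Yg: "Y g = 0" using g g' by simp
  obtain p t0 where "g - a = p *\<^sub>R (b - a) + t0 *\<^sub>R m"
    using orthogonal_frame[OF orth nm _, of "g - a"] ab by auto
  then have g_eq0: "g = a + p *\<^sub>R (b - a) + t0 *\<^sub>R m" by (simp add: algebra_simps)
  have "t0 = 0" using Yg Yv[of p t0] g_eq0 l0 by simp
  then have g_eq: "g = a + p *\<^sub>R (b - a)" using g_eq0 by simp
  have p: "p \<le> 0 \<or> 1 \<le> p"
  proof (rule ccontr)
    assume "\<not> ?thesis"
    then have "g \<in> open_segment a b" unfolding in_segment using ab
      by (auto intro!: exI[of _ p] simp: g_eq algebra_simps)
    then show False using seg g(1) by blast
  qed
  have nrm: "(norm (\<sigma> *\<^sub>R (b - a) + \<tau> *\<^sub>R m))\<^sup>2 = (\<sigma>\<^sup>2 + \<tau>\<^sup>2) * l\<^sup>2" for \<sigma> \<tau>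
  proof -
    have "(norm (\<sigma> *\<^sub>R (b - a) + \<tau> *\<^sub>R m))\<^sup>2 = \<sigma>\<^sup>2 * ((b - a) \<bullet> (b - a)) + \<tau>\<^sup>2 * (m \<bullet> m)"
      unfolding power2_norm_eq_inner using orth
      by (simp add: inner_add_left inner_add_right inner_commute power2_eq_square)
    also have "(b - a) \<bullet> (b - a) = l\<^sup>2" by (simp add: l_def power2_norm_eq_inner)
    finally show ?thesis using mm by (simp add: algebra_simps)
  qed
  \<comment> \<open>Distances along the base line, in units of \<open>l\<close>, from the touching
    point to the moving point and to \<open>y1\<close>. As the touching point is outside the open
    base, both are seen from it under a slope of at most 1/4.\<close>
  define Q where "Q = \<bar>s - p\<bar>"
  define Q1 where "Q1 = \<bar>s1 - p\<bar>"
  have Q: "0 < Q" "0 < Q1" "\<bar>t\<bar> \<le> Q / 4" "\<bar>t1\<bar> \<le> Q1 / 4"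
    using p s01 ts ts' 1(2,3) tb unfolding Q_def Q1_def by argo+
  have zg: "z \<theta> - g = (s - p) *\<^sub>R (b - a) + t *\<^sub>R m" unfolding z_eq g_eq by (simp add: algebra_simps)
  have yg: "y1 - g = (s1 - p) *\<^sub>R (b - a) + t1 *\<^sub>R m" unfolding 1(1) g_eq by (simp add: algebra_simps)
  have Q_le: "Q \<le> 5/4"
  proof -
    have "(Q * l)\<^sup>2 \<le> (norm (z \<theta> - g))\<^sup>2"
      unfolding zg nrm by (simp add: Q_def power_mult_distrib mult_right_mono)
    then have "Q * l \<le> dist (z \<theta>) g" unfolding dist_norm by (rule power2_le_imp_le) simp
    also have "\<dots> \<le> 5/4 * l" using gnear[OF y1(2)] zy1 by linarith
    finally show ?thesis using l0 by simp
  qed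
  have Q1: "Q1 < 9/4" using Q_le s01 1 p unfolding Q_def Q1_def by (auto simp: abs_if split: if_splits)
  obtain \<tau> where \<tau>: "z \<theta> = g + \<tau> *\<^sub>R n g" using nearest_normal[OF g(1) gnear] by blast
  have \<tau>': "\<bar>\<tau>\<bar> = norm (z \<theta> - g)" unfolding \<tau> using norm_n[OF g(1)] by simp
  have "norm (z \<theta> - g) \<le> \<bar>s - p\<bar> * l + \<bar>t\<bar> * l"
    unfolding zg using norm_triangle_ineq nm by (metis l_def norm_scaleR)
  then have \<tau>le: "\<bar>\<tau>\<bar> \<le> (Q + \<bar>t\<bar>) * l" unfolding \<tau>' Q_def by (simp add: algebra_simps)
  have inner: "(y1 - g) \<bullet> (z \<theta> - g) = ((s1 - p) * (s - p) + t1 * t) * l\<^sup>2"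
  proof -
    have "(y1 - g) \<bullet> (z \<theta> - g) = (s1 - p) * (s - p) * ((b - a) \<bullet> (b - a)) + t1 * t * (m \<bullet> m)"
      unfolding zg yg using orth by (simp add: inner_add_left inner_add_right inner_commute)
    also have "(b - a) \<bullet> (b - a) = l\<^sup>2" by (simp add: l_def power2_norm_eq_inner)
    finally show ?thesis using mm by (simp add: algebra_simps)
  qed
  \<comment> \<open>The touching point lies beyond one end of the base, so both differences have the
    same sign.\<close>
  have "Q1 * Q = (s1 - p) * (s - p)"
    using p
  proof
    assume "p \<le> 0"
    then show ?thesis using s01 1(2) by (simp add: Q_def Q1_def)
  next
    assume "1 \<le> p"
    then show ?thesis using s01 1(3) by (simp add: Q_def Q1_def algebra_simps)
  qed
  moreover have "- (\<bar>t1\<bar> * \<bar>t\<bar>) \<le> t1 * t" by (metis abs_ge_minus_self abs_mult neg_le_iff_le minus_le_iff)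
  ultimately have "Q1 * Q - \<bar>t1\<bar> * \<bar>t\<bar> \<le> (s1 - p) * (s - p) + t1 * t" by linarith
  then have "(Q1 * Q - \<bar>t1\<bar> * \<bar>t\<bar>) * l\<^sup>2 \<le> (y1 - g) \<bullet> (z \<theta> - g)"
    unfolding inner by (simp add: mult_right_mono)
  also have "\<dots> = \<tau> * ((y1 - g) \<bullet> n g)" unfolding \<tau> by simp
  also have "\<dots> \<le> \<bar>\<tau>\<bar> * \<bar>(y1 - g) \<bullet> n g\<bar>" by (metis abs_ge_self abs_mult)
  finally have "2 * r * ((Q1 * Q - \<bar>t1\<bar> * \<bar>t\<bar>) * l\<^sup>2) \<le> 2 * r * (\<bar>\<tau>\<bar> * \<bar>(y1 - g) \<bullet> n g\<bar>)"
    using r0 by (intro mult_left_mono) auto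
  also have "\<dots> = \<bar>\<tau>\<bar> * (2 * r * \<bar>(y1 - g) \<bullet> n g\<bar>)" by simp
  also have "\<dots> \<le> ((Q + \<bar>t\<bar>) * l) * ((Q1\<^sup>2 + t1\<^sup>2) * l\<^sup>2)"
  proof (rule mult_mono[OF \<tau>le])
    have "2 * r * \<bar>(y1 - g) \<bullet> n g\<bar> \<le> (norm (y1 - g))\<^sup>2" by (rule reach[OF g(1) y1(2)])
    also have "\<dots> = (Q1\<^sup>2 + t1\<^sup>2) * l\<^sup>2" unfolding yg nrm by (simp add: Q1_def)
    finally show "2 * r * \<bar>(y1 - g) \<bullet> n g\<bar> \<le> (Q1\<^sup>2 + t1\<^sup>2) * l\<^sup>2" .
  qed (use Q l0 r0 in auto)
  finally have "(2 * r * (Q1 * Q - \<bar>t1\<bar> * \<bar>t\<bar>)) * l\<^sup>2 \<le> (l * (Q1\<^sup>2 + t1\<^sup>2) * (Q + \<bar>t\<bar>)) * l\<^sup>2"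
    by (simp add: algebra_simps)
  then have "2 * r * (Q1 * Q - \<bar>t1\<bar> * \<bar>t\<bar>) \<le> l * (Q1\<^sup>2 + t1\<^sup>2) * (Q + \<bar>t\<bar>)"
    using l0 by simp
  then show False using cone_arith[OF Q l0 _ Q1] len unfolding l_def by blast
qed

end

section \<open>Geometry of the interface\<close>

lemma seg_point:
  fixes a b :: "'a::real_vector"
  assumes "0 \<le> s" "s \<le> 1" shows "a + s *\<^sub>R (b - a) \<in> closed_segment a b"
proof -
  have "a + s *\<^sub>R (b - a) = (1 - s) *\<^sub>R a + s *\<^sub>R b" by (simp add: algebra_simps)
  then show ?thesis unfolding in_segment using assms by blast
qed

text \<open>The two tents and their base form a kite that is a neighbourhood of every inner point of
  the base. One-sided limits at such a point are therefore decided inside the tents.\<close>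

lemma kite_neighbourhood:
  fixes a b m :: "real^2"
  assumes orth: "(b - a) \<bullet> m = 0" and nm: "norm m = norm (b - a)" and ab: "a \<noteq> b"
    and d: "0 < d" "d \<le> 1/4" and s: "0 < s" "s < 1"
  obtains U where "open U" "a + s *\<^sub>R (b - a) \<in> U"
    "U \<subseteq> tent a b m d \<union> tent a b (- m) d \<union> closed_segment a b"
proof -
  define l where "l = norm (b - a)"
  have l0: "0 < l" using ab by (simp add: l_def)
  define k where "k = min s (1 - s)"
  have k: "0 < k" "k \<le> s" "k \<le> 1 - s" using s by (auto simp: k_def)
  let ?x = "a + s *\<^sub>R (b - a)"
  have "y \<in> tent a b m d \<union> tent a b (- m) d \<union> closed_segment a b" if "y \<in> ball ?x (l * d * k / 2)" for y
  proof -
    have "b - a \<noteq> 0" using ab by simp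
    from orthogonal_frame[OF orth nm this, of "y - ?x", folded l_def]
    obtain \<sigma> \<tau> where n: "y - ?x = \<sigma> *\<^sub>R (b - a) + \<tau> *\<^sub>R m"
      and bd: "\<bar>\<sigma>\<bar> * l \<le> norm (y - ?x)" "\<bar>\<tau>\<bar> * l \<le> norm (y - ?x)" by blast
    have "norm (y - ?x) < (d * k / 2) * l" using that by (simp add: dist_norm norm_minus_commute mult_ac)
    then have "\<bar>\<sigma>\<bar> * l < (d * k / 2) * l" "\<bar>\<tau>\<bar> * l < (d * k / 2) * l" using bd by linarith+
    then have bd': "\<bar>\<sigma>\<bar> < d * k / 2" "\<bar>\<tau>\<bar> < d * k / 2" using l0 by (simp_all only: mult_less_cancel_right_pos)
    have y: "y = a + (s + \<sigma>) *\<^sub>R (b - a) + \<tau> *\<^sub>R m"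
    proof -
      have "y = ?x + (y - ?x)" by simp
      then have "y = ?x + (\<sigma> *\<^sub>R (b - a) + \<tau> *\<^sub>R m)" unfolding n .
      then show ?thesis by (simp add: scaleR_add_left)
    qed
    have "d * k \<le> 1 * k" using d k by (intro mult_right_mono) auto
    then have "\<bar>\<sigma>\<bar> < k / 2" using bd' by linarith
    then have sk: "k / 2 \<le> s + \<sigma>" "k / 2 \<le> 1 - (s + \<sigma>)" using k by linarith+
    then have "d * (k / 2) \<le> d * (s + \<sigma>)" "d * (k / 2) \<le> d * (1 - (s + \<sigma>))"
      using d by (auto intro!: mult_left_mono)
    then have t: "\<bar>\<tau>\<bar> < d * (s + \<sigma>)" "\<bar>\<tau>\<bar> < d * (1 - (s + \<sigma>))" using bd' by linarith+
    consider "\<tau> = 0" | "0 < \<tau>" | "\<tau> < 0" by linarith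
    then show ?thesis
    proof cases
      case 1
      have "y \<in> closed_segment a b" using seg_point[of "s + \<sigma>" a b] sk k unfolding y 1 by simp
      then show ?thesis by blast
    next
      case 2
      then have "y \<in> tent a b m d" using t by (intro tentI[OF y]) auto
      then show ?thesis by blast
    next
      case 3
      have "y = a + (s + \<sigma>) *\<^sub>R (b - a) + (- \<tau>) *\<^sub>R (- m)" unfolding y by simp
      then have "y \<in> tent a b (-m) d" using 3 t by (intro tentI) auto
      then show ?thesis by blast
    qed
  qed
  moreover have "?x \<in> ball ?x (l * d * k / 2)" using l0 d k by simp
  ultimately show ?thesis using that[of "ball ?x (l * d * k / 2)"] by blast
qed

section \<open>Closed regular simple curves\<close>

locale regular_curve =
  fixes \<Gamma> :: interface
  assumes reg: "closed_regular_simple_C2 (curve \<Gamma>)"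
begin

abbreviation "g \<equiv> curve \<Gamma>"
abbreviation "g' \<equiv> (\<lambda>t. vector_derivative (curve \<Gamma>) (at t))"

lemma curve_periodic: "g (t + 1) = g t"
  using reg by (simp add: closed_regular_simple_C2_def)

lemma curve_periodic_int: "g (t + of_int k) = g t"
proof -
  have nat: "g (t + real n) = g t" for n :: nat and t
    by (induction n) (auto simp: curve_periodic add.assoc[symmetric] add.commute[of 1])
  show ?thesis
  proof (cases "0 \<le> k")
    case True
    then show ?thesis using nat[of t "nat k"] by simp
  next
    case False
    then show ?thesis using nat[of "t + of_int k" "nat (- k)"] by simp
  qed
qed

lemma curve_frac: "g (frac t) = g t"
  using curve_periodic_int[of t "- floor t"] by (simp add: frac_def)

lemma curve_inj: "inj_on g {0..<1}"
  using reg by (simp add: closed_regular_simple_C2_def)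

lemma curve_deriv: "(g has_vector_derivative g' t) (at t)"
  using reg by (simp add: closed_regular_simple_C2_def C1_differentiable_on_eq vector_derivative_works)

lemma curve_deriv_nz: "g' t \<noteq> 0"
  using reg by (simp add: closed_regular_simple_C2_def)

lemma curve_deriv_continuous: "continuous_on S g'"
proof -
  have "continuous_on UNIV g'"
    using reg by (simp add: closed_regular_simple_C2_def C1_differentiable_on_eq)
  then show ?thesis by (rule continuous_on_subset) simp
qed

lemma curve_continuous: "continuous_on S g"
  using has_vector_derivative_continuous[OF curve_deriv] by (simp add: continuous_at_imp_continuous_on)

lemma Gam_unit: "Gam \<Gamma> = g ` {0..<1}"
proof -
  have "g t \<in> g ` {0..<1}" for t
    using curve_frac[of t] frac_ge_0[of t] frac_lt_1[of t] by (metis atLeastLessThan_iff imageI)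
  then show ?thesis unfolding Gam_def by auto
qed

lemma Gam_compact: "compact (Gam \<Gamma>)"
proof -
  have "Gam \<Gamma> = g ` {0..1}" unfolding Gam_def using Gam_unit by (auto simp: Gam_def)
  then show ?thesis by (metis compact_continuous_image compact_Icc curve_continuous)
qed

lemma Gam_closed: "closed (Gam \<Gamma>)"
  using Gam_compact by (rule compact_imp_closed)

lemma Gam_nonempty: "Gam \<Gamma> \<noteq> {}"
  by (simp add: Gam_def)

lemma negligible_Gam: "negligible (Gam \<Gamma>)"
  unfolding Gam_def
proof (rule negligible_differentiable_image_lowdim)
  show "g differentiable_on UNIV"
    using curve_deriv by (meson differentiableI_vector differentiable_at_imp_differentiable_on)
qed simp

lemma gtangent_curve:
  assumes "t \<in> {0..<1}" shows "gtangent \<Gamma> (g t) = g' t /\<^sub>R norm (g' t)"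
  unfolding gtangent_def using inv_into_f_f[OF curve_inj assms] by (simp add: Let_def)

lemma norm_gtangent: "x \<in> Gam \<Gamma> \<Longrightarrow> norm (gtangent \<Gamma> x) = 1"
  unfolding gtangent_def Let_def using curve_deriv_nz by simp

lemma norm_gnormal: "x \<in> Gam \<Gamma> \<Longrightarrow> norm (gnormal \<Gamma> x) = 1"
  using norm_gtangent[of x] unfolding gnormal_def
  by (simp add: norm_vec_def L2_set_def sum_2 add.commute)

text \<open>First-order condition: along the curve the squared distance to \<open>z\<close> is
  minimal at \<open>x\<close>, so its derivative vanishes and \<open>z - x\<close> is orthogonal to
  the tangent.\<close>

lemma nearest_normal_Gam:
  assumes x: "x \<in> Gam \<Gamma>" and near: "\<And>y. y \<in> Gam \<Gamma> \<Longrightarrow> dist z x \<le> dist z y"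
  shows "\<exists>\<tau>. z = x + \<tau> *\<^sub>R gnormal \<Gamma> x"
proof -
  \<comment> \<open>The parameter is taken in the half-open period on which \<open>gtangent\<close>
    inverts the curve.\<close>
  obtain t where t: "t \<in> {0..<1}" "x = g t" using x Gam_unit by auto
  have D: "((\<lambda>u. (g u - z) \<bullet> (g u - z)) has_derivative
      (\<lambda>h. (h *\<^sub>R g' t) \<bullet> (g t - z) + (g t - z) \<bullet> (h *\<^sub>R g' t))) (at t)"
    using curve_deriv[of t] unfolding has_vector_derivative_def
    by (auto intro!: derivative_eq_intros simp: inner_commute)
  have "(\<lambda>h. (h *\<^sub>R g' t) \<bullet> (g t - z) + (g t - z) \<bullet> (h *\<^sub>R g' t)) = (\<lambda>h. 0)"
  proof (rule has_derivative_local_min[OF D])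
    have "(g t - z) \<bullet> (g t - z) \<le> (g u - z) \<bullet> (g u - z)" for u
    proof -
      have "norm (g t - z) \<le> norm (g u - z)"
        using near[of "g u"] t(2) by (simp add: Gam_def dist_norm norm_minus_commute)
      then show ?thesis by (simp add: norm_le)
    qed
    then show "\<forall>\<^sub>F u in at t. (g t - z) \<bullet> (g t - z) \<le> (g u - z) \<bullet> (g u - z)"
      by (simp add: always_eventually)
  qed
  from fun_cong[OF this, of 1] have "(g t - z) \<bullet> g' t = 0" by (simp add: inner_commute)
  then have "(z - x) \<bullet> gtangent \<Gamma> x = 0"
    unfolding t(2) gtangent_curve[OF t(1)] by (simp add: inner_diff_left)
  then have "crs (gnormal \<Gamma> x) (z - x) = 0"
    by (simp add: crs_def gnormal_def inner_vec_def sum_2 algebra_simps)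
  moreover have "gnormal \<Gamma> x \<noteq> 0" using norm_gnormal[OF x] by auto
  ultimately obtain k where "z - x = k *\<^sub>R gnormal \<Gamma> x" using crs_zero_parallel by blast
  then show ?thesis by (intro exI[of _ k]) (simp add: algebra_simps)
qed

text \<open>The Jordan curve theorem in the complex plane, transported by the coordinate
  homeomorphism. Equality of both frontiers with the curve turns into the two closure
  inclusions.\<close>

lemma jordan:
  obtains U V where "open U" "open V" "U \<inter> V = {}" "U \<union> V = - Gam \<Gamma>"
    "Gam \<Gamma> \<subseteq> closure U" "Gam \<Gamma> \<subseteq> closure V"
proof -
  define \<phi> where "\<phi> = (\<lambda>x::real^2. Complex (x$1) (x$2))"
  define \<psi> where "\<psi> = (\<lambda>z. Re z *\<^sub>R axis 1 1 + Im z *\<^sub>R axis 2 1 :: real^2)"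
  have inv: "\<psi> (\<phi> x) = x" "\<phi> (\<psi> z) = z" for x z
    by (simp_all add: \<phi>_def \<psi>_def vec_eq_iff forall_2 axis_def)
  have c\<phi>: "continuous_on S \<phi>" for S
    unfolding \<phi>_def complex_eq by (intro continuous_intros)
  have c\<psi>: "continuous_on S \<psi>" for S
    unfolding \<psi>_def by (intro continuous_intros)
  have P: "path_image (\<phi> \<circ> g) = \<phi> ` Gam \<Gamma>"
  proof -
    have "g ` {0..1} = Gam \<Gamma>" using Gam_unit by (auto simp: Gam_def)
    then show ?thesis unfolding path_image_def image_comp[symmetric] by simp
  qed
  have "simple_path (\<phi> \<circ> g)"
    unfolding simple_path_def loop_free_def path_def
  proof (intro conjI ballI impI)
    show "continuous_on {0..1} (\<phi> \<circ> g)" by (intro continuous_on_compose curve_continuous c\<phi>)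
    fix x y :: real assume xy: "x \<in> {0..1}" "y \<in> {0..1}" "(\<phi> \<circ> g) x = (\<phi> \<circ> g) y"
    then have e: "g x = g y" using inv by (metis comp_apply)
    have g1: "g 1 = g 0" using curve_periodic[of 0] by simp
    consider "x < 1" "y < 1" | "x = 1" "y < 1" | "x < 1" "y = 1" | "x = 1" "y = 1" using xy by force
    then show "x = y \<or> x = 0 \<and> y = 1 \<or> x = 1 \<and> y = 0"
    proof cases
      case 1
      then have "x = y" using xy(1,2) by (intro inj_onD[OF curve_inj e]) simp_all
      then show ?thesis ..
    next
      case 2
      then have "g 0 = g y" using e g1 by simp
      then have "0 = y" by (rule inj_onD[OF curve_inj]) (use xy(1,2) 2 in simp_all)
      then show ?thesis using 2 by simp
    next
      case 3
      then have "g x = g 0" using e g1 by simp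
      then have "x = 0" by (rule inj_onD[OF curve_inj]) (use xy(1,2) 3 in simp_all)
      then show ?thesis using 3 by simp
    qed simp
  qed
  moreover have "pathfinish (\<phi> \<circ> g) = pathstart (\<phi> \<circ> g)"
    using curve_periodic[of 0] by (simp add: pathfinish_def pathstart_def)
  ultimately obtain inner outer where io: "open inner" "open outer" "inner \<inter> outer = {}"
    "inner \<union> outer = - path_image (\<phi> \<circ> g)" "frontier inner = path_image (\<phi> \<circ> g)"
    "frontier outer = path_image (\<phi> \<circ> g)"
    using Jordan_curve by metis
  have cl: "Gam \<Gamma> \<subseteq> closure (\<phi> -` A)" if "frontier A = path_image (\<phi> \<circ> g)" for A
  proof
    fix x assume "x \<in> Gam \<Gamma>"
    then have "\<phi> x \<in> closure A" using that P by (auto simp: frontier_def)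
    then have "\<psi> (\<phi> x) \<in> \<psi> ` closure A" by blast
    also have "\<psi> ` closure A \<subseteq> closure (\<psi> ` A)"
      by (rule image_closure_subset[OF c\<psi>]) (auto simp: closure_subset)
    also have "\<psi> ` A = \<phi> -` A" using inv by (auto simp: image_iff) (metis inv(1))
    finally show "x \<in> closure (\<phi> -` A)" by (simp add: inv)
  qed
  have opn: "open (\<phi> -` A)" if "open A" for A
    using continuous_open_vimage[OF that] c\<phi>[of UNIV] by (auto simp: continuous_on_eq_continuous_at)
  show ?thesis
  proof (rule that[of "\<phi> -` inner" "\<phi> -` outer"])
    have "\<phi> x \<in> \<phi> ` Gam \<Gamma> \<longleftrightarrow> x \<in> Gam \<Gamma>" for x using inv by (metis image_iff)
    then show "\<phi> -` inner \<union> \<phi> -` outer = - Gam \<Gamma>"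
      using io(4) unfolding P by (simp add: set_eq_iff)
  qed (use io cl opn in auto)
qed

end

section \<open>The two subdomains and segments contained in the interface\<close>

fun opp :: "side \<Rightarrow> side" where
  "opp Plus = Minus" | "opp Minus = Plus"

lemma opp_neq: "opp s \<noteq> s" by (cases s) auto

lemma side_eq_opp: "s \<noteq> s' \<longleftrightarrow> s' = opp s" by (cases s; cases s') auto

locale interface_domain = regular_curve \<Gamma> for \<Gamma> +
  fixes \<Omega> :: "(real^2) set" and r :: real
  assumes open_\<Omega>: "open \<Omega>" and Gam_sub: "Gam \<Gamma> \<subseteq> \<Omega>"
    and sides_ne: "side_dom \<Gamma> Plus \<noteq> side_dom \<Gamma> Minus"
    and comps: "components (\<Omega> - Gam \<Gamma>) = {side_dom \<Gamma> Plus, side_dom \<Gamma> Minus}"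
    and r_pos: "0 < r"
    and normals_disjoint: "x \<in> Gam \<Gamma> \<Longrightarrow> y \<in> Gam \<Gamma> \<Longrightarrow> x \<noteq> y \<Longrightarrow>
           closed_segment (x - r *\<^sub>R gnormal \<Gamma> x) (x + r *\<^sub>R gnormal \<Gamma> x) \<inter>
           closed_segment (y - r *\<^sub>R gnormal \<Gamma> y) (y + r *\<^sub>R gnormal \<Gamma> y) = {}"
begin

sublocale tubular "Gam \<Gamma>" "gnormal \<Gamma>" r
proof unfold_locales
  show "compact (Gam \<Gamma>)" "Gam \<Gamma> \<noteq> {}" "0 < r" by (rule Gam_compact Gam_nonempty r_pos)+
next
  fix x assume "x \<in> Gam \<Gamma>"
  then show "norm (gnormal \<Gamma> x) = 1" by (rule norm_gnormal)
next
  fix x z assume "x \<in> Gam \<Gamma>" "\<And>y. y \<in> Gam \<Gamma> \<Longrightarrow> dist z x \<le> dist z y"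
  then show "\<exists>\<tau>. z = x + \<tau> *\<^sub>R gnormal \<Gamma> x" by (rule nearest_normal_Gam)
qed (rule normals_disjoint)

lemma side_comp: "side_dom \<Gamma> s \<in> components (\<Omega> - Gam \<Gamma>)"
  using comps by (cases s) auto

lemma open_side: "open (side_dom \<Gamma> s)"
  using open_components[OF open_Diff[OF open_\<Omega> Gam_closed] side_comp] .

lemma side_sub: "side_dom \<Gamma> s \<subseteq> \<Omega> - Gam \<Gamma>"
  using in_components_subset[OF side_comp] .

lemma side_disjoint: "s \<noteq> s' \<Longrightarrow> side_dom \<Gamma> s \<inter> side_dom \<Gamma> s' = {}"
  using components_eq[OF side_comp side_comp, of s s'] sides_ne by (cases s; cases s') auto

lemma in_side_unique: "x \<in> side_dom \<Gamma> s \<Longrightarrow> x \<in> side_dom \<Gamma> s' \<Longrightarrow> s = s'"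
  using side_disjoint by blast

lemma side_union: "side_dom \<Gamma> Plus \<union> side_dom \<Gamma> Minus = \<Omega> - Gam \<Gamma>"
  using Union_components[of "\<Omega> - Gam \<Gamma>"] comps by auto

lemma in_some_side: "x \<in> \<Omega> \<Longrightarrow> x \<notin> Gam \<Gamma> \<Longrightarrow> \<exists>s. x \<in> side_dom \<Gamma> s"
  using side_union by blast

lemma connected_in_side:
  assumes "connected S" "S \<subseteq> \<Omega> - Gam \<Gamma>" shows "\<exists>s. S \<subseteq> side_dom \<Gamma> s"
proof (cases "S = {}")
  case False
  then have "\<Omega> - Gam \<Gamma> \<noteq> {}" using assms(2) by blast
  then obtain c where "c \<in> components (\<Omega> - Gam \<Gamma>)" "S \<subseteq> c"
    using exists_component_superset[OF assms(2) _ assms(1)] by blast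
  then show ?thesis using comps by auto
qed auto

text \<open>Both Jordan components accumulate at every point of the curve, also after intersection
  with the open set \<Omega>. The opposite subdomain is connected and hence contained in one of
  them, so the part of the other one in \<Omega> belongs to
  \<open>side_dom \<Gamma> s\<close>.\<close>

lemma Gam_closure_side: "Gam \<Gamma> \<subseteq> closure (side_dom \<Gamma> s)"
proof -
  obtain U V where UV: "open U" "open V" "U \<inter> V = {}" "U \<union> V = - Gam \<Gamma>"
    "Gam \<Gamma> \<subseteq> closure U" "Gam \<Gamma> \<subseteq> closure V" using jordan .
  have conn: "side_dom \<Gamma> s \<subseteq> U \<or> side_dom \<Gamma> s \<subseteq> V" for s
  proof -
    have "connected (side_dom \<Gamma> s)" using in_components_connected[OF side_comp] .
    moreover have "side_dom \<Gamma> s \<subseteq> U \<union> V" using side_sub[of s] UV(4) by blast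
    ultimately have "U \<inter> side_dom \<Gamma> s = {} \<or> V \<inter> side_dom \<Gamma> s = {}"
      using connectedD[of "side_dom \<Gamma> s" U V] UV(1-3) by blast
    then show ?thesis using \<open>side_dom \<Gamma> s \<subseteq> U \<union> V\<close> by blast
  qed
  have meets: "A \<inter> \<Omega> \<noteq> {} \<and> Gam \<Gamma> \<subseteq> closure (A \<inter> \<Omega>)" if "Gam \<Gamma> \<subseteq> closure A" for A
  proof -
    have "Gam \<Gamma> \<subseteq> \<Omega> \<inter> closure A" using Gam_sub that by blast
    also have "\<dots> \<subseteq> closure (\<Omega> \<inter> A)" using open_Int_closure_subset[OF open_\<Omega>] .
    finally have "Gam \<Gamma> \<subseteq> closure (A \<inter> \<Omega>)" by (simp add: Int_commute)
    then show ?thesis using Gam_nonempty by auto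
  qed
  have cov: "A \<inter> \<Omega> \<subseteq> side_dom \<Gamma> Plus \<union> side_dom \<Gamma> Minus" if "A \<subseteq> U \<union> V" for A
    using side_union UV(4) that by blast
  have key: "Gam \<Gamma> \<subseteq> closure (side_dom \<Gamma> s)" if "A \<inter> B = {}" "A \<subseteq> U \<union> V" "Gam \<Gamma> \<subseteq> closure A"
      "side_dom \<Gamma> (opp s) \<subseteq> B" for A B
  proof -
    have "A \<inter> \<Omega> \<subseteq> side_dom \<Gamma> s" using cov[OF that(2)] that(1,4) by (cases s) auto
    then show ?thesis using meets[OF that(3)] closure_mono by blast
  qed
  show ?thesis
    using conn[of "opp s"]
  proof
    assume "side_dom \<Gamma> (opp s) \<subseteq> U"
    then show ?thesis using key[of V U] UV by blast
  next
    assume "side_dom \<Gamma> (opp s) \<subseteq> V"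
    then show ?thesis using key[of U V] UV by blast
  qed
qed

text \<open>The balls of radius \<open>r\<close> touching the curve at a point of the segment contain no other point of it,
  so the segment is tangent to them.\<close>

lemma gnormal_segment:
  assumes seg: "closed_segment a b \<subseteq> Gam \<Gamma>" and s: "0 < s" "s < 1"
  shows "gnormal \<Gamma> (a + s *\<^sub>R (b - a)) \<bullet> (b - a) = 0"
proof (rule ccontr)
  let ?x = "a + s *\<^sub>R (b - a)"
  define k where "k = \<bar>gnormal \<Gamma> ?x \<bullet> (b - a)\<bar>"
  assume "gnormal \<Gamma> ?x \<bullet> (b - a) \<noteq> 0"
  then have k: "0 < k" by (simp add: k_def)
  have inG: "a + u *\<^sub>R (b - a) \<in> Gam \<Gamma>" if "0 \<le> u" "u \<le> 1" for u
  proof -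
    show ?thesis using seg_point[OF that, of a b] seg by blast
  qed
  \<comment> \<open>A step along the segment so short that the quadratic side of
    \<open>reach\<close> falls below the linear one.\<close>
  define e where "e = min (1 - s) (r * k / ((norm (b - a))\<^sup>2 + 1))"
  have e: "0 < e" "s + e \<le> 1" "e \<le> r * k / ((norm (b - a))\<^sup>2 + 1)"
    using s k r_pos by (auto simp: e_def add_nonneg_pos)
  have "2 * r * \<bar>(a + (s + e) *\<^sub>R (b - a) - ?x) \<bullet> gnormal \<Gamma> ?x\<bar> \<le> (norm (a + (s + e) *\<^sub>R (b - a) - ?x))\<^sup>2"
    using s e by (intro reach inG) auto
  also have "a + (s + e) *\<^sub>R (b - a) - ?x = e *\<^sub>R (b - a)" by (simp add: algebra_simps)
  finally have "e * (2 * r * k) \<le> e * (e * (norm (b - a))\<^sup>2)"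
    using e by (simp add: k_def inner_commute abs_mult power_mult_distrib power2_eq_square mult_ac)
  then have "2 * r * k \<le> e * (norm (b - a))\<^sup>2" using e by simp
  also have "\<dots> \<le> e * ((norm (b - a))\<^sup>2 + 1)" using e by (intro mult_left_mono) auto
  also have "\<dots> \<le> r * k"
    using e(3) by (simp add: pos_le_divide_eq add_nonneg_pos)
  finally show False using k r_pos by simp
qed

text \<open>A point of the tent lies above its foot on the segment in the direction of the curve
  normal. If it were on the curve, \<open>reach\<close> would make its height at least
  \<open>2 * r\<close>, but the height is below a quarter of the base length.\<close>

lemma segment_tent_avoids:
  assumes ab: "a \<noteq> b" and orth: "(b - a) \<bullet> m = 0" and nm: "norm m = norm (b - a)"
    and len: "2 * norm (b - a) < r" and d: "0 < d" "d \<le> 1/4"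
    and seg: "closed_segment a b \<subseteq> Gam \<Gamma>"
  shows "tent a b m d \<inter> Gam \<Gamma> = {}"
proof (rule ccontr)
  assume "\<not> ?thesis"
  then obtain x where x: "x \<in> tent a b m d" "x \<in> Gam \<Gamma>" by blast
  obtain s t where st: "x = a + s *\<^sub>R (b - a) + t *\<^sub>R m" "0 < s" "s < 1" "0 < t" "t < d * s" "t < d * (1 - s)"
    using tent_param[OF x(1) d(1)] .
  have "d * s \<le> d * 1" using st d by (intro mult_left_mono) auto
  then have t: "t < 1/4" using st d by linarith
  let ?y = "a + s *\<^sub>R (b - a)"
  have yG: "?y \<in> Gam \<Gamma>" using seg_point[of s a b] st seg by auto
  have "b - a \<noteq> 0" using ab by simp
  from orthogonal_frame[OF orth nm this, of "gnormal \<Gamma> ?y"]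
  obtain \<sigma> \<tau> where n: "gnormal \<Gamma> ?y = \<sigma> *\<^sub>R (b - a) + \<tau> *\<^sub>R m"
    and n1: "(norm (gnormal \<Gamma> ?y))\<^sup>2 = (\<sigma>\<^sup>2 + \<tau>\<^sup>2) * (norm (b - a))\<^sup>2" by blast
  have "gnormal \<Gamma> ?y \<bullet> (b - a) = 0" by (rule gnormal_segment[OF seg st(2,3)])
  then have "\<sigma> * ((b - a) \<bullet> (b - a)) + \<tau> * ((b - a) \<bullet> m) = 0"
    unfolding n by (simp add: inner_add_left inner_add_right inner_commute)
  then have "\<sigma> * ((b - a) \<bullet> (b - a)) = 0" using orth by simp
  then have \<sigma>: "\<sigma> = 0" using ab by simp
  define l where "l = norm (b - a)"
  have l0: "0 < l" using ab by (simp add: l_def)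
  have "1 = (\<bar>\<tau>\<bar> * l)\<^sup>2" using n1 \<sigma> norm_gnormal[OF yG] by (simp add: l_def power_mult_distrib)
  then have \<tau>: "\<bar>\<tau>\<bar> * l = 1" using l0 power2_eq_imp_eq[of "\<bar>\<tau>\<bar> * l" 1] by simp
  have xy: "x - ?y = t *\<^sub>R m" unfolding st(1) by simp
  have "(x - ?y) \<bullet> gnormal \<Gamma> ?y = t * \<tau> * l\<^sup>2"
    unfolding xy n \<sigma> using nm by (simp add: l_def power2_norm_eq_inner[symmetric])
  then have "\<bar>(x - ?y) \<bullet> gnormal \<Gamma> ?y\<bar> = t * l * (\<bar>\<tau>\<bar> * l)"
    using st l0 by (simp add: abs_mult power2_eq_square)
  then have "2 * r * (t * l) \<le> (t * l)\<^sup>2"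
    using reach[OF yG x(2)] \<tau> nm st unfolding xy by (simp add: l_def power_mult_distrib)
  then have "(t * l) * (2 * r) \<le> (t * l) * (t * l)" by (simp add: power2_eq_square mult_ac)
  then have "2 * r \<le> t * l" using st l0 by simp
  also have "t * l \<le> 1/4 * l" using t l0 by simp
  finally show False using len l0 r_pos unfolding l_def by linarith
qed

text \<open>Each tent misses the curve and lies in one subdomain. Near the midpoint there is nothing
  but the segment and the two tents, while both subdomains accumulate there, so the tents cannot
  share a side.\<close>

lemma segment_two_sides:
  assumes ab: "a \<noteq> b" and orth: "(b - a) \<bullet> m = 0" and nm: "norm m = norm (b - a)"
    and len: "2 * norm (b - a) < r" and d: "0 < d" "d \<le> 1/4"
    and seg: "closed_segment a b \<subseteq> Gam \<Gamma>"
    and sub: "tent a b m d \<subseteq> \<Omega>" "tent a b (- m) d \<subseteq> \<Omega>"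
  obtains s where "tent a b m d \<subseteq> side_dom \<Gamma> s" "tent a b (- m) d \<subseteq> side_dom \<Gamma> (opp s)"
proof -
  have av: "tent a b m d \<inter> Gam \<Gamma> = {}" "tent a b (-m) d \<inter> Gam \<Gamma> = {}"
    using segment_tent_avoids[OF ab orth nm len d seg] segment_tent_avoids[OF ab _ _ len d seg, of "-m"] orth nm by auto
  obtain s where s: "tent a b m d \<subseteq> side_dom \<Gamma> s"
    using connected_in_side[OF convex_connected[OF tent_convex], of a b m d] sub av by blast
  obtain s' where s': "tent a b (-m) d \<subseteq> side_dom \<Gamma> s'"
    using connected_in_side[OF convex_connected[OF tent_convex], of a b "-m" d] sub av by blast
  define x where "x = a + (1/2) *\<^sub>R (b - a)"
  have "0 < (1/2::real)" "(1/2::real) < 1" by auto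
  from kite_neighbourhood[OF orth nm ab d this, folded x_def]
  obtain U where U: "open U" "x \<in> U" "U \<subseteq> tent a b m d \<union> tent a b (- m) d \<union> closed_segment a b" .
  have xG: "x \<in> Gam \<Gamma>"
    using seg_point[of "1/2" a b] seg by (auto simp: x_def)
  have ex: "\<exists>y\<in>side_dom \<Gamma> u. y \<in> tent a b m d \<or> y \<in> tent a b (-m) d" for u
  proof -
    have "x \<in> closure (side_dom \<Gamma> u)" using Gam_closure_side xG by blast
    then have "U \<inter> side_dom \<Gamma> u \<noteq> {}" using open_Int_closure_eq_empty[OF U(1)] U(2) by blast
    then show ?thesis using U(3) seg side_sub by blast
  qed
  have "s' \<noteq> s"
  proof
    assume "s' = s"
    then obtain y where "y \<in> side_dom \<Gamma> (opp s)" "y \<in> side_dom \<Gamma> s" using ex[of "opp s"] s s' by blast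
    then show False using in_side_unique opp_neq by metis
  qed
  then have "s' = opp s" using side_eq_opp by metis
  with s s' show ?thesis using that by blast
qed

end

section \<open>Edges of the mesh\<close>

definition rot :: "real^2 \<Rightarrow> real^2" where
  "rot v = vector [- v$2, v$1]"

lemma rot_orth: "v \<bullet> rot v = 0"
  by (simp add: rot_def inner_vec_def sum_2)

lemma norm_rot: "norm (rot v) = norm v"
  by (simp add: rot_def norm_vec_def L2_set_def sum_2 add.commute)

lemma crs_eq_inner_rot: "crs u v = rot u \<bullet> v"
  by (simp add: rot_def crs_def inner_vec_def sum_2)

lemma closure_finite_UN: "finite A \<Longrightarrow> closure (\<Union>i\<in>A. B i) = (\<Union>i\<in>A. closure (B i))"
  by (induction A rule: finite_induct) auto

text \<open>A sufficiently flat tent stays below the two other edges of the triangle; this is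
  checked by positivity of the barycentric coordinates.\<close>

lemma tent_interior_triangle:
  assumes nc: "crs (b - a) (c - a) \<noteq> 0" and orth: "(b - a) \<bullet> m = 0" and nm: "norm m = norm (b - a)"
    and side: "0 < (c - a) \<bullet> m"
  shows "\<exists>d0>0. \<forall>d. 0 < d \<and> d \<le> d0 \<longrightarrow> tent a b m d \<subseteq> interior (convex hull {a, b, c})"
proof -
  have ba: "b - a \<noteq> 0" using nc by (auto simp: crs_def)
  have ncol: "\<not> collinear {a, b, c}"
  proof
    assume "collinear {a, b, c}"
    then have "collinear {0, b - a, c - a}"
      using collinear_3[of b a c] by (simp add: insert_commute)
    then obtain k where "c - a = k *\<^sub>R (b - a) \<or> b - a = 0"
      using collinear_lemma[of "b - a" "c - a"] by (metis scaleR_zero_left)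
    moreover have "crs (b - a) (k *\<^sub>R (b - a)) = 0" by (simp add: crs_def)
    ultimately show False using nc ba by auto
  qed
  have dim2: "DIM(real^2) = 2" by simp
  obtain s0 t0 where st: "c - a = s0 *\<^sub>R (b - a) + t0 *\<^sub>R m"
    using orthogonal_frame[OF orth nm ba, of "c - a"] by blast
  have "(c - a) \<bullet> m = t0 * (norm m)\<^sup>2"
    unfolding st using orth by (simp add: inner_add_left power2_norm_eq_inner)
  then have t0: "0 < t0" using side by (simp add: zero_less_mult_iff)
  \<comment> \<open>With apex coordinates \<open>(s0, t0)\<close> and
    \<open>\<tau> = t / t0\<close>, the weights of \<open>b\<close> and \<open>a\<close> are
    \<open>s - \<tau> * s0\<close> and \<open>1 - s - \<tau> * (1 - s0)\<close>; the denominator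
    keeps both positive.\<close>
  define d0 where "d0 = t0 / (\<bar>s0\<bar> + \<bar>1 - s0\<bar> + 1)"
  have d0: "0 < d0" using t0 by (simp add: d0_def)
  have d01: "d0 * (\<bar>s0\<bar> + \<bar>1 - s0\<bar> + 1) = t0" unfolding d0_def by simp
  show ?thesis
  proof (intro exI[of _ d0] conjI allI impI subsetI d0)
    fix d x assume d: "0 < d \<and> d \<le> d0" and "x \<in> tent a b m d"
    then obtain s t where x: "x = a + s *\<^sub>R (b - a) + t *\<^sub>R m" "0 < s" "s < 1" "0 < t" "t < d * s" "t < d * (1 - s)"
      by (auto elim: tent_param)
    define \<tau> where "\<tau> = t / t0"
    have \<tau>0: "0 < \<tau>" using x t0 by (simp add: \<tau>_def)
    have b1: "\<tau> * \<bar>s0\<bar> < s"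
    proof -
      have "t * \<bar>s0\<bar> \<le> (d * s) * \<bar>s0\<bar>" using x by (intro mult_right_mono) auto
      also have "\<dots> \<le> (d0 * s) * \<bar>s0\<bar>" using d x by (intro mult_right_mono) auto
      also have "\<dots> = (d0 * \<bar>s0\<bar>) * s" by simp
      also have "\<dots> < (d0 * (\<bar>s0\<bar> + \<bar>1 - s0\<bar> + 1)) * s"
        using x d0 by (intro mult_strict_right_mono mult_strict_left_mono) auto
      finally show ?thesis unfolding d01 using t0 by (simp add: \<tau>_def field_simps)
    qed
    have b2: "\<tau> * \<bar>1 - s0\<bar> < 1 - s"
    proof -
      have "t * \<bar>1 - s0\<bar> \<le> (d * (1 - s)) * \<bar>1 - s0\<bar>" using x by (intro mult_right_mono) auto
      also have "\<dots> \<le> (d0 * (1 - s)) * \<bar>1 - s0\<bar>" using d x by (intro mult_right_mono) auto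
      also have "\<dots> = (d0 * \<bar>1 - s0\<bar>) * (1 - s)" by simp
      also have "\<dots> < (d0 * (\<bar>s0\<bar> + \<bar>1 - s0\<bar> + 1)) * (1 - s)"
        using x d0 by (intro mult_strict_right_mono mult_strict_left_mono) auto
      finally show ?thesis unfolding d01 using t0 by (simp add: \<tau>_def field_simps)
    qed
    have "\<tau> * s0 \<le> \<tau> * \<bar>s0\<bar>" "\<tau> * (1 - s0) \<le> \<tau> * \<bar>1 - s0\<bar>" using \<tau>0 by (auto intro!: mult_left_mono)
    then have pos: "0 < s - \<tau> * s0" "0 < 1 - s - \<tau> * (1 - s0)" using b1 b2 by linarith+
    have "t *\<^sub>R m = \<tau> *\<^sub>R (t0 *\<^sub>R m)" using t0 by (simp add: \<tau>_def)
    also have "t0 *\<^sub>R m = (c - a) - s0 *\<^sub>R (b - a)" using st by simp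
    finally have tm: "t *\<^sub>R m = \<tau> *\<^sub>R (c - a) - (\<tau> * s0) *\<^sub>R (b - a)" by (simp add: scaleR_diff_right)
    have "(1 - s - \<tau> * (1 - s0)) *\<^sub>R a + (s - \<tau> * s0) *\<^sub>R b + \<tau> *\<^sub>R c = x"
      unfolding x(1) tm by (simp add: algebra_simps)
    moreover have "(1 - s - \<tau> * (1 - s0)) + (s - \<tau> * s0) + \<tau> = 1" by (simp add: algebra_simps)
    ultimately show "x \<in> interior (convex hull {a, b, c})"
      unfolding interior_convex_hull_3_minimal[OF ncol dim2] using pos \<tau>0 by blast
  qed
qed

locale mesh =
  fixes \<Omega> :: "(real^2) set" and \<T> :: "(real^2) set set"
  assumes domain: "polygonal_domain \<Omega>" and tri: "triangular_mesh \<Omega> \<T>"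
begin

lemma open_dom: "open \<Omega>" and int_clo: "interior (closure \<Omega>) = \<Omega>"
  using domain by (auto simp: polygonal_domain_def)

lemma finite_mesh: "finite \<T>" and face_mesh: "T \<in> \<T> \<Longrightarrow> T' \<in> \<T> \<Longrightarrow> (T \<inter> T') face_of T"
  and simplex_mesh: "T \<in> \<T> \<Longrightarrow> 2 simplex T" and union_mesh: "\<Union>\<T> = closure \<Omega>"
  using tri by (auto simp: triangular_mesh_def triangulation_def)

lemma polytope_mesh: "T \<in> \<T> \<Longrightarrow> polytope T"
proof -
  assume "T \<in> \<T>"
  then obtain a b c where "T = convex hull {a, b, c}" by (rule two_simplexE[OF simplex_mesh])
  then show ?thesis by (simp add: polytope_convex_hull)
qed

lemma convex_mesh: "T \<in> \<T> \<Longrightarrow> convex T"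
  and closed_mesh: "T \<in> \<T> \<Longrightarrow> closed T" and bounded_mesh: "T \<in> \<T> \<Longrightarrow> bounded T"
  by (simp_all add: polytope_imp_convex polytope_imp_closed polytope_imp_bounded polytope_mesh)

lemma finite_edges: "finite (edges \<T>)"
proof -
  have "edges \<T> = (\<Union>T\<in>\<T>. {e. e facet_of T})" by (auto simp: edges_def)
  then show ?thesis using finite_mesh finite_polytope_facets[OF polytope_mesh] by simp
qed

lemma finite_int_edges: "finite (int_edges \<Omega> \<T>)"
  using finite_edges by (simp add: int_edges_def)

lemma interior_mesh_nonempty: "T \<in> \<T> \<Longrightarrow> interior T \<noteq> {}"
proof -
  assume "T \<in> \<T>"
  then obtain a b c where T: "T = convex hull {a, b, c}" "crs (b - a) (c - a) \<noteq> 0"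
    by (rule two_simplexE[OF simplex_mesh])
  have "affine hull T = UNIV"
    using aff_dim_simplex[OF simplex_mesh[OF \<open>T \<in> \<T>\<close>]] by (intro aff_dim_eq_full[THEN iffD1]) simp
  then have "rel_interior T = interior T" by (rule rel_interior_interior)
  then show ?thesis using rel_interior_eq_empty[OF convex_mesh[OF \<open>T \<in> \<T>\<close>]] T by auto
qed

lemma closure_interior_mesh: "T \<in> \<T> \<Longrightarrow> closure (interior T) = T"
  by (simp add: convex_closure_interior convex_mesh interior_mesh_nonempty closed_mesh)

lemma interior_mesh_sub: "T \<in> \<T> \<Longrightarrow> interior T \<subseteq> \<Omega>"
proof -
  assume "T \<in> \<T>"
  then have "T \<subseteq> closure \<Omega>" using union_mesh by blast
  then show ?thesis using interior_mono int_clo by blast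
qed

text \<open>A face that meets the interior of a convex set is the whole set. Applied to the common
  face, first in \<open>T'\<close> and then in \<open>T\<close>, this gives both inclusions.\<close>

lemma mesh_eqI: "T \<in> \<T> \<Longrightarrow> T' \<in> \<T> \<Longrightarrow> T \<inter> interior T' \<noteq> {} \<Longrightarrow> T = T'"
proof -
  assume T: "T \<in> \<T>" "T' \<in> \<T>" "T \<inter> interior T' \<noteq> {}"
  have 1: "T' \<subseteq> T"
  proof (rule ccontr)
    assume "\<not> ?thesis"
    then have "(T' \<inter> T) \<inter> interior T' = {}"
      using face_of_disjoint_interior[OF face_mesh[OF T(2,1)]] by blast
    then show False using T(3) interior_subset by blast
  qed
  then have "interior T' \<subseteq> interior T" by (rule interior_mono)
  then have "T \<inter> T' \<inter> interior T \<noteq> {}" using interior_mesh_nonempty[OF T(2)] interior_subset by blast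
  then have "T \<inter> T' = T" using face_of_disjoint_interior[OF face_mesh[OF T(1,2)]] by blast
  with 1 show ?thesis by blast
qed

lemma interior_skeleton: "T \<in> \<T> \<Longrightarrow> interior T \<inter> skeleton \<T> = {}"
proof (rule ccontr)
  assume T: "T \<in> \<T>" "interior T \<inter> skeleton \<T> \<noteq> {}"
  then obtain x T' where x: "x \<in> interior T" "T' \<in> \<T>" "x \<in> frontier T'"
    by (auto simp: skeleton_def)
  then have "x \<in> T'" using closed_mesh frontier_subset_closed by blast
  then have "T' = T" using mesh_eqI[OF x(2) T(1)] x by blast
  then show False using x by (simp add: frontier_def)
qed

lemma closed_skeleton: "closed (skeleton \<T>)"
  unfolding skeleton_def using finite_mesh by (intro closed_UN) simp_all

lemma facet_segment:
  assumes "T \<in> \<T>" "e facet_of T"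
  obtains a b c where "e = closed_segment a b" "T = convex hull {a, b, c}" "crs (b - a) (c - a) \<noteq> 0"
proof -
  obtain a b c where T: "T = convex hull {a, b, c}" "crs (b - a) (c - a) \<noteq> 0" and ne: "a \<noteq> b" "a \<noteq> c" "b \<noteq> c"
    and ind: "\<not> affine_dependent {a, b, c}"
    by (rule two_simplexE[OF simplex_mesh[OF assms(1)]])
  from assms(2) obtain u where u: "u \<in> {a, b, c}" "e = convex hull ({a, b, c} - {u})"
    unfolding T(1) facet_of_convex_hull_affine_independent[OF ind] by blast
  consider "u = a" | "u = b" | "u = c" using u by blast
  then show ?thesis
  proof cases
    case 1
    have "{a, b, c} - {u} = {b, c}" using 1 ne by auto
    then have "e = closed_segment b c" using u by (simp add: segment_convex_hull)
    moreover have "crs (c - b) (a - b) \<noteq> 0" using T(2) by (simp add: crs_def algebra_simps)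
    moreover have "T = convex hull {b, c, a}" using T(1) by (simp add: insert_commute)
    ultimately show ?thesis using that by blast
  next
    case 2
    have "{a, b, c} - {u} = {a, c}" using 2 ne by auto
    then have "e = closed_segment a c" using u by (simp add: segment_convex_hull)
    moreover have "crs (c - a) (b - a) \<noteq> 0" using T(2) by (simp add: crs_def algebra_simps)
    moreover have "T = convex hull {a, c, b}" using T(1) by (simp add: insert_commute)
    ultimately show ?thesis using that by blast
  next
    case 3
    have "{a, b, c} - {u} = {a, b}" using 3 ne by auto
    then have "e = closed_segment a b" using u by (simp add: segment_convex_hull)
    then show ?thesis using that T by blast
  qed
qed

lemma facet_apex:
  assumes "T \<in> \<T>" "closed_segment a b facet_of T"
  obtains c where "T = convex hull {a, b, c}" "crs (b - a) (c - a) \<noteq> 0"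
proof -
  obtain a' b' c where e: "closed_segment a b = closed_segment a' b'" "T = convex hull {a', b', c}" "crs (b' - a') (c - a') \<noteq> 0"
    by (rule facet_segment[OF assms])
  have "{a, b} = {a', b'}" using e(1) by (simp add: closed_segment_eq)
  then consider "a = a'" "b = b'" | "a = b'" "b = a'" by (auto simp: doubleton_eq_iff)
  then show ?thesis
  proof cases
    case 1
    then show ?thesis using e that by blast
  next
    case 2
    have "crs (b - a) (c - a) \<noteq> 0" using e(3) unfolding 2 by (simp add: crs_def algebra_simps)
    moreover have "T = convex hull {a, b, c}" using e(2) unfolding 2 by (simp add: insert_commute)
    ultimately show ?thesis using that by blast
  qed
qed

lemma apex_halfspace:
  assumes "(b - a) \<bullet> m = 0" "0 < (c - a) \<bullet> m" "y \<in> convex hull {a, b, c}"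
  shows "0 \<le> (y - a) \<bullet> m"
proof -
  have "convex hull {a, b, c} \<subseteq> {y. m \<bullet> a \<le> m \<bullet> y}"
  proof (rule hull_minimal)
    have "m \<bullet> b = m \<bullet> a" "m \<bullet> a < m \<bullet> c"
      using assms(1,2) by (simp_all add: inner_diff_left inner_diff_right inner_commute[of _ m])
    then show "{a, b, c} \<subseteq> {y. m \<bullet> a \<le> m \<bullet> y}" by auto
    show "convex {y. m \<bullet> a \<le> m \<bullet> y}" by (rule convex_halfspace_ge)
  qed
  then have "m \<bullet> a \<le> m \<bullet> y" using assms(3) by blast
  then show ?thesis by (simp add: inner_diff_right inner_commute[of _ m])
qed

lemma apex_inner_nonzero:
  assumes "crs (b - a) (c - a) \<noteq> 0" shows "(c - a) \<bullet> rot (b - a) \<noteq> 0"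
  using assms by (simp add: crs_eq_inner_rot inner_commute)

text \<open>Near an inner point of \<open>e\<close> in \<Omega>, the half-plane away from
  \<open>T\<close> is covered by finitely many elements, one of which accumulates at the point. Its
  common face with \<open>T\<close> contains a relative interior point of \<open>e\<close>, hence
  all of \<open>e\<close>, and the dimension leaves room for nothing more.\<close>

lemma second_element:
  assumes T: "T \<in> \<T>" and e: "e facet_of T" and int: "\<not> e \<subseteq> frontier \<Omega>"
  shows "\<exists>T'\<in>\<T>. T' \<noteq> T \<and> e facet_of T'"
proof -
  obtain a b c where abc: "e = closed_segment a b" "T = convex hull {a, b, c}" "crs (b - a) (c - a) \<noteq> 0"
    by (rule facet_segment[OF T e])
  define m where "m = (if 0 < (c - a) \<bullet> rot (b - a) then rot (b - a) else - rot (b - a))"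
  have m: "(b - a) \<bullet> m = 0" "0 < (c - a) \<bullet> m"
    using apex_inner_nonzero[OF abc(3)] by (auto simp: m_def rot_orth)
  have ab: "a \<noteq> b" using abc(3) by (auto simp: crs_def)
  have eT: "e \<subseteq> T" using facet_of_imp_subset[OF e] .
  obtain x where x: "x \<in> e" "x \<notin> frontier \<Omega>" using int by blast
  have "x \<in> \<Omega>"
    using x eT T union_mesh open_dom by (auto simp: frontier_def interior_open)
  moreover have "x \<in> closure (open_segment a b)" using x(1) ab abc(1) by simp
  ultimately obtain y where y: "y \<in> open_segment a b" "y \<in> \<Omega>"
    using open_Int_closure_eq_empty[OF open_dom, of "open_segment a b"] by blast
  obtain \<epsilon> where \<epsilon>: "0 < \<epsilon>" "ball y \<epsilon> \<subseteq> \<Omega>" using open_dom y(2) open_contains_ball by metis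
  \<comment> \<open>The open half disc beyond the edge, disjoint from \<open>T\<close> by
    \<open>apex_halfspace\<close>.\<close>
  define H where "H = ball y \<epsilon> \<inter> {z. (z - a) \<bullet> m < 0}"
  obtain s where s: "y = (1 - s) *\<^sub>R a + s *\<^sub>R b" using y(1) unfolding in_segment by blast
  have ya: "(y - a) \<bullet> m = 0"
  proof -
    have "y - a = s *\<^sub>R (b - a)" unfolding s by (simp add: algebra_simps)
    then show ?thesis using m(1) by simp
  qed
  have m0: "m \<noteq> 0" using m by auto
  have "y \<in> closure H"
    unfolding closure_approachable
  proof (intro allI impI)
    fix \<delta> :: real assume "0 < \<delta>"
    define \<eta> where "\<eta> = min \<delta> \<epsilon> / 2 / norm m"
    have \<eta>: "0 < \<eta>" "\<eta> * norm m < \<delta>" "\<eta> * norm m < \<epsilon>" using \<open>0 < \<delta>\<close> \<epsilon>(1) m0 by (auto simp: \<eta>_def)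
    have "(y - \<eta> *\<^sub>R m - a) \<bullet> m = - \<eta> * (norm m)\<^sup>2"
      using ya by (simp add: inner_diff_left power2_norm_eq_inner)
    also have "\<dots> < 0" using \<eta> m0 by (simp add: mult_less_0_iff)
    finally have "y - \<eta> *\<^sub>R m \<in> H" using \<eta> by (simp add: H_def dist_norm)
    moreover have "dist (y - \<eta> *\<^sub>R m) y < \<delta>" using \<eta> by (simp add: dist_norm)
    ultimately show "\<exists>z\<in>H. dist z y < \<delta>" by blast
  qed
  also have "H = (\<Union>T'\<in>\<T>. T' \<inter> H)"
    using \<epsilon>(2) union_mesh closure_subset[of \<Omega>] by (auto simp: H_def)
  also have "closure \<dots> = (\<Union>T'\<in>\<T>. closure (T' \<inter> H))"
    by (rule closure_finite_UN[OF finite_mesh])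
  finally obtain T' where T': "T' \<in> \<T>" "y \<in> closure (T' \<inter> H)" by blast
  have yT': "y \<in> T'" using T' closure_mono[of "T' \<inter> H" T'] closed_mesh[OF T'(1)] by auto
  have "T' \<inter> H \<noteq> {}" using T'(2) by auto
  then obtain z where z: "z \<in> T'" "z \<in> H" by blast
  have zT: "z \<notin> T" using apex_halfspace[OF m, of z] z(2) abc(2) by (auto simp: H_def)
  have ne: "T' \<noteq> T" using z zT by blast
  have F: "(T \<inter> T') face_of T" "(T \<inter> T') face_of T'"
    using face_mesh[OF T T'(1)] face_mesh[OF T'(1) T] by (simp_all add: Int_commute)
  have yT: "y \<in> T \<inter> T'" using yT' y(1) eT abc(1) closed_segment_eq_open by blast
  have eF: "e \<subseteq> T \<inter> T'"
  proof (rule subset_of_face_of[OF F(1) eT])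
    have "rel_interior e = open_segment a b" unfolding abc(1) using ab by (simp add: rel_interior_closed_segment)
    then show "T \<inter> T' \<inter> rel_interior e \<noteq> {}" using yT y(1) by blast
  qed
  have FT: "T \<inter> T' \<noteq> T"
  proof
    assume "T \<inter> T' = T"
    then have "T' \<inter> interior T \<noteq> {}" using interior_mesh_nonempty[OF T] interior_subset by blast
    then show False using mesh_eqI[OF T'(1) T] ne by blast
  qed
  have d1: "aff_dim (T \<inter> T') < 2"
    using face_of_aff_dim_lt[OF convex_mesh[OF T] F(1) FT] aff_dim_simplex[OF simplex_mesh[OF T]] by simp
  have d2: "aff_dim e = 1" using e aff_dim_simplex[OF simplex_mesh[OF T]] by (simp add: facet_of_def)
  have "e face_of (T \<inter> T')"
    using face_of_subset[OF facet_of_imp_face_of[OF e] eF] by simp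
  then have "e = T \<inter> T'"
    using face_of_aff_dim_lt[OF convex_Int[OF convex_mesh[OF T] convex_mesh[OF T'(1)]]] d1 d2 by force
  then have "e facet_of T'"
    using F(2) d2 aff_dim_simplex[OF simplex_mesh[OF T'(1)]] x(1) by (auto simp: facet_of_def)
  then show ?thesis using T'(1) ne by blast
qed

text \<open>Collects the values of the choice operators attached to an edge (end points used by
  \<open>eint\<close>, ordered pair of elements, normal) together with a tent of slope
  \<open>d\<close> in each of the two elements. None of these data involves the interface.\<close>

definition edge_frame :: "real \<Rightarrow> (real^2) set \<Rightarrow> real^2 \<Rightarrow> real^2 \<Rightarrow> real^2 \<Rightarrow> (real^2) set \<Rightarrow> (real^2) set \<Rightarrow> bool" where
  "edge_frame d e a b m T1 T2 \<longleftrightarrow>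
     (SOME (a, b). e = closed_segment a b) = (a, b) \<and> e = closed_segment a b \<and> a \<noteq> b \<and>
     elems_of \<T> e = (T1, T2) \<and> T1 \<noteq> T2 \<and> T1 \<in> \<T> \<and> T2 \<in> \<T> \<and> e facet_of T1 \<and> e facet_of T2 \<and>
     (b - a) \<bullet> m = 0 \<and> norm m = norm (b - a) \<and>
     norm (enormal \<T> e) = 1 \<and> enormal \<T> e \<bullet> (b - a) = 0 \<and>
     tent a b m d \<subseteq> interior T1 \<and> tent a b (- m) d \<subseteq> interior T2"

lemma tent_nonempty:
  assumes "0 < d" shows "tent a b m d \<noteq> {}"
proof -
  have "a + (1/2) *\<^sub>R (b - a) + (d/4) *\<^sub>R m \<in> tent a b m d"
    by (rule tentI[OF refl]) (use assms in auto)
  then show ?thesis by blast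
qed

lemma edge_frame_exists:
  assumes e: "e \<in> int_edges \<Omega> \<T>"
  shows "\<exists>d0>0. \<forall>d. 0 < d \<and> d \<le> d0 \<longrightarrow> (\<exists>a b m T1 T2. edge_frame d e a b m T1 T2)"
proof -
  obtain T where T: "T \<in> \<T>" "e facet_of T" "\<not> e \<subseteq> frontier \<Omega>"
    using e by (auto simp: int_edges_def edges_def)
  obtain T1 T2 where el: "elems_of \<T> e = (T1, T2)" by fastforce
  have "\<exists>p. case p of (T1, T2) \<Rightarrow> T1 \<in> \<T> \<and> T2 \<in> \<T> \<and> T1 \<noteq> T2 \<and> e facet_of T1 \<and> e facet_of T2"
    using second_element[OF T] T by auto
  from someI_ex[OF this] have 1: "T1 \<in> \<T>" "T2 \<in> \<T>" "T1 \<noteq> T2" "e facet_of T1" "e facet_of T2"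
    using el unfolding elems_of_def by auto
  obtain a b where ab: "(SOME (a, b). e = closed_segment a b) = (a, b)" by fastforce
  have "\<exists>p. case p of (a, b) \<Rightarrow> e = closed_segment a b"
  proof -
    obtain a b c where "e = closed_segment a b" by (rule facet_segment[OF T(1,2)])
    then show ?thesis by (intro exI[of _ "(a, b)"]) simp
  qed
  from someI_ex[OF this] have e_ab: "e = closed_segment a b" using ab by auto
  obtain c1 where c1: "T1 = convex hull {a, b, c1}" "crs (b - a) (c1 - a) \<noteq> 0"
    by (rule facet_apex[OF 1(1) 1(4)[unfolded e_ab]])
  obtain c2 where c2: "T2 = convex hull {a, b, c2}" "crs (b - a) (c2 - a) \<noteq> 0"
    by (rule facet_apex[OF 1(2) 1(5)[unfolded e_ab]])
  have ne: "a \<noteq> b" using c1 by (auto simp: crs_def)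
  define m where "m = (if 0 < (c1 - a) \<bullet> rot (b - a) then rot (b - a) else - rot (b - a))"
  have m: "(b - a) \<bullet> m = 0" "0 < (c1 - a) \<bullet> m" "norm m = norm (b - a)"
    using apex_inner_nonzero[OF c1(2)] by (auto simp: m_def rot_orth norm_rot)
  have m0: "m \<noteq> 0" using m by auto
  obtain d1 where d1: "0 < d1" "\<And>d. 0 < d \<and> d \<le> d1 \<Longrightarrow> tent a b m d \<subseteq> interior T1"
    using tent_interior_triangle[OF c1(2) m(1,3,2)] c1(1) by auto
  have "(c2 - a) \<bullet> m \<noteq> 0" using apex_inner_nonzero[OF c2(2)] by (auto simp: m_def)
  \<comment> \<open>Two apices on the same side of the edge would put a flat enough tent into both
    interiors.\<close>
  moreover have "\<not> 0 < (c2 - a) \<bullet> m"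
  proof
    assume "0 < (c2 - a) \<bullet> m"
    then obtain d2 where d2: "0 < d2" "\<And>d. 0 < d \<and> d \<le> d2 \<Longrightarrow> tent a b m d \<subseteq> interior T2"
      using tent_interior_triangle[OF c2(2) m(1,3)] c2(1) by auto
    have "tent a b m (min d1 d2) \<subseteq> interior T1 \<inter> interior T2" using d1 d2 by auto
    then have "T1 \<inter> interior T2 \<noteq> {}"
      using tent_nonempty[of "min d1 d2" a b m] d1(1) d2(1) interior_subset by fastforce
    then show False using mesh_eqI 1 by blast
  qed
  ultimately have "0 < (c2 - a) \<bullet> (- m)" by simp
  then obtain d2 where d2: "0 < d2" "\<And>d. 0 < d \<and> d \<le> d2 \<Longrightarrow> tent a b (-m) d \<subseteq> interior T2"
    using tent_interior_triangle[OF c2(2), of "-m"] m c2(1) by auto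
  define n where "n = - (m /\<^sub>R norm m)"
  have n: "norm n = 1" "n \<bullet> (b - a) = 0" using m0 m(1) by (auto simp: n_def inner_commute)
  have en: "enormal \<T> e = n"
    unfolding enormal_def
  proof (rule the_equality)
    have on_e: "v \<bullet> (y - x) = 0" if v: "v \<bullet> (b - a) = 0" and xy: "x \<in> e" "y \<in> e" for v x y
    proof -
      obtain s t where st: "x = (1 - s) *\<^sub>R a + s *\<^sub>R b" "y = (1 - t) *\<^sub>R a + t *\<^sub>R b"
        using xy unfolding e_ab in_segment by blast
      have "y - x = (t - s) *\<^sub>R (b - a)" unfolding st by (simp add: algebra_simps)
      then show ?thesis using v by simp
    qed
    have ae: "a \<in> e" "b \<in> e" unfolding e_ab by auto
    have out: "n \<bullet> (y - x) \<le> 0" if "x \<in> e" "y \<in> T1" for x y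
    proof -
      have "n \<bullet> (y - a) \<le> 0"
        using apex_halfspace[OF m(1,2)] that(2) c1(1) m0
        by (simp add: n_def inner_commute divide_simps mult_nonneg_nonneg)
      moreover have "n \<bullet> (a - x) = 0" by (rule on_e[OF n(2) that(1) ae(1)])
      moreover have "n \<bullet> (y - x) = n \<bullet> (y - a) + n \<bullet> (a - x)" by (simp add: inner_diff_right)
      ultimately show ?thesis by simp
    qed
    show "norm n = 1 \<and> (\<forall>x\<in>e. \<forall>y\<in>e. n \<bullet> (y - x) = 0) \<and> (\<forall>x\<in>e. \<forall>y\<in>fst (elems_of \<T> e). n \<bullet> (y - x) \<le> 0)"
      using n on_e out el by auto
    fix k assume k: "norm k = 1 \<and> (\<forall>x\<in>e. \<forall>y\<in>e. k \<bullet> (y - x) = 0) \<and> (\<forall>x\<in>e. \<forall>y\<in>fst (elems_of \<T> e). k \<bullet> (y - x) \<le> 0)"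
    have kb: "(b - a) \<bullet> k = 0" using k ae by (auto simp: inner_commute)
    have ba: "b - a \<noteq> 0" using ne by simp
    obtain s t where st: "k = s *\<^sub>R (b - a) + t *\<^sub>R m" using orthogonal_frame[OF m(1,3) ba, of k] by blast
    have "s * ((b - a) \<bullet> (b - a)) = 0" using kb m(1) unfolding st by (simp add: inner_add_right)
    then have "s = 0" using ba by simp
    then have kt: "k = t *\<^sub>R m" using st by simp
    have "c1 \<in> T1" unfolding c1(1) by (rule hull_inc) simp
    then have "k \<bullet> (c1 - a) \<le> 0" using k ae el by auto
    then have "t * ((c1 - a) \<bullet> m) \<le> 0" unfolding kt by (simp add: inner_commute)
    then have "t \<le> 0" using m(2) by (simp add: mult_le_0_iff)
    moreover have "\<bar>t\<bar> * norm m = 1" using k kt by simp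
    ultimately have "t = - (1 / norm m)" using m0 by (simp add: field_simps)
    then show "k = n" unfolding kt n_def by (simp add: divide_inverse)
  qed
  show ?thesis
  proof (intro exI[of _ "min d1 d2"] conjI allI impI)
    fix d assume "0 < d \<and> d \<le> min d1 d2"
    then show "\<exists>a b m T1 T2. edge_frame d e a b m T1 T2"
      unfolding edge_frame_def using ab e_ab ne el 1 m en n d1(2)[of d] d2(2)[of d]
      by (intro exI[of _ a] exI[of _ b] exI[of _ m] exI[of _ T1] exI[of _ T2]) simp
  qed (use d1 d2 in auto)
qed

text \<open>Finitely many edges admit a common slope, fixed by the mesh before any interface is
  considered. The cap 1/4 is the one under which the tent estimates hold.\<close>

lemma edge_frames:
  obtains d where "0 < d" "d \<le> 1/4" "\<And>e. e \<in> int_edges \<Omega> \<T> \<Longrightarrow> \<exists>a b m T1 T2. edge_frame d e a b m T1 T2"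
proof -
  obtain D where D: "\<And>e. e \<in> int_edges \<Omega> \<T> \<Longrightarrow> 0 < D e \<and>
      (\<forall>d. 0 < d \<and> d \<le> D e \<longrightarrow> (\<exists>a b m T1 T2. edge_frame d e a b m T1 T2))"
    using edge_frame_exists by metis
  define d where "d = Min (insert (1/4) (D ` int_edges \<Omega> \<T>))"
  have fin: "finite (insert (1/4) (D ` int_edges \<Omega> \<T>))" using finite_int_edges by simp
  have "0 < d" unfolding d_def using D fin by (subst Min_gr_iff) auto
  moreover have "d \<le> 1/4" unfolding d_def using fin by (intro Min_le) auto
  moreover have "d \<le> D e" if "e \<in> int_edges \<Omega> \<T>" for e unfolding d_def using fin that by (intro Min_le) auto
  ultimately show ?thesis using that D by blast
qed

lemma diameter_le_mesh_size: "T \<in> \<T> \<Longrightarrow> diameter T \<le> mesh_size \<T>"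
  unfolding mesh_size_def using finite_mesh by (intro Max_ge) auto

lemma facet_length_le:
  assumes "T \<in> \<T>" "closed_segment a b facet_of T"
  shows "norm (b - a) \<le> diameter T"
proof -
  have "a \<in> T" "b \<in> T" using facet_of_imp_subset[OF assms(2)] by auto
  then have "dist b a \<le> diameter T" using bounded_mesh[OF assms(1)] by (intro diameter_bounded_bound) auto
  then show ?thesis by (simp add: dist_norm)
qed

end

lemma diameter_segment:
  fixes a b :: "'a::euclidean_space"
  shows "diameter (closed_segment a b) = norm (b - a)"
proof (rule antisym)
  show "diameter (closed_segment a b) \<le> norm (b - a)"
  proof (rule diameter_le)
    fix x y assume "x \<in> closed_segment a b" "y \<in> closed_segment a b"
    then obtain s t where st: "x = (1 - s) *\<^sub>R a + s *\<^sub>R b" "0 \<le> s" "s \<le> 1" "y = (1 - t) *\<^sub>R a + t *\<^sub>R b" "0 \<le> t" "t \<le> 1"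
      unfolding in_segment by blast
    have "x - y = (s - t) *\<^sub>R (b - a)" unfolding st by (simp add: algebra_simps)
    then have "norm (x - y) = \<bar>s - t\<bar> * norm (b - a)" by simp
    also have "\<dots> \<le> 1 * norm (b - a)" using st by (intro mult_right_mono) auto
    finally show "norm (x - y) \<le> norm (b - a)" by simp
  qed simp
  have "dist b a \<le> diameter (closed_segment a b)"
    by (rule diameter_bounded_bound) (auto simp: bounded_closed_segment)
  then show "norm (b - a) \<le> diameter (closed_segment a b)" by (simp add: dist_norm)
qed

section \<open>One-sided limits and integrals\<close>

lemma open_islimpt_closure:
  fixes S :: "(real^2) set"
  assumes "open S" "x \<in> closure S" shows "x islimpt S"
proof (cases "x \<in> S")
  case True
  then show ?thesis using interior_limit_point[of x S] assms(1) by (simp add: interior_open)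
next
  case False
  then show ?thesis using assms(2) by (simp add: closure_def)
qed

text \<open>The way one-sided traces are evaluated: within \<open>S\<close> and near
  \<open>x\<close> the function agrees with a continuous one. That \<open>x\<close> is a limit point
  makes the limit unique, so that \<open>Lim\<close> has a definite value.\<close>

lemma Lim_within_open_eq:
  fixes f q :: "real^2 \<Rightarrow> real"
  assumes "x islimpt S" "open U" "x \<in> U" "\<And>y. y \<in> U \<Longrightarrow> y \<in> S \<Longrightarrow> f y = q y" "continuous_on UNIV q"
  shows "Lim (at x within S) f = q x"
proof (rule tendsto_Lim)
  show "at x within S \<noteq> bot" using assms(1) by (simp add: trivial_limit_within)
  have "(q \<longlongrightarrow> q x) (at x within S)"
    using assms(5) continuous_on_subset[OF assms(5), of S]
    by (meson UNIV_I continuous_on_def subset_UNIV tendsto_within_subset)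
  moreover have "\<forall>\<^sub>F y in at x within S. q y = f y"
    unfolding eventually_at_topological using assms(2-4) by (intro exI[of _ U]) auto
  ultimately show "(f \<longlongrightarrow> q x) (at x within S)" by (rule Lim_transform_eventually)
qed

lemma dn_uminus: "dn (- n) f x = - dn n f x"
  by (simp add: dn_def sum_negf)

text \<open>Serves to identify the curve normal with the edge normal, up to sign, on an edge
  contained in the curve.\<close>

lemma perp_unit_unique:
  fixes n k v :: "real^2"
  assumes "norm n = 1" "norm k = 1" "n \<bullet> v = 0" "k \<bullet> v = 0" "v \<noteq> 0"
  shows "k = n \<or> k = - n"
proof -
  have kn: "crs n k *\<^sub>R v = 0"
  proof -
    have "crs n v * crs n v + (n \<bullet> v) * (n \<bullet> v) = (n \<bullet> n) * (v \<bullet> v)"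
      by (simp add: crs_def inner_vec_def sum_2 algebra_simps)
    then have nv: "crs n v \<noteq> 0" using assms by (auto simp: power2_norm_eq_inner[symmetric])
    have "crs n k * (v \<bullet> v) = (k \<bullet> v) * crs n v - (n \<bullet> v) * crs k v"
      by (simp add: crs_def inner_vec_def sum_2 algebra_simps)
    then show ?thesis using assms by simp
  qed
  then have "crs n k = 0" using assms(5) by simp
  moreover have "n \<noteq> 0" using assms(1) by auto
  ultimately obtain c where c: "k = c *\<^sub>R n" using crs_zero_parallel by blast
  then have "\<bar>c\<bar> = 1" using assms(1,2) by simp
  then show ?thesis using c by (cases "0 \<le> c") auto
qed

lemma segment_in_closure_tent:
  assumes "0 < s" "s < 1" "0 < d" shows "a + s *\<^sub>R (b - a) \<in> closure (tent a b m d)"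
proof (cases "m = 0")
  case True
  have "a + s *\<^sub>R (b - a) \<in> tent a b m d"
    using assms by (intro tentI[where s = s and t = "d * min s (1 - s) / 2"]) (auto simp: True min_def)
  then show ?thesis using closure_subset by blast
next
  case False
  define k where "k = min s (1 - s)"
  have k: "0 < k" "k \<le> s" "k \<le> 1 - s" using assms by (auto simp: k_def)
  show ?thesis
    unfolding closure_approachable
  proof (intro allI impI)
    fix e :: real assume e: "0 < e"
    define t where "t = min (d * k / 2) (e / 2 / norm m)"
    have t: "0 < t" "t \<le> d * k / 2" "t \<le> e / 2 / norm m" using assms k e False by (auto simp: t_def)
    have dk: "0 < d * k" "d * k \<le> d * s" "d * k \<le> d * (1 - s)"
      using assms k by (auto intro!: mult_left_mono simp del: mult_le_cancel_left)
    have "a + s *\<^sub>R (b - a) + t *\<^sub>R m \<in> tent a b m d"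
      by (rule tentI[OF refl]) (use t dk in linarith)+
    moreover have "dist (a + s *\<^sub>R (b - a) + t *\<^sub>R m) (a + s *\<^sub>R (b - a)) < e"
    proof -
      have "t * norm m \<le> (e / 2 / norm m) * norm m" using t by (intro mult_right_mono) auto
      then show ?thesis using t e False by (simp add: dist_norm)
    qed
    ultimately show "\<exists>y\<in>tent a b m d. dist y (a + s *\<^sub>R (b - a)) < e" by blast
  qed
qed

text \<open>Integrability passes between functions that agree off a null set; in the nonintegrable
  case both integrals are 0 by convention.\<close>

lemma set_lint_spike:
  fixes f g :: "'a::euclidean_space \<Rightarrow> real"
  assumes N: "negligible N" and eq: "\<And>x. x \<in> S - N \<Longrightarrow> f x = g x"
  shows "(LINT x:S|lebesgue. f x) = (LINT x:S|lebesgue. g x)"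
proof -
  have iff: "set_integrable lebesgue S f \<longleftrightarrow> set_integrable lebesgue S g"
    by (rule absolutely_integrable_spike_eq[OF N]) (simp add: eq)
  show ?thesis
  proof (cases "set_integrable lebesgue S f")
    case True
    have "integral S f = integral S g"
      by (rule integral_spike[OF N]) (simp add: eq)
    then show ?thesis using set_lebesgue_integral_eq_integral(2) True iff by metis
  next
    case False
    then have "\<not> set_integrable lebesgue S g" using iff by simp
    with False show ?thesis
      unfolding set_integrable_def set_lebesgue_integral_def by (simp add: not_integrable_integral_eq)
  qed
qed

lemma set_integrable_continuous_sub:
  fixes f :: "'a::euclidean_space \<Rightarrow> real"
  assumes "compact K" "continuous_on K f" "E \<subseteq> K" "E \<in> sets lebesgue"
  shows "set_integrable lebesgue E f"
proof -
  have i: "integrable lborel (\<lambda>x. indicator K x *\<^sub>R f x)"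
    by (rule borel_integrable_compact[OF assms(1,2)])
  then have "set_integrable lebesgue K f"
    unfolding set_integrable_def by (subst integrable_completion) auto
  then show ?thesis by (rule set_integrable_subset) (use assms in auto)
qed

lemma set_lint_const:
  assumes "E \<in> sets lebesgue" "E \<subseteq> {p..q}" "0 \<le> c" "p \<le> q"
  shows "(LINT t:E|lebesgue. c) \<le> (q - p) * (c::real)"
proof -
  have "(LINT t:E|lebesgue. c) \<le> (LINT t:{p..q}|lebesgue. c)"
  proof -
    have i: "set_integrable lebesgue {p..q} (\<lambda>t. c)"
      by (rule set_integrable_continuous_sub[of "{p..q}"]) auto
    show ?thesis unfolding set_lebesgue_integral_def
    proof (rule integral_mono)
      show "integrable lebesgue (\<lambda>x. indicat_real E x *\<^sub>R c)"
        using set_integrable_subset[OF i assms(1,2)] by (simp add: set_integrable_def)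
      show "integrable lebesgue (\<lambda>x. indicat_real {p..q} x *\<^sub>R c)"
        using i by (simp add: set_integrable_def)
      show "indicat_real E x *\<^sub>R c \<le> indicat_real {p..q} x *\<^sub>R c" for x
        using assms by (auto simp: indicator_def)
    qed
  qed
  also have "\<dots> = (q - p) * c"
    using assms(4) by (simp add: set_lebesgue_integral_def measure_completion)
  finally show ?thesis .
qed

text \<open>\<open>A\<close> is the average and \<open>D\<close> the jump of the second normal derivative, \<open>j\<close> the jump of the first, on
  a piece \<open>E\<close> of an edge of length \<open>l\<close>. With \<open>\<kappa> = 0\<close> no jump of second derivatives is needed.\<close>

lemma cross_term_bound:
  fixes A D j :: "real \<Rightarrow> real"
  assumes cont: "continuous_on UNIV A" "continuous_on UNIV D" "continuous_on UNIV j"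
    and E: "E \<in> sets lebesgue" "E \<subseteq> {0..1}"
    and pos: "0 < l" "0 < \<beta>" "0 < \<delta>" "0 < L" and L: "L = (LINT t:E|lebesgue. l)"
    and bd: "\<And>t. t \<in> E \<Longrightarrow> (A t)\<^sup>2 \<le> M + \<kappa> * (D t)\<^sup>2"
  shows "2 * (LINT t:E|lebesgue. \<beta> * A t * j t * l) \<le> \<delta> * (\<beta> * L\<^sup>2 * M)
    + \<delta> * \<kappa> * (L * \<beta> * (LINT t:E|lebesgue. (D t)\<^sup>2 * l)) + 1 / \<delta> * (\<beta> / L * (LINT t:E|lebesgue. (j t)\<^sup>2 * l))"
proof -
  have int: "set_integrable lebesgue E f" if "continuous_on UNIV f" for f :: "real \<Rightarrow> real"
    by (rule set_integrable_continuous_sub[of "{0..1}"]) (use that E in \<open>auto intro: continuous_on_subset\<close>)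
  have i1: "set_integrable lebesgue E (\<lambda>t. \<delta> * L * \<beta> * M * l)"
    and i2: "set_integrable lebesgue E (\<lambda>t. \<delta> * L * \<beta> * \<kappa> * ((D t)\<^sup>2 * l))"
    and i3: "set_integrable lebesgue E (\<lambda>t. \<beta> / (\<delta> * L) * ((j t)\<^sup>2 * l))"
    and i4: "set_integrable lebesgue E (\<lambda>t. 2 * (\<beta> * A t * j t * l))"
    by (intro int continuous_intros cont)+
  have "2 * (LINT t:E|lebesgue. \<beta> * A t * j t * l) = (LINT t:E|lebesgue. 2 * (\<beta> * A t * j t * l))"
    by simp
  also have "\<dots> \<le> (LINT t:E|lebesgue. \<delta> * L * \<beta> * M * l + \<delta> * L * \<beta> * \<kappa> * ((D t)\<^sup>2 * l) + \<beta> / (\<delta> * L) * ((j t)\<^sup>2 * l))"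
  proof (rule set_integral_mono[OF i4])
    show "set_integrable lebesgue E (\<lambda>t. \<delta> * L * \<beta> * M * l + \<delta> * L * \<beta> * \<kappa> * ((D t)\<^sup>2 * l) + \<beta> / (\<delta> * L) * ((j t)\<^sup>2 * l))"
      using i1 i2 i3 by (intro set_integral_add)
    fix t assume t: "t \<in> E"
    \<comment> \<open>The weight in Young's inequality is proportional to the length
      \<open>L\<close> of the piece. It puts the factor \<open>L\<close> in front of the jump of
      second derivatives and \<open>1 / L\<close> in front of that of first derivatives, as in the
      penalties.\<close>
    define k where "k = \<delta> * L"
    have k0: "0 < k" using pos by (simp add: k_def)
    have "0 \<le> (k * A t - j t)\<^sup>2" by simp
    then have "2 * (A t * j t) * k \<le> (k * (A t)\<^sup>2 + (j t)\<^sup>2 / k) * k"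
      using k0 by (simp add: power2_eq_square algebra_simps)
    then have "2 * (A t * j t) \<le> k * (A t)\<^sup>2 + (j t)\<^sup>2 / k" using k0 by simp
    also have "\<dots> \<le> k * (M + \<kappa> * (D t)\<^sup>2) + (j t)\<^sup>2 / k" using bd[OF t] k0 by simp
    finally have "(\<beta> * l) * (2 * (A t * j t)) \<le> (\<beta> * l) * (k * (M + \<kappa> * (D t)\<^sup>2) + (j t)\<^sup>2 / k)"
      using pos by (intro mult_left_mono) auto
    then show "2 * (\<beta> * A t * j t * l) \<le> \<delta> * L * \<beta> * M * l + \<delta> * L * \<beta> * \<kappa> * ((D t)\<^sup>2 * l) + \<beta> / (\<delta> * L) * ((j t)\<^sup>2 * l)"
      unfolding k_def by (simp add: algebra_simps)
  qed
  also have "\<dots> = \<delta> * L * \<beta> * M * L + \<delta> * L * \<beta> * \<kappa> * (LINT t:E|lebesgue. (D t)\<^sup>2 * l)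
      + \<beta> / (\<delta> * L) * (LINT t:E|lebesgue. (j t)\<^sup>2 * l)"
  proof -
    have "(LINT t:E|lebesgue. \<delta> * L * \<beta> * M * l) = \<delta> * L * \<beta> * M * L"
      unfolding set_lebesgue_integral_def L by simp
    then show ?thesis using i1 i2 i3 by (simp add: set_integral_add)
  qed
  also have "\<dots> = \<delta> * (\<beta> * L\<^sup>2 * M) + \<delta> * \<kappa> * (L * \<beta> * (LINT t:E|lebesgue. (D t)\<^sup>2 * l))
      + 1 / \<delta> * (\<beta> / L * (LINT t:E|lebesgue. (j t)\<^sup>2 * l))"
    by (simp add: power2_eq_square)
  finally show ?thesis .
qed

text \<open>The curve may touch an edge in an inner point \<open>\<tau>\<close> without crossing it; then the part \<open>E\<close> of the edge
  on one side of the curve consists of two intervals.\<close>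

lemma longest_interval:
  fixes E :: "real set"
  assumes E: "E \<subseteq> {0<..<1}" "E \<noteq> {}" and \<tau>: "0 \<le> \<tau>" "\<tau> \<le> 1" "\<tau> = 0 \<or> \<tau> \<notin> E"
    and left: "{0<..<\<tau>} \<subseteq> E \<or> {0<..<\<tau>} \<inter> E = {}"
    and right: "{\<tau><..<1} \<subseteq> E \<or> {\<tau><..<1} \<inter> E = {}"
  obtains t0 t1 where "0 \<le> t0" "t0 < t1" "t1 \<le> 1" "{t0<..<t1} \<subseteq> E"
    "\<And>t. t \<in> E \<Longrightarrow> -1 \<le> (t - t0) / (t1 - t0) \<and> (t - t0) / (t1 - t0) \<le> 2"
    "\<And>l. E \<in> sets lebesgue \<Longrightarrow> 0 \<le> l \<Longrightarrow> (LINT t:E|lebesgue. l) \<le> 2 * (t1 - t0) * l"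
proof -
  have tauE: "\<tau> \<notin> E" using \<tau> E by auto
  have E01: "0 < t \<and> t < 1" if "t \<in> E" for t using E(1) that by auto
  consider (both) "{0<..<\<tau>} \<subseteq> E" "{\<tau><..<1} \<subseteq> E" | (l) "{0<..<\<tau>} \<subseteq> E" "{\<tau><..<1} \<inter> E = {}"
    | (r) "{0<..<\<tau>} \<inter> E = {}" "{\<tau><..<1} \<subseteq> E" | (none) "{0<..<\<tau>} \<inter> E = {}" "{\<tau><..<1} \<inter> E = {}"
    using left right by blast
  then show ?thesis
  proof cases
    case both
    \<comment> \<open>The longer of the two intervals has length at least 1/2. So the whole edge is
      at most twice as long and stays within [-1, 2] in the affine coordinate of that
      interval.\<close>
    show ?thesis
    proof (cases "1/2 \<le> \<tau>")
      case True
      show ?thesis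
      proof (rule that[of 0 \<tau>])
        show "-1 \<le> (t - 0) / (\<tau> - 0) \<and> (t - 0) / (\<tau> - 0) \<le> 2" if "t \<in> E" for t
          using E01[OF that] True by (auto simp: field_simps)
        fix l :: real assume El: "E \<in> sets lebesgue" "0 \<le> l"
        have "(LINT t:E|lebesgue. l) \<le> (1 - 0) * l"
          by (rule set_lint_const) (use E El in auto)
        also have "\<dots> \<le> 2 * (\<tau> - 0) * l" using True El by (intro mult_right_mono) auto
        finally show "(LINT t:E|lebesgue. l) \<le> 2 * (\<tau> - 0) * l" .
      qed (use both \<tau> True in auto)
    next
      case False
      show ?thesis
      proof (rule that[of \<tau> 1])
        show "-1 \<le> (t - \<tau>) / (1 - \<tau>) \<and> (t - \<tau>) / (1 - \<tau>) \<le> 2" if "t \<in> E" for t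
          using E01[OF that] False \<tau> by (auto simp: field_simps)
        fix l :: real assume El: "E \<in> sets lebesgue" "0 \<le> l"
        have "(LINT t:E|lebesgue. l) \<le> (1 - 0) * l"
          by (rule set_lint_const) (use E El in auto)
        also have "\<dots> \<le> 2 * (1 - \<tau>) * l" using False El by (intro mult_right_mono) auto
        finally show "(LINT t:E|lebesgue. l) \<le> 2 * (1 - \<tau>) * l" .
      qed (use both \<tau> False in auto)
    qed
  next
    case l
    have sub: "E \<subseteq> {0<..<\<tau>}"
    proof
      fix t assume t: "t \<in> E"
      have "t \<notin> {\<tau><..<1}" using t l by blast
      moreover have "t \<noteq> \<tau>" using t tauE by blast
      ultimately show "t \<in> {0<..<\<tau>}" using E01[OF t] by auto
    qed
    then have "0 < \<tau>" using E(2) by fastforce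
    show ?thesis
    proof (rule that[of 0 \<tau>])
      show "-1 \<le> (t - 0) / (\<tau> - 0) \<and> (t - 0) / (\<tau> - 0) \<le> 2" if "t \<in> E" for t
        using subsetD[OF sub that] by (auto simp: field_simps)
      fix l :: real assume El: "E \<in> sets lebesgue" "0 \<le> l"
      have "(LINT t:E|lebesgue. l) \<le> (\<tau> - 0) * l"
        by (rule set_lint_const) (use sub El \<tau> in auto)
      also have "\<dots> \<le> 2 * (\<tau> - 0) * l" using \<open>0 < \<tau>\<close> El by (intro mult_right_mono) auto
      finally show "(LINT t:E|lebesgue. l) \<le> 2 * (\<tau> - 0) * l" .
    qed (use l \<tau> \<open>0 < \<tau>\<close> in auto)
  next
    case r
    have sub: "E \<subseteq> {\<tau><..<1}"
    proof
      fix t assume t: "t \<in> E"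
      have "t \<notin> {0<..<\<tau>}" using t r by blast
      moreover have "t \<noteq> \<tau>" using t tauE by blast
      ultimately show "t \<in> {\<tau><..<1}" using E01[OF t] by auto
    qed
    then have "\<tau> < 1" using E(2) by fastforce
    show ?thesis
    proof (rule that[of \<tau> 1])
      show "-1 \<le> (t - \<tau>) / (1 - \<tau>) \<and> (t - \<tau>) / (1 - \<tau>) \<le> 2" if "t \<in> E" for t
        using subsetD[OF sub that] \<tau> by (auto simp: field_simps)
      fix l :: real assume El: "E \<in> sets lebesgue" "0 \<le> l"
      have "(LINT t:E|lebesgue. l) \<le> (1 - \<tau>) * l"
        by (rule set_lint_const) (use sub El \<tau> in auto)
      also have "\<dots> \<le> 2 * (1 - \<tau>) * l" using \<open>\<tau> < 1\<close> El by (intro mult_right_mono) auto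
      finally show "(LINT t:E|lebesgue. l) \<le> 2 * (1 - \<tau>) * l" .
    qed (use r \<tau> \<open>\<tau> < 1\<close> in auto)
  next
    case none
    obtain t where t: "t \<in> E" using E(2) by blast
    have "t \<notin> {0<..<\<tau>}" "t \<notin> {\<tau><..<1}" using t none by blast+
    moreover have "t \<noteq> \<tau>" using t tauE by blast
    ultimately show ?thesis using E01[OF t] by auto
  qed
qed

section \<open>Piecewise polynomials on the cut mesh\<close>

text \<open>\<open>w T s\<close> is a polynomial on the whole plane representing \<open>v\<close> on
  the part of \<open>T\<close> on side \<open>s\<close>; where that part is empty it is an arbitrary
  polynomial. Traces of the pieces thus make sense however the curve cuts the element.\<close>

locale ife = mesh \<Omega> \<T> + interface_domain \<Gamma> \<Omega> r for \<Omega> \<T> \<Gamma> r +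
  fixes \<beta> :: "side \<Rightarrow> real" and p :: nat and v :: "real^2 \<Rightarrow> real"
    and w :: "(real^2) set \<Rightarrow> side \<Rightarrow> real^2 \<Rightarrow> real"
  assumes \<beta>_pos: "0 < \<beta> s" and p3: "p \<le> 3"
    and w_poly: "T \<in> \<T> \<Longrightarrow> w T s \<in> poly2 p"
    and v_w: "T \<in> \<T> \<Longrightarrow> x \<in> interior T \<Longrightarrow> x \<in> side_dom \<Gamma> s \<Longrightarrow> v x = w T s x"
    and mesh_r: "2 * mesh_size \<T> < r"
    and edge_cut: "e \<in> edges \<T> \<Longrightarrow> e \<subseteq> Gam \<Gamma> \<or> (\<exists>x. Gam \<Gamma> \<inter> e \<subseteq> {x})"
begin

definition energy :: real where
  "energy = (\<Sum>T\<in>\<T>. LINT x:T|lebesgue. coef \<Gamma> \<beta> x * hess_inner v v x)"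

lemma coef_side: "x \<in> side_dom \<Gamma> s \<Longrightarrow> coef \<Gamma> \<beta> x = \<beta> s"
  using in_side_unique[of x s Plus] in_side_unique[of x Plus Minus]
  by (cases s) (auto simp: coef_def)

lemma piece_derivs:
  assumes "T \<in> \<T>" "x \<in> interior T" "x \<in> side_dom \<Gamma> s"
  shows "dn n v x = dn n (w T s) x" "dnn n v x = dnn n (w T s) x"
    "hess_inner v v x = hess_inner (w T s) (w T s) x"
proof -
  let ?S = "interior T \<inter> side_dom \<Gamma> s"
  have S: "open ?S" "x \<in> ?S" "\<And>y. y \<in> ?S \<Longrightarrow> v y = w T s y"
    using assms open_side v_w by auto
  show "dn n v x = dn n (w T s) x" by (rule dn_cong_open[OF S])
  show "dnn n v x = dnn n (w T s) x" by (rule dnn_cong_open[OF S])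
  show "hess_inner v v x = hess_inner (w T s) (w T s) x" by (rule hess_cong_open[OF S])
qed

lemma dnn_w_affine: "T \<in> \<T> \<Longrightarrow> dnn n (w T s) \<in> poly2 1"
  using poly2_dnn[OF w_poly p3] .

lemma dnn_w_continuous: "T \<in> \<T> \<Longrightarrow> continuous_on UNIV (dnn n (w T s))"
  using poly2_continuous[OF dnn_w_affine] .

lemma dn_w_continuous: "T \<in> \<T> \<Longrightarrow> continuous_on UNIV (dn n (w T s))"
  using poly2_dn[OF w_poly] .

text \<open>Off the boundary of \<open>T\<close> and the curve, a null set, the integrand is
  \<open>G\<close>, made of two continuous functions restricted to the two sides. This gives the
  integrability needed to compare with the integral over a ball inside one piece.\<close>

lemma energy_term:
  assumes T: "T \<in> \<T>"
  shows "0 \<le> (LINT x:T|lebesgue. coef \<Gamma> \<beta> x * hess_inner v v x)"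
    and "cball c \<rho> \<subseteq> interior T \<inter> side_dom \<Gamma> s \<Longrightarrow> norm n = 1 \<Longrightarrow>
      \<beta> s * (LINT x:cball c \<rho>|lebesgue. (dnn n (w T s) x)\<^sup>2) \<le> (LINT x:T|lebesgue. coef \<Gamma> \<beta> x * hess_inner v v x)"
proof -
  define A where "A = (\<lambda>s. interior T \<inter> side_dom \<Gamma> s)"
  define f where "f = (\<lambda>s x. \<beta> s * hess_inner (w T s) (w T s) x)"
  define G where "G = (\<lambda>x. indicat_real (A Plus) x * f Plus x + indicat_real (A Minus) x * f Minus x)"
  have f0: "0 \<le> f s x" for s x unfolding f_def using \<beta>_pos[of s] hess_inner_nonneg by (simp add: less_imp_le)
  have cT: "compact T" using closed_mesh[OF T] bounded_mesh[OF T] by (simp add: compact_eq_bounded_closed)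
  have fc: "continuous_on K (f s)" for K s
    unfolding f_def using poly2_hess[OF w_poly[OF T]] by (intro continuous_intros) (auto intro: continuous_on_subset)
  have A_T: "A s \<subseteq> T" for s using interior_subset by (auto simp: A_def)
  have A_m: "A s \<in> sets lebesgue" for s
    using open_side by (simp add: A_def lebesgue_openin)
  have iA: "set_integrable lebesgue T (\<lambda>x. indicat_real (A s) x * f s x)" for s
  proof -
    have "integrable lebesgue (\<lambda>x. indicat_real (A s) x *\<^sub>R (f s x))"
      using set_integrable_continuous_sub[OF cT fc A_T A_m] unfolding set_integrable_def .
    moreover have "(\<lambda>x. indicat_real T x *\<^sub>R (indicat_real (A s) x * f s x)) = (\<lambda>x. indicat_real (A s) x *\<^sub>R f s x)"
      using A_T[of s] by (auto simp: indicator_def fun_eq_iff)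
    ultimately show ?thesis unfolding set_integrable_def by simp
  qed
  have iG: "set_integrable lebesgue T G" unfolding G_def by (intro set_integral_add iA)
  have N: "negligible (frontier T \<union> Gam \<Gamma>)"
    using negligible_convex_frontier[OF convex_mesh[OF T]] negligible_Gam by (rule negligible_Un)
  have FG: "coef \<Gamma> \<beta> x * hess_inner v v x = G x" if "x \<in> T - (frontier T \<union> Gam \<Gamma>)" for x
  proof -
    have x: "x \<in> interior T" "x \<notin> Gam \<Gamma>" using that closed_mesh[OF T] by (auto simp: frontier_def)
    then have "x \<in> \<Omega>" using interior_mesh_sub[OF T] by blast
    then obtain s where s: "x \<in> side_dom \<Gamma> s" using in_some_side x by blast
    have "G x = f s x"
      using s x in_side_unique[OF s] by (cases s) (auto simp: G_def A_def indicator_def)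
    then show ?thesis using coef_side[OF s] piece_derivs(3)[OF T x(1) s] by (simp add: f_def)
  qed
  have eq: "(LINT x:T|lebesgue. coef \<Gamma> \<beta> x * hess_inner v v x) = (LINT x:T|lebesgue. G x)"
    by (rule set_lint_spike[OF N FG])
  have G0: "0 \<le> G x" for x unfolding G_def using f0 by simp
  have "0 \<le> (LINT x:T|lebesgue. G x)"
    unfolding set_lebesgue_integral_def using G0 by (intro integral_nonneg_AE) auto
  then show "0 \<le> (LINT x:T|lebesgue. coef \<Gamma> \<beta> x * hess_inner v v x)" by (simp only: eq)
  assume c: "cball c \<rho> \<subseteq> interior T \<inter> side_dom \<Gamma> s" and n: "norm n = 1"
  let ?B = "cball c \<rho>"
  have BT: "?B \<subseteq> T" using c interior_subset by blast
  have iB: "set_integrable lebesgue ?B (f s)"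
    by (rule set_integrable_continuous_sub[OF compact_cball fc]) auto
  have iD: "set_integrable lebesgue ?B (\<lambda>x. \<beta> s * (dnn n (w T s) x)\<^sup>2)"
    by (rule set_integrable_continuous_sub[OF compact_cball])
      (auto intro!: continuous_intros continuous_on_subset[OF dnn_w_continuous[OF T]])
  have "\<beta> s * (LINT x:?B|lebesgue. (dnn n (w T s) x)\<^sup>2) = (LINT x:?B|lebesgue. \<beta> s * (dnn n (w T s) x)\<^sup>2)"
    by simp
  also have "\<dots> \<le> (LINT x:?B|lebesgue. f s x)"
    by (rule set_integral_mono[OF iD iB]) (use dnn_sq_le_hess[OF n] \<beta>_pos[of s] in \<open>simp add: f_def\<close>)
  also have "\<dots> \<le> (LINT x:T|lebesgue. G x)"
    unfolding set_lebesgue_integral_def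
  proof (rule integral_mono)
    show "integrable lebesgue (\<lambda>x. indicat_real ?B x *\<^sub>R f s x)" using iB unfolding set_integrable_def .
    show "integrable lebesgue (\<lambda>x. indicat_real T x *\<^sub>R G x)" using iG unfolding set_integrable_def .
    fix x
    show "indicat_real ?B x *\<^sub>R f s x \<le> indicat_real T x *\<^sub>R G x"
    proof (cases "x \<in> ?B")
      case True
      then have s: "x \<in> side_dom \<Gamma> s" and x: "x \<in> interior T" using c by auto
      have "G x = f s x"
        using s x in_side_unique[OF s] by (cases s) (auto simp: G_def A_def indicator_def)
      then show ?thesis using True BT by (simp add: indicator_def subset_iff)
    next
      case False
      then show ?thesis using G0[of x] by (simp add: indicator_def)
    qed
  qed
  finally show "\<beta> s * (LINT x:?B|lebesgue. (dnn n (w T s) x)\<^sup>2) \<le> (LINT x:T|lebesgue. coef \<Gamma> \<beta> x * hess_inner v v x)"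
    unfolding eq .
qed

lemma energy_nonneg: "0 \<le> energy"
  unfolding energy_def by (intro sum_nonneg energy_term(1))

text \<open>The energy of one element is replaced by the total one; \<open>coercive\<close> pays for
  this with the number of interior edges.\<close>

lemma energy_local:
  assumes "T \<in> \<T>" "cball c \<rho> \<subseteq> interior T \<inter> side_dom \<Gamma> s" "norm n = 1"
  shows "(LINT x:cball c \<rho>|lebesgue. (dnn n (w T s) x)\<^sup>2) \<le> energy / \<beta> s"
proof -
  have "\<beta> s * (LINT x:cball c \<rho>|lebesgue. (dnn n (w T s) x)\<^sup>2) \<le> (LINT x:T|lebesgue. coef \<Gamma> \<beta> x * hess_inner v v x)"
    by (rule energy_term(2)[OF assms])
  also have "\<dots> \<le> energy"
    unfolding energy_def by (rule member_le_sum[OF assms(1)]) (use energy_term(1) finite_mesh in auto)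
  finally show ?thesis using \<beta>_pos[of s] by (simp add: pos_le_divide_eq mult.commute)
qed

text \<open>The tent lies in one subdomain and its closure contains the inner points of the base,
  which fixes the subdomain.\<close>

lemma tent_in_side:
  assumes s: "\<And>t. 0 < t \<Longrightarrow> t < 1 \<Longrightarrow> a + t *\<^sub>R (b - a) \<in> side_dom \<Gamma> s"
    and d: "0 < d" and sub: "tent a b m d \<subseteq> \<Omega> - Gam \<Gamma>"
  shows "tent a b m d \<subseteq> side_dom \<Gamma> s"
proof -
  obtain s' where s': "tent a b m d \<subseteq> side_dom \<Gamma> s'"
    using connected_in_side[OF convex_connected[OF tent_convex] sub] by blast
  let ?x = "a + (1/2) *\<^sub>R (b - a)"
  have "?x \<in> closure (tent a b m d)" by (rule segment_in_closure_tent) (use d in auto)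
  moreover have "?x \<in> side_dom \<Gamma> s" by (rule s) auto
  ultimately have "side_dom \<Gamma> s \<inter> tent a b m d \<noteq> {}"
    using open_Int_closure_eq_empty[OF open_side] by blast
  then have "s = s'" using s' in_side_unique by blast
  then show ?thesis using s' by simp
qed

text \<open>The tent stands over the interval from \<open>t0\<close> to \<open>t1\<close>, whereas
  \<open>t\<close> may lie outside it, beyond a touching point. The squared interval length in the
  denominator is compensated later by the squared length of the piece in
  \<open>cross_term_bound\<close>.\<close>

lemma trace_bound:
  assumes T: "T \<in> \<T>" and orth: "(b - a) \<bullet> m = 0" and nm: "norm m = norm (b - a)" and ab: "a \<noteq> b"
    and d: "0 < d" "d \<le> 1/4" and sub: "tent a b m d \<subseteq> interior T"
    and J: "0 \<le> t0" "t0 < t1" "t1 \<le> 1" and s: "\<And>t. t0 < t \<Longrightarrow> t < t1 \<Longrightarrow> a + t *\<^sub>R (b - a) \<in> side_dom \<Gamma> s"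
    and av: "tent (a + t0 *\<^sub>R (b - a)) (a + t1 *\<^sub>R (b - a)) ((t1 - t0) *\<^sub>R m) d \<inter> Gam \<Gamma> = {}"
    and n: "norm n = 1" and t: "-1 \<le> (t - t0) / (t1 - t0)" "(t - t0) / (t1 - t0) \<le> 2"
  shows "(dnn n (w T s) (a + t *\<^sub>R (b - a)))\<^sup>2 \<le> 57600 / (pi * d\<^sup>2 * ((t1 - t0) * norm (b - a))\<^sup>2) * (energy / \<beta> s)"
proof -
  define a' where "a' = a + t0 *\<^sub>R (b - a)"
  define b' where "b' = a + t1 *\<^sub>R (b - a)"
  define m' where "m' = (t1 - t0) *\<^sub>R m"
  have ba': "b' - a' = (t1 - t0) *\<^sub>R (b - a)" by (simp add: a'_def b'_def scaleR_diff_left)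
  have nb: "norm (b' - a') = (t1 - t0) * norm (b - a)" using J by (simp add: ba')
  have tsub: "tent a' b' m' d \<subseteq> interior T"
    using tent_sub[OF J d(1), of a b m] sub unfolding a'_def b'_def m'_def by blast
  have tside: "tent a' b' m' d \<subseteq> side_dom \<Gamma> s"
  proof (rule tent_in_side[OF _ d(1)])
    fix u :: real assume u: "0 < u" "u < 1"
    have "a' + u *\<^sub>R (b' - a') = a + (t0 + u * (t1 - t0)) *\<^sub>R (b - a)"
      unfolding ba' by (simp add: a'_def algebra_simps)
    moreover have "u * (t1 - t0) < 1 * (t1 - t0)" using u J by (intro mult_strict_right_mono) auto
    moreover have "0 < u * (t1 - t0)" using u J by simp
    ultimately show "a' + u *\<^sub>R (b' - a') \<in> side_dom \<Gamma> s" using s[of "t0 + u * (t1 - t0)"] by simp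
  next
    show "tent a' b' m' d \<subseteq> \<Omega> - Gam \<Gamma>"
      using tsub interior_mesh_sub[OF T] av unfolding a'_def b'_def m'_def by blast
  qed
  define u where "u = (t - t0) / (t1 - t0)"
  have "u * (t1 - t0) = t - t0" using J by (simp add: u_def)
  then have t_eq: "a + t *\<^sub>R (b - a) = a' + u *\<^sub>R (b' - a')"
    unfolding ba' by (simp add: a'_def scaleR_add_left[symmetric] add.assoc)
  have "(dnn n (w T s) (a' + u *\<^sub>R (b' - a')))\<^sup>2 \<le> 57600 / (pi * d\<^sup>2 * (norm (b' - a'))\<^sup>2) * (energy / \<beta> s)"
  proof (rule tent_trace[OF dnn_w_affine[OF T] _ _ _ d])
    show "(b' - a') \<bullet> m' = 0" using orth by (simp add: ba' m'_def)
    show "norm m' = norm (b' - a')" using nm J by (simp add: nb m'_def)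
    show "a' \<noteq> b'" using nb J ab by auto
    show "(LINT x:cball c \<rho>|lebesgue. (dnn n (w T s) x)\<^sup>2) \<le> energy / \<beta> s" if "cball c \<rho> \<subseteq> tent a' b' m' d" for c \<rho>
      by (rule energy_local[OF T _ n]) (use that tsub tside in blast)
  qed (use t in \<open>auto simp: u_def\<close>)
  then show ?thesis unfolding t_eq nb .
qed

lemma etrace_side:
  assumes T: "T \<in> \<T>" "x \<in> T" and s: "x \<in> side_dom \<Gamma> s" and q: "continuous_on UNIV q"
    and eq: "\<And>y. y \<in> interior T \<Longrightarrow> y \<in> side_dom \<Gamma> s \<Longrightarrow> f y = q y"
  shows "etrace \<Gamma> T f x = q x"
  unfolding etrace_def
proof (rule Lim_within_open_eq[OF _ open_side s _ q])
  have xG: "x \<in> - Gam \<Gamma>" using s side_sub by blast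
  have "x \<in> - Gam \<Gamma> \<inter> closure (interior T)" using xG T closure_interior_mesh by simp
  also have "\<dots> \<subseteq> closure (- Gam \<Gamma> \<inter> interior T)"
    using Gam_closed by (intro open_Int_closure_subset) (simp add: open_Compl)
  finally have "x \<in> closure (interior T - Gam \<Gamma>)" by (simp add: Diff_eq Int_commute)
  then show "x islimpt interior T - Gam \<Gamma>"
    using Gam_closed by (intro open_islimpt_closure) (simp_all add: open_Diff)
qed (use eq in auto)

lemma etrace_derivs_side:
  assumes T: "T \<in> \<T>" "x \<in> T" and s: "x \<in> side_dom \<Gamma> s"
  shows "etrace \<Gamma> T (dn n v) x = dn n (w T s) x" "etrace \<Gamma> T (dnn n v) x = dnn n (w T s) x"
    "etrace \<Gamma> T (\<lambda>y. coef \<Gamma> \<beta> y * dnn n v y) x = \<beta> s * dnn n (w T s) x"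
proof -
  show "etrace \<Gamma> T (dn n v) x = dn n (w T s) x"
    by (rule etrace_side[OF T s dn_w_continuous[OF T(1)]]) (rule piece_derivs[OF T(1)])
  show "etrace \<Gamma> T (dnn n v) x = dnn n (w T s) x"
    by (rule etrace_side[OF T s dnn_w_continuous[OF T(1)]]) (rule piece_derivs[OF T(1)])
  show "etrace \<Gamma> T (\<lambda>y. coef \<Gamma> \<beta> y * dnn n v y) x = \<beta> s * dnn n (w T s) x"
  proof (rule etrace_side[OF T s])
    show "continuous_on UNIV (\<lambda>x. \<beta> s * dnn n (w T s) x)"
      by (intro continuous_intros dnn_w_continuous T)
    show "coef \<Gamma> \<beta> y * dnn n v y = \<beta> s * dnn n (w T s) y" if "y \<in> interior T" "y \<in> side_dom \<Gamma> s" for y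
      using piece_derivs(2)[OF T(1) that] coef_side[OF that(2)] by simp
  qed
qed

end

section \<open>Interior edges and their pieces on the two sides of the interface\<close>

locale ife_edge = ife +
  fixes d :: real and e :: "(real^2) set" and a b m :: "real^2" and T1 T2 :: "(real^2) set"
  assumes d: "0 < d" "d \<le> 1/4" and frame: "edge_frame d e a b m T1 T2"
    and e_int: "e \<in> int_edges \<Omega> \<T>"
begin

abbreviation "X \<equiv> (\<lambda>t. a + t *\<^sub>R (b - a))"
abbreviation "l \<equiv> norm (b - a)"
abbreviation "n \<equiv> enormal \<T> e"

lemma
  shows e_eq: "e = closed_segment a b" and ab: "a \<noteq> b" and el: "elems_of \<T> e = (T1, T2)" and T12: "T1 \<noteq> T2"
    and T1: "T1 \<in> \<T>" and T2: "T2 \<in> \<T>" and facet1: "e facet_of T1" and facet2: "e facet_of T2"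
    and orth: "(b - a) \<bullet> m = 0" and nm: "norm m = l" and norm_n: "norm n = 1"
    and n_orth: "n \<bullet> (b - a) = 0"
    and tent1: "tent a b m d \<subseteq> interior T1" and tent2: "tent a b (- m) d \<subseteq> interior T2"
    and some_ends: "(SOME (a, b). e = closed_segment a b) = (a, b)"
  using frame by (auto simp: edge_frame_def)

lemma l_pos: "0 < l" using ab by simp

lemma orth': "(b - a) \<bullet> (- m) = 0" and nm': "norm (- m) = l"
  using orth nm by simp_all

lemma two_l: "2 * l < r"
  using facet_length_le[OF T1 facet1[unfolded e_eq]] diameter_le_mesh_size[OF T1] mesh_r by linarith

lemma X_e: "0 \<le> t \<Longrightarrow> t \<le> 1 \<Longrightarrow> X t \<in> e"
  unfolding e_eq by (rule seg_point)

lemma e_T: "e \<subseteq> T1" "e \<subseteq> T2"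
  using facet_of_imp_subset facet1 facet2 by blast+

lemma X_inj: "X t = X t' \<longleftrightarrow> t = t'"
  using ab by simp

lemma X_cont: "continuous_on S X"
  by (intro continuous_intros)

text \<open>The kite around an inner point lies in the union of the two elements, so the point is
  interior to the closure of \<Omega>, which is regular open.\<close>

lemma X_dom: "0 < t \<Longrightarrow> t < 1 \<Longrightarrow> X t \<in> \<Omega>"
proof -
  assume t: "0 < t" "t < 1"
  obtain U where U: "open U" "X t \<in> U" "U \<subseteq> tent a b m d \<union> tent a b (- m) d \<union> closed_segment a b"
    using kite_neighbourhood[OF orth nm ab d t] .
  have "U \<subseteq> T1 \<union> T2" using U(3) tent1 tent2 e_T e_eq interior_subset by blast
  also have "\<dots> \<subseteq> closure \<Omega>" using T1 T2 union_mesh by blast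
  finally have "U \<subseteq> interior (closure \<Omega>)" using U(1) by (simp add: interior_maximal)
  then show ?thesis using U(2) int_clo by blast
qed

lemma eint_frame: "eint e S f = (LINT t:{0..1}|lebesgue. indicat_real S (X t) * f (X t) * l)"
  unfolding eint_def some_ends by (simp add: dist_norm norm_minus_commute)

text \<open>The end points are left out: they form a null set, and only inner points of the edge are
  known to lie in \<Omega>.\<close>

definition "E s = {t \<in> {0<..<1}. X t \<in> side_dom \<Gamma> s}"

lemma E_open: "open (E s)"
proof -
  have "open ({0<..<1} \<inter> X -` side_dom \<Gamma> s)"
    by (intro open_Int open_vimage open_side X_cont open_greaterThanLessThan)
  moreover have "E s = {0<..<1} \<inter> X -` side_dom \<Gamma> s" by (auto simp: E_def)
  ultimately show ?thesis by simp
qed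

lemma E_measurable: "E s \<in> sets lebesgue"
  using E_open by (simp add: lebesgue_openin)

lemma E_sub: "E s \<subseteq> {0<..<1}" by (auto simp: E_def)

lemma eint_side: "eint e (side_dom \<Gamma> s) f = (LINT t:E s|lebesgue. f (X t) * l)"
proof -
  have "eint e (side_dom \<Gamma> s) f = (LINT t:{0..1}|lebesgue. indicat_real (E s) t * (f (X t) * l))"
    unfolding eint_frame
    by (rule set_lint_spike[of "{0, 1}"]) (auto simp: E_def indicator_def)
  also have "\<dots> = (LINT t:E s|lebesgue. f (X t) * l)"
    unfolding set_lebesgue_integral_def using E_sub[of s]
    by (intro Bochner_Integration.integral_cong) (auto simp: indicator_def)
  finally show ?thesis .
qed

lemma elen_side: "elen e (side_dom \<Gamma> s) = (LINT t:E s|lebesgue. l)"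
  unfolding elen_def eint_side by simp

lemma diameter_e: "diameter e = l"
  unfolding e_eq by (rule diameter_segment)

definition "Q T s t = dnn n (w T s) (X t)"
definition "jmp s t = dn n (w T1 s) (X t) - dn n (w T2 s) (X t)"

lemma Q_cont: "T \<in> \<T> \<Longrightarrow> continuous_on S (Q T s)"
  unfolding Q_def by (intro continuous_on_compose2[OF dnn_w_continuous X_cont]) auto

lemma jmp_cont: "continuous_on S (jmp s)"
  unfolding jmp_def
  by (intro continuous_intros continuous_on_compose2[OF dn_w_continuous X_cont] T1 T2) auto

lemma values_side:
  assumes "t \<in> E s"
  shows "ejump_n \<T> \<Gamma> e v (X t) = jmp s t" "ejump_nn \<T> \<Gamma> e v (X t) = Q T1 s t - Q T2 s t"
    "eavg_bnn \<T> \<Gamma> \<beta> e v (X t) = \<beta> s * ((Q T1 s t + Q T2 s t) / 2)" "coef \<Gamma> \<beta> (X t) = \<beta> s"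
proof -
  have t: "X t \<in> side_dom \<Gamma> s" "X t \<in> T1" "X t \<in> T2" using assms X_e[of t] e_T by (auto simp: E_def)
  note D1 = etrace_derivs_side[OF T1 t(2,1)] and D2 = etrace_derivs_side[OF T2 t(3,1)]
  show "ejump_n \<T> \<Gamma> e v (X t) = jmp s t" "ejump_nn \<T> \<Gamma> e v (X t) = Q T1 s t - Q T2 s t"
    "eavg_bnn \<T> \<Gamma> \<beta> e v (X t) = \<beta> s * ((Q T1 s t + Q T2 s t) / 2)"
    by (simp_all add: ejump_n_def ejump_nn_def eavg_bnn_def ejump_def eavg_def el D1 D2 jmp_def Q_def
        distrib_left add_divide_distrib)
  show "coef \<Gamma> \<beta> (X t) = \<beta> s" by (rule coef_side[OF t(1)])
qed

lemma E_length_pos: "E s \<noteq> {} \<Longrightarrow> 0 < (LINT t:E s|lebesgue. l)"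
proof -
  assume ne: "E s \<noteq> {}"
  have lm: "E s \<in> lmeasurable"
  proof (rule lmeasurable_open[OF _ E_open])
    have "E s \<subseteq> {0..1}" using E_sub[of s] by force
    then show "bounded (E s)" by (rule bounded_subset[OF compact_imp_bounded[OF compact_Icc]])
  qed
  have "\<not> negligible (E s)" using open_not_negligible[OF E_open ne] .
  then have "measure lebesgue (E s) \<noteq> 0" using lm by (simp add: negligible_iff_measure)
  then have "0 < measure lebesgue (E s)" using measure_nonneg[of lebesgue "E s"] by linarith
  moreover have "(LINT t:E s|lebesgue. l) = measure lebesgue (E s) * l"
    using E_measurable by (simp add: set_lebesgue_integral_def)
  ultimately show ?thesis using l_pos by simp
qed

text \<open>The value \<open>\<tau> = 0\<close> also stands for an edge that the curve misses; inner
  parameters are different from it in any case.\<close>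

lemma E_split:
  assumes "\<not> e \<subseteq> Gam \<Gamma>"
  obtains \<tau> where "0 \<le> \<tau>" "\<tau> \<le> 1" "\<tau> = 0 \<or> X \<tau> \<in> Gam \<Gamma>" "\<And>t. 0 < t \<Longrightarrow> t < 1 \<Longrightarrow> t \<noteq> \<tau> \<Longrightarrow> X t \<notin> Gam \<Gamma>"
proof -
  have "e \<in> edges \<T>" using e_int by (simp add: int_edges_def)
  then obtain x where x: "Gam \<Gamma> \<inter> e \<subseteq> {x}" using edge_cut assms by blast
  show ?thesis
  proof (cases "Gam \<Gamma> \<inter> e = {}")
    case True
    have "X t \<notin> Gam \<Gamma>" if "0 < t" "t < 1" for t using X_e[of t] True that by auto
    then show ?thesis using that[of 0] by auto
  next
    case False
    then have xe: "x \<in> e" "x \<in> Gam \<Gamma>" using x by auto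
    then obtain \<tau> where \<tau>: "x = (1 - \<tau>) *\<^sub>R a + \<tau> *\<^sub>R b" "0 \<le> \<tau>" "\<tau> \<le> 1"
      unfolding e_eq in_segment by blast
    have x_eq: "x = X \<tau>" unfolding \<tau>(1) by (simp add: algebra_simps)
    show ?thesis
    proof (rule that[of \<tau>])
      show "X t \<notin> Gam \<Gamma>" if "0 < t" "t < 1" "t \<noteq> \<tau>" for t
        using X_e[of t] x X_inj that unfolding x_eq by auto
    qed (use \<tau> xe x_eq in auto)
  qed
qed

lemma eint_split:
  assumes nG: "\<not> e \<subseteq> Gam \<Gamma>" and F: "\<And>s. continuous_on UNIV (F s)" and eq: "\<And>s t. t \<in> E s \<Longrightarrow> f (X t) = F s t"
  shows "eint e UNIV f = (LINT t:E Plus|lebesgue. F Plus t * l) + (LINT t:E Minus|lebesgue. F Minus t * l)"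
proof -
  obtain \<tau> where \<tau>: "\<And>t. 0 < t \<Longrightarrow> t < 1 \<Longrightarrow> t \<noteq> \<tau> \<Longrightarrow> X t \<notin> Gam \<Gamma>" using E_split[OF nG] by metis
  let ?g = "\<lambda>s t. indicat_real (E s) t *\<^sub>R (F s t * l)"
  have int: "integrable lebesgue (?g s)" for s
  proof -
    have "E s \<subseteq> {0..1}" using E_sub[of s] by force
    moreover have "continuous_on {0..1} (\<lambda>t. F s t * l)"
      by (intro continuous_intros continuous_on_subset[OF F]) simp
    ultimately show ?thesis
      using set_integrable_continuous_sub[of "{0..1}" "\<lambda>t. F s t * l" "E s"] E_measurable
      unfolding set_integrable_def by blast
  qed
  have "eint e UNIV f = (LINT t:{0..1}|lebesgue. ?g Plus t + ?g Minus t)"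
    unfolding eint_frame
  proof (rule set_lint_spike[of "{0, 1, \<tau>}"])
    fix t assume "t \<in> {0..1} - {0, 1, \<tau>}"
    then have t: "0 < t" "t < 1" "t \<noteq> \<tau>" by auto
    then obtain s where s: "X t \<in> side_dom \<Gamma> s" using in_some_side[OF X_dom] \<tau> by blast
    then have tE: "t \<in> E s" using t by (auto simp: E_def)
    have "t \<notin> E (opp s)" using in_side_unique[OF s, of "opp s"] opp_neq[of s] by (auto simp: E_def)
    then show "indicat_real UNIV (X t) * f (X t) * l = ?g Plus t + ?g Minus t"
      using tE eq[OF tE] by (cases s) auto
  qed simp
  also have "\<dots> = (LINT t|lebesgue. ?g Plus t + ?g Minus t)"
    unfolding set_lebesgue_integral_def using E_sub[of Plus] E_sub[of Minus]
    by (intro Bochner_Integration.integral_cong) (auto simp: indicator_def)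
  also have "\<dots> = (LINT t|lebesgue. ?g Plus t) + (LINT t|lebesgue. ?g Minus t)"
    by (rule Bochner_Integration.integral_add[OF int int])
  finally show ?thesis unfolding set_lebesgue_integral_def .
qed

text \<open>Eight times the constant of \<open>tent_trace\<close>: a factor 2 from the bound
  \<open>2 * M\<close> on the averaged trace, and a factor 4 because the piece is at most twice as
  long as the interval below the tent.\<close>

definition "Ktr = 460800 / (pi * d\<^sup>2)"

text \<open>On an edge that belongs to no interface element the jump of second derivatives is not penalized;
  there both one-sided traces are controlled and \<open>\<kappa> = 0\<close>.\<close>

lemma edge_side_bound:
  assumes nG: "\<not> e \<subseteq> Gam \<Gamma>" and ne: "E s \<noteq> {}" and \<delta>: "0 < \<delta>"
  defines "L \<equiv> (LINT t:E s|lebesgue. l)"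
  shows "\<exists>\<kappa>\<in>{0, 1/2}. (\<kappa> \<noteq> 0 \<longrightarrow> T1 \<inter> Gam \<Gamma> \<noteq> {} \<or> T2 \<inter> Gam \<Gamma> \<noteq> {}) \<and>
    2 * (LINT t:E s|lebesgue. \<beta> s * ((Q T1 s t + Q T2 s t) / 2) * jmp s t * l) \<le>
      \<delta> * (Ktr * energy) + \<delta> * \<kappa> * (L * \<beta> s * (LINT t:E s|lebesgue. (Q T1 s t - Q T2 s t)\<^sup>2 * l))
      + 1 / \<delta> * (\<beta> s / L * (LINT t:E s|lebesgue. (jmp s t)\<^sup>2 * l))"
proof -
  obtain \<tau> where \<tau>: "0 \<le> \<tau>" "\<tau> \<le> 1" "\<tau> = 0 \<or> X \<tau> \<in> Gam \<Gamma>"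
    "\<And>t. 0 < t \<Longrightarrow> t < 1 \<Longrightarrow> t \<noteq> \<tau> \<Longrightarrow> X t \<notin> Gam \<Gamma>" using E_split[OF nG] by blast
  \<comment> \<open>A connected stretch of the edge without curve points lies in one
    subdomain.\<close>
  have part: "I \<subseteq> E s \<or> I \<inter> E s = {}" if I: "I \<subseteq> {0<..<1} - {\<tau>}" "connected I" for I
  proof -
    have "connected (X ` I)" by (intro connected_continuous_image X_cont I)
    moreover have "X ` I \<subseteq> \<Omega> - Gam \<Gamma>"
    proof (rule image_subsetI)
      fix t assume "t \<in> I"
      then have t: "0 < t" "t < 1" "t \<noteq> \<tau>" using I(1) by auto
      show "X t \<in> \<Omega> - Gam \<Gamma>" using X_dom[OF t(1,2)] \<tau>(4)[OF t] by blast
    qed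
    ultimately obtain s' where s': "X ` I \<subseteq> side_dom \<Gamma> s'" using connected_in_side by blast
    show ?thesis
    proof (cases "s' = s")
      case True
      then show ?thesis using s' I(1) by (auto simp: E_def)
    next
      case False
      then have "X t \<notin> side_dom \<Gamma> s" if "t \<in> I" for t using s' that in_side_unique by blast
      then show ?thesis by (auto simp: E_def)
    qed
  qed
  have \<tau>E: "\<tau> = 0 \<or> \<tau> \<notin> E s" using \<tau>(3) side_sub[of s] by (auto simp: E_def)
  have left: "{0<..<\<tau>} \<subseteq> E s \<or> {0<..<\<tau>} \<inter> E s = {}" by (rule part) (use \<tau> in auto)
  have right: "{\<tau><..<1} \<subseteq> E s \<or> {\<tau><..<1} \<inter> E s = {}" by (rule part) (use \<tau> in auto)
  have "\<exists>t0 t1. (0 \<le> t0 \<and> t0 < t1 \<and> t1 \<le> 1 \<and> {t0<..<t1} \<subseteq> E s) \<and>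
      (\<forall>t\<in>E s. -1 \<le> (t - t0) / (t1 - t0) \<and> (t - t0) / (t1 - t0) \<le> 2) \<and> L \<le> 2 * (t1 - t0) * l"
  proof (rule longest_interval[OF E_sub ne \<tau>(1,2) \<tau>E left right])
    fix t0 t1
    assume J: "0 \<le> t0" "t0 < t1" "t1 \<le> 1" "{t0<..<t1} \<subseteq> E s"
      and Jr: "\<And>t. t \<in> E s \<Longrightarrow> -1 \<le> (t - t0) / (t1 - t0) \<and> (t - t0) / (t1 - t0) \<le> 2"
      and Jl: "\<And>l. E s \<in> sets lebesgue \<Longrightarrow> 0 \<le> l \<Longrightarrow> (LINT t:E s|lebesgue. l) \<le> 2 * (t1 - t0) * l"
    have "L \<le> 2 * (t1 - t0) * l" unfolding L_def by (rule Jl[OF E_measurable]) simp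
    then show ?thesis using J Jr by blast
  qed
  then obtain t0 t1 where J: "0 \<le> t0" "t0 < t1" "t1 \<le> 1" "{t0<..<t1} \<subseteq> E s"
    and Jr: "\<And>t. t \<in> E s \<Longrightarrow> -1 \<le> (t - t0) / (t1 - t0) \<and> (t - t0) / (t1 - t0) \<le> 2"
    and L_le: "L \<le> 2 * ((t1 - t0) * l)" unfolding mult.assoc by blast
  have L0: "0 < L" unfolding L_def by (rule E_length_pos[OF ne])
  define M where "M = 57600 / (pi * d\<^sup>2 * ((t1 - t0) * l)\<^sup>2) * (energy / \<beta> s)"
  have inside: "X t \<in> side_dom \<Gamma> s" if "t0 < t" "t < t1" for t using J(4) that by (auto simp: E_def)
  let ?tn = "\<lambda>m. tent (X t0) (X t1) ((t1 - t0) *\<^sub>R m) d"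
  have tr: "(Q T s t)\<^sup>2 \<le> M" if "T \<in> \<T>" "(b - a) \<bullet> m' = 0" "norm m' = l" "tent a b m' d \<subseteq> interior T"
      "?tn m' \<inter> Gam \<Gamma> = {}" "t \<in> E s" for T m' t
    unfolding Q_def M_def
    by (rule trace_bound[OF that(1-3) ab d that(4) J(1-3) inside that(5) norm_n]) (use Jr[OF that(6)] in auto)
  \<comment> \<open>The curve misses the open interval from \<open>t0\<close> to \<open>t1\<close>,
    so \<open>one_tent_avoids\<close> applies to it whatever happens on the rest of the
    edge.\<close>
  have good: "?tn m \<inter> Gam \<Gamma> = {} \<or> ?tn (- m) \<inter> Gam \<Gamma> = {}"
  proof -
    have X10: "X t1 - X t0 = (t1 - t0) *\<^sub>R (b - a)" by (simp add: scaleR_diff_left)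
    have "?tn m \<inter> Gam \<Gamma> = {} \<or> tent (X t0) (X t1) (- ((t1 - t0) *\<^sub>R m)) d \<inter> Gam \<Gamma> = {}"
    proof (rule one_tent_avoids[OF _ _ _ _ d])
      show "X t0 \<noteq> X t1" using X_inj J by auto
      show "(X t1 - X t0) \<bullet> (t1 - t0) *\<^sub>R m = 0" unfolding X10 using orth by simp
      show "norm ((t1 - t0) *\<^sub>R m) = norm (X t1 - X t0)" unfolding X10 norm_scaleR nm ..
      have "(t1 - t0) * l \<le> 1 * l" using J(1,3) by (intro mult_right_mono) (linarith, rule norm_ge_zero)
      moreover have "norm (X t1 - X t0) = (t1 - t0) * l" unfolding X10 norm_scaleR using J(2) by simp
      ultimately have "norm (X t1 - X t0) \<le> l" by simp
      then show "2 * norm (X t1 - X t0) < r" using two_l by linarith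
      show "open_segment (X t0) (X t1) \<inter> Gam \<Gamma> = {}"
      proof -
        have "x \<notin> Gam \<Gamma>" if xseg: "x \<in> open_segment (X t0) (X t1)" for x
        proof -
          obtain u where u: "0 < u" "u < 1" "x = (1 - u) *\<^sub>R X t0 + u *\<^sub>R X t1"
            using xseg unfolding in_segment by blast
          have x_eq: "x = X (t0 + u * (t1 - t0))" unfolding u(3) by (simp add: algebra_simps)
          define k where "k = u * (t1 - t0)"
          have "k < t1 - t0" "0 < k" using u(1,2) J(2) by (simp_all add: k_def)
          then have "t0 < t0 + k" "t0 + k < t1" by linarith+
          then have "X (t0 + k) \<in> side_dom \<Gamma> s" by (rule inside)
          then show ?thesis using side_sub[of s] unfolding x_eq k_def by blast
        qed
        then show ?thesis by blast
      qed
    qed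
    then show ?thesis by simp
  qed
  have tent_meets: "?tn m' \<subseteq> T" if "tent a b m' d \<subseteq> interior T" for m' T
    using tent_sub[OF J(1-3) d(1), of a b m'] that interior_subset by blast
  have cA: "continuous_on UNIV (\<lambda>t. (Q T1 s t + Q T2 s t) / 2)"
    and cD: "continuous_on UNIV (\<lambda>t. Q T1 s t - Q T2 s t)"
    by (intro continuous_intros Q_cont T1 T2; simp)+
  have E01: "E s \<subseteq> {0..1}" using E_sub[of s] by auto
  \<comment> \<open>Stated for open \<kappa>, since the two cases below differ only in that number.
    The length of the interval cancels against \<open>L\<close>.\<close>
  have key: "2 * (LINT t:E s|lebesgue. \<beta> s * ((Q T1 s t + Q T2 s t) / 2) * jmp s t * l) \<le>
      \<delta> * (Ktr * energy) + \<delta> * \<kappa> * (L * \<beta> s * (LINT t:E s|lebesgue. (Q T1 s t - Q T2 s t)\<^sup>2 * l))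
      + 1 / \<delta> * (\<beta> s / L * (LINT t:E s|lebesgue. (jmp s t)\<^sup>2 * l))"
    if "\<And>t. t \<in> E s \<Longrightarrow> ((Q T1 s t + Q T2 s t) / 2)\<^sup>2 \<le> 2 * M + \<kappa> * (Q T1 s t - Q T2 s t)\<^sup>2" for \<kappa>
  proof -
    have "\<beta> s * L\<^sup>2 * (2 * M) \<le> Ktr * energy"
    proof -
      have M0: "0 \<le> M" unfolding M_def using energy_nonneg \<beta>_pos[of s] by simp
      have "L\<^sup>2 \<le> (2 * ((t1 - t0) * l))\<^sup>2" using L_le L0 by (intro power_mono) auto
      then have "\<beta> s * L\<^sup>2 * (2 * M) \<le> \<beta> s * (2 * ((t1 - t0) * l))\<^sup>2 * (2 * M)"
        using M0 \<beta>_pos[of s] by (intro mult_right_mono mult_left_mono) auto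
      also have "\<dots> = Ktr * energy"
      proof -
        define y where "y = ((t1 - t0) * l)\<^sup>2"
        have "0 < y" using J l_pos by (simp add: y_def)
        then show ?thesis
          unfolding M_def Ktr_def power_mult_distrib[of 2] y_def[symmetric]
          using \<beta>_pos[of s] d(1) by (simp add: field_simps)
      qed
      finally show ?thesis .
    qed
    then have "\<delta> * (\<beta> s * L\<^sup>2 * (2 * M)) \<le> \<delta> * (Ktr * energy)" using \<delta> by simp
    moreover have "2 * (LINT t:E s|lebesgue. \<beta> s * ((Q T1 s t + Q T2 s t) / 2) * jmp s t * l)
        \<le> \<delta> * (\<beta> s * L\<^sup>2 * (2 * M)) + \<delta> * \<kappa> * (L * \<beta> s * (LINT t:E s|lebesgue. (Q T1 s t - Q T2 s t)\<^sup>2 * l))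
        + 1 / \<delta> * (\<beta> s / L * (LINT t:E s|lebesgue. (jmp s t)\<^sup>2 * l))"
      by (rule cross_term_bound[OF cA cD jmp_cont E_measurable E01 l_pos \<beta>_pos \<delta> L0 L_def[THEN meta_eq_to_obj_eq] that])
    ultimately show ?thesis by linarith
  qed
  have mean_sq: "((x + y) / 2)\<^sup>2 \<le> 2 * M" if "x\<^sup>2 \<le> M" "y\<^sup>2 \<le> M" for x y M :: real
  proof -
    have "0 \<le> (x - y)\<^sup>2" by simp
    then have "((x + y) / 2)\<^sup>2 \<le> (x\<^sup>2 + y\<^sup>2) / 2" by (simp add: power2_eq_square field_simps)
    also have "\<dots> \<le> M" using that by simp
    also have "M \<le> 2 * M" using order_trans[OF zero_le_power2 that(1)] by simp
    finally show ?thesis .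
  qed
  show ?thesis
  proof (cases "?tn m \<inter> Gam \<Gamma> = {} \<and> ?tn (- m) \<inter> Gam \<Gamma> = {}")
    case True
    have "((Q T1 s t + Q T2 s t) / 2)\<^sup>2 \<le> 2 * M + 0 * (Q T1 s t - Q T2 s t)\<^sup>2" if t: "t \<in> E s" for t
    proof -
      have "(Q T1 s t)\<^sup>2 \<le> M" by (rule tr[OF T1 orth nm tent1 _ t]) (use True in simp)
      moreover have "(Q T2 s t)\<^sup>2 \<le> M" by (rule tr[OF T2 orth' nm' tent2 _ t]) (use True in simp)
      ultimately show ?thesis using mean_sq[of "Q T1 s t" M "Q T2 s t"] by simp
    qed
    from key[OF this] show ?thesis by (intro bexI[of _ 0]) auto
  next
    case False
    \<comment> \<open>A tent meeting the curve makes its element an interface element.\<close>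
    then have meets: "T1 \<inter> Gam \<Gamma> \<noteq> {} \<or> T2 \<inter> Gam \<Gamma> \<noteq> {}"
      using tent_meets[OF tent1] tent_meets[OF tent2] by blast
    \<comment> \<open>The average is the controlled trace \<open>x\<close> minus half the jump; the
      two sides differ by \<open>(3 * x - y)\<^sup>2 / 4\<close>.\<close>
    have sq: "((x + y) / 2)\<^sup>2 \<le> 2 * x\<^sup>2 + 1/2 * (x - y)\<^sup>2" for x y :: real
    proof -
      have "0 \<le> (3 * x - y)\<^sup>2" by simp
      then show ?thesis by (simp add: power2_eq_square field_simps)
    qed
    have "((Q T1 s t + Q T2 s t) / 2)\<^sup>2 \<le> 2 * M + 1/2 * (Q T1 s t - Q T2 s t)\<^sup>2" if t: "t \<in> E s" for t
      using good
    proof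
      assume "?tn m \<inter> Gam \<Gamma> = {}"
      then have "(Q T1 s t)\<^sup>2 \<le> M" by (rule tr[OF T1 orth nm tent1 _ t])
      then show ?thesis using sq[of "Q T1 s t" "Q T2 s t"] by linarith
    next
      assume "?tn (- m) \<inter> Gam \<Gamma> = {}"
      then have "(Q T2 s t)\<^sup>2 \<le> M" by (rule tr[OF T2 orth' nm' tent2 _ t])
      then show ?thesis using sq[of "Q T2 s t" "Q T1 s t"]
        by (simp add: power2_commute[of "Q T2 s t"] add.commute)
    qed
    from key[OF this] meets show ?thesis by (intro bexI[of _ "1/2"]) auto
  qed
qed

end

context ife_edge
begin

definition cross :: real where
  "cross = eint e UNIV (\<lambda>x. eavg_bnn \<T> \<Gamma> \<beta> e v x * ejump_n \<T> \<Gamma> e v x)"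

lemma set_lint_nonneg: "(\<And>x. x \<in> S \<Longrightarrow> 0 \<le> f x) \<Longrightarrow> 0 \<le> (LINT x:S|M. (f x::real))"
  unfolding set_lebesgue_integral_def by (intro integral_nonneg_AE) (auto simp: indicator_def)

lemma eint_side_jumps:
  "eint e (side_dom \<Gamma> s) (\<lambda>x. (ejump_n \<T> \<Gamma> e v x)\<^sup>2) = (LINT t:E s|lebesgue. (jmp s t)\<^sup>2 * l)"
  "eint e (side_dom \<Gamma> s) (\<lambda>x. (ejump_nn \<T> \<Gamma> e v x)\<^sup>2) = (LINT t:E s|lebesgue. (Q T1 s t - Q T2 s t)\<^sup>2 * l)"
  unfolding eint_side by (intro set_lebesgue_integral_cong E_measurable; simp add: values_side)+

lemma cross_split:
  assumes "\<not> e \<subseteq> Gam \<Gamma>"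
  shows "cross = (LINT t:E Plus|lebesgue. \<beta> Plus * ((Q T1 Plus t + Q T2 Plus t) / 2) * jmp Plus t * l)
    + (LINT t:E Minus|lebesgue. \<beta> Minus * ((Q T1 Minus t + Q T2 Minus t) / 2) * jmp Minus t * l)"
  unfolding cross_def
  by (rule eint_split[OF assms, where F = "\<lambda>s t. \<beta> s * ((Q T1 s t + Q T2 s t) / 2) * jmp s t"])
    (auto intro!: continuous_intros Q_cont jmp_cont T1 T2 simp: values_side)

text \<open>On a cut edge the jump of second derivatives is always penalized, so \<kappa> may be
  raised to 1/2 on both pieces.\<close>

lemma cut_edge_bound:
  assumes nG: "\<not> e \<subseteq> Gam \<Gamma>" and \<delta>: "0 < \<delta>"
  shows "2 * cross \<le> (\<Sum>s\<in>{Plus, Minus}. \<delta> * (Ktr * energy)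
      + \<delta> / 2 * (elen e (side_dom \<Gamma> s) * \<beta> s * eint e (side_dom \<Gamma> s) (\<lambda>x. (ejump_nn \<T> \<Gamma> e v x)\<^sup>2))
      + 1 / \<delta> * (\<beta> s / elen e (side_dom \<Gamma> s) * eint e (side_dom \<Gamma> s) (\<lambda>x. (ejump_n \<T> \<Gamma> e v x)\<^sup>2)))"
proof -
  have K: "0 \<le> Ktr" unfolding Ktr_def by simp
  define J where "J s = (LINT t:E s|lebesgue. (jmp s t)\<^sup>2 * l)" for s
  define D where "D s = (LINT t:E s|lebesgue. (Q T1 s t - Q T2 s t)\<^sup>2 * l)" for s
  define C where "C s = (LINT t:E s|lebesgue. \<beta> s * ((Q T1 s t + Q T2 s t) / 2) * jmp s t * l)" for s
  define L where "L s = (LINT t:E s|lebesgue. l)" for s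
  have *: "2 * C s \<le> \<delta> * (Ktr * energy) + \<delta> / 2 * (L s * \<beta> s * D s) + 1 / \<delta> * (\<beta> s / L s * J s)" for s
  \<comment> \<open>An empty piece has length 0 and division by zero yields 0, so only the
    nonnegative energy term is left.\<close>
  proof (cases "E s = {}")
    case True
    then show ?thesis
      using \<delta> K energy_nonneg by (simp add: C_def D_def J_def L_def set_lebesgue_integral_def)
  next
    case False
    obtain \<kappa> where \<kappa>: "\<kappa> \<in> {0, 1/2}"
      and b: "2 * C s \<le> \<delta> * (Ktr * energy) + \<delta> * \<kappa> * (L s * \<beta> s * D s) + 1 / \<delta> * (\<beta> s / L s * J s)"
      using edge_side_bound[OF nG False \<delta>] unfolding C_def D_def J_def L_def by blast
    have "0 \<le> L s * \<beta> s * D s"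
      using \<beta>_pos[of s] unfolding L_def D_def by (intro mult_nonneg_nonneg set_lint_nonneg) auto
    moreover have "\<delta> * \<kappa> \<le> \<delta> / 2" using \<kappa> \<delta> by auto
    ultimately have "\<delta> * \<kappa> * (L s * \<beta> s * D s) \<le> \<delta> / 2 * (L s * \<beta> s * D s)" by (intro mult_right_mono)
    with b show ?thesis by linarith
  qed
  show ?thesis
    unfolding cross_split[OF nG] eint_side_jumps elen_side C_def[symmetric] D_def[symmetric] J_def[symmetric] L_def[symmetric]
    using add_mono[OF *[of Plus] *[of Minus]] by simp
qed

text \<open>An edge off the curve lies on one side, where the coefficient is constant. Here \<kappa>
  has to be kept, because the jump of second derivatives is penalized only on edges of interface
  elements.\<close>

lemma uncut_edge_bound:
  assumes nG: "e \<inter> Gam \<Gamma> = {}" and \<delta>: "0 < \<delta>"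
  shows "\<exists>\<kappa>\<in>{0, 1/2}. (\<kappa> \<noteq> 0 \<longrightarrow> T1 \<inter> Gam \<Gamma> \<noteq> {} \<or> T2 \<inter> Gam \<Gamma> \<noteq> {}) \<and>
    2 * cross \<le> \<delta> * (Ktr * energy)
      + \<delta> * \<kappa> * (diameter e * eint e UNIV (\<lambda>x. coef \<Gamma> \<beta> x * (ejump_nn \<T> \<Gamma> e v x)\<^sup>2))
      + 1 / \<delta> * (1 / diameter e * eint e UNIV (\<lambda>x. coef \<Gamma> \<beta> x * (ejump_n \<T> \<Gamma> e v x)\<^sup>2))"
proof -
  have nG': "\<not> e \<subseteq> Gam \<Gamma>" using X_e[of 0] nG by auto
  have sub: "X ` {0<..<1} \<subseteq> \<Omega> - Gam \<Gamma>"
  proof (rule image_subsetI)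
    fix t :: real assume "t \<in> {0<..<1}"
    then show "X t \<in> \<Omega> - Gam \<Gamma>" using X_dom[of t] X_e[of t] nG by auto
  qed
  have "connected (X ` {0<..<1})" by (intro connected_continuous_image X_cont connected_Ioo)
  from connected_in_side[OF this sub] obtain s where s: "X ` {0<..<1} \<subseteq> side_dom \<Gamma> s" by blast
  have Es: "E s = {0<..<1}" using s by (auto simp: E_def)
  have Eo: "E (opp s) = {}"
    using s in_side_unique[of _ s "opp s"] opp_neq[of s] by (fastforce simp: E_def)
  have other: "(LINT t:E s'|lebesgue. f t) = 0" if "s' \<noteq> s" for s' and f :: "real \<Rightarrow> real"
    using that Eo side_eq_opp[of s s'] by (simp add: set_lebesgue_integral_def)
  have pick: "(LINT t:E Plus|lebesgue. f Plus t) + (LINT t:E Minus|lebesgue. f Minus t) = (LINT t:E s|lebesgue. f s t)"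
    for f :: "side \<Rightarrow> real \<Rightarrow> real"
    using other[of "opp s" "f (opp s)"] opp_neq[of s] by (cases s) auto
  have L: "(LINT t:E s|lebesgue. l) = l"
    unfolding Es set_lebesgue_integral_def by simp
  have n1: "eint e UNIV (\<lambda>x. coef \<Gamma> \<beta> x * (ejump_n \<T> \<Gamma> e v x)\<^sup>2) = \<beta> s * (LINT t:E s|lebesgue. (jmp s t)\<^sup>2 * l)"
  proof -
    have "eint e UNIV (\<lambda>x. coef \<Gamma> \<beta> x * (ejump_n \<T> \<Gamma> e v x)\<^sup>2) =
        (LINT t:E Plus|lebesgue. \<beta> Plus * (jmp Plus t)\<^sup>2 * l) + (LINT t:E Minus|lebesgue. \<beta> Minus * (jmp Minus t)\<^sup>2 * l)"
      by (rule eint_split[OF nG', where F = "\<lambda>s t. \<beta> s * (jmp s t)\<^sup>2"])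
        (auto intro!: continuous_intros jmp_cont simp: values_side)
    also have "\<dots> = (LINT t:E s|lebesgue. \<beta> s * (jmp s t)\<^sup>2 * l)"
      using pick[of "\<lambda>s t. \<beta> s * (jmp s t)\<^sup>2 * l"] .
    finally show ?thesis by (simp add: mult.assoc)
  qed
  have n2: "eint e UNIV (\<lambda>x. coef \<Gamma> \<beta> x * (ejump_nn \<T> \<Gamma> e v x)\<^sup>2) = \<beta> s * (LINT t:E s|lebesgue. (Q T1 s t - Q T2 s t)\<^sup>2 * l)"
  proof -
    have "eint e UNIV (\<lambda>x. coef \<Gamma> \<beta> x * (ejump_nn \<T> \<Gamma> e v x)\<^sup>2) =
        (LINT t:E Plus|lebesgue. \<beta> Plus * (Q T1 Plus t - Q T2 Plus t)\<^sup>2 * l) + (LINT t:E Minus|lebesgue. \<beta> Minus * (Q T1 Minus t - Q T2 Minus t)\<^sup>2 * l)"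
      by (rule eint_split[OF nG', where F = "\<lambda>s t. \<beta> s * (Q T1 s t - Q T2 s t)\<^sup>2"])
        (auto intro!: continuous_intros Q_cont T1 T2 simp: values_side)
    also have "\<dots> = (LINT t:E s|lebesgue. \<beta> s * (Q T1 s t - Q T2 s t)\<^sup>2 * l)"
      using pick[of "\<lambda>s t. \<beta> s * (Q T1 s t - Q T2 s t)\<^sup>2 * l"] .
    finally show ?thesis by (simp add: mult.assoc)
  qed
  have c: "cross = (LINT t:E s|lebesgue. \<beta> s * ((Q T1 s t + Q T2 s t) / 2) * jmp s t * l)"
    unfolding cross_split[OF nG'] using pick[of "\<lambda>s t. \<beta> s * ((Q T1 s t + Q T2 s t) / 2) * jmp s t * l"] .
  have "E s \<noteq> {}" unfolding Es by simp
  from edge_side_bound[OF nG' this \<delta>]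
  show ?thesis unfolding c n1 n2 L diameter_e by (simp add: mult.assoc)
qed

text \<open>Near an inner point of the edge, \<open>S\<close> contains points of one tent only. With
  \<open>S\<close> the interior of an element off the curve this computes \<open>etrace\<close>,
  with \<open>S\<close> a subdomain off the skeleton it computes \<open>gtrace\<close>.\<close>

lemma kite_limit:
  fixes f q :: "real^2 \<Rightarrow> real"
  assumes t: "0 < t" "t < 1" and S: "open S" and ts: "tent a b m' d \<subseteq> S" "tent a b (- m') d \<inter> S = {}" "e \<inter> S = {}"
    and m': "m' = m \<or> m' = - m"
    and fq: "\<And>y. y \<in> tent a b m' d \<Longrightarrow> f y = q y" and q: "continuous_on UNIV q"
  shows "Lim (at (X t) within S) f = q (X t)"
proof -
  obtain U where U: "open U" "X t \<in> U" "U \<subseteq> tent a b m d \<union> tent a b (- m) d \<union> closed_segment a b"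
    using kite_neighbourhood[OF orth nm ab d t] .
  have U': "U \<subseteq> tent a b m' d \<union> tent a b (- m') d \<union> e" using U(3) m' e_eq by auto
  have "X t \<in> closure (tent a b m' d)" by (rule segment_in_closure_tent[OF t d(1)])
  then have "X t \<in> closure S" using closure_mono[OF ts(1)] by blast
  then have lim: "X t islimpt S" by (rule open_islimpt_closure[OF S])
  show ?thesis
    by (rule Lim_within_open_eq[OF lim U(1,2) _ q]) (use U' ts fq in blast)
qed

end

section \<open>Edges contained in the interface\<close>

locale ife_edge_on_curve = ife_edge +
  assumes e_Gam: "e \<subseteq> Gam \<Gamma>"
begin

lemma X_Gam: "0 \<le> t \<Longrightarrow> t \<le> 1 \<Longrightarrow> X t \<in> Gam \<Gamma>"
  using X_e e_Gam by blast

lemma T12_disjoint: "T1 \<inter> interior T2 = {}" "T2 \<inter> interior T1 = {}"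
  using mesh_eqI[OF T1 T2] mesh_eqI[OF T2 T1] T12 by auto

text \<open>The side of the tent in \<open>T1\<close>; of the element itself only this tent is known
  to lie there.\<close>

definition "s1 = (SOME s. tent a b m d \<subseteq> side_dom \<Gamma> s \<and> tent a b (- m) d \<subseteq> side_dom \<Gamma> (opp s))"

lemma s1: "tent a b m d \<subseteq> side_dom \<Gamma> s1" "tent a b (- m) d \<subseteq> side_dom \<Gamma> (opp s1)"
proof -
  have sub: "tent a b m d \<subseteq> \<Omega>" "tent a b (- m) d \<subseteq> \<Omega>"
    using tent1 tent2 interior_mesh_sub T1 T2 by blast+
  obtain s where "tent a b m d \<subseteq> side_dom \<Gamma> s" "tent a b (- m) d \<subseteq> side_dom \<Gamma> (opp s)"
    using segment_two_sides[OF ab orth nm two_l d e_Gam[unfolded e_eq] sub] .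
  then have "\<exists>s. tent a b m d \<subseteq> side_dom \<Gamma> s \<and> tent a b (- m) d \<subseteq> side_dom \<Gamma> (opp s)" by blast
  from someI_ex[OF this] show "tent a b m d \<subseteq> side_dom \<Gamma> s1" "tent a b (- m) d \<subseteq> side_dom \<Gamma> (opp s1)"
    unfolding s1_def by auto
qed

lemma etrace1:
  assumes t: "0 < t" "t < 1" and fq: "\<And>y. y \<in> tent a b m d \<Longrightarrow> f y = q y" and q: "continuous_on UNIV q"
  shows "etrace \<Gamma> T1 f (X t) = q (X t)"
  unfolding etrace_def
proof (rule kite_limit[OF t _ _ _ _ _ fq q, of _ m])
  show "open (interior T1 - Gam \<Gamma>)" using Gam_closed by (simp add: open_Diff)
  show "tent a b m d \<subseteq> interior T1 - Gam \<Gamma>" using tent1 s1 side_sub by blast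
  show "tent a b (- m) d \<inter> (interior T1 - Gam \<Gamma>) = {}" using tent2 T12_disjoint interior_subset by blast
qed (use e_Gam in auto)

lemma etrace2:
  assumes t: "0 < t" "t < 1" and fq: "\<And>y. y \<in> tent a b (- m) d \<Longrightarrow> f y = q y" and q: "continuous_on UNIV q"
  shows "etrace \<Gamma> T2 f (X t) = q (X t)"
  unfolding etrace_def
proof (rule kite_limit[OF t _ _ _ _ _ fq q, of _ "- m"])
  show "open (interior T2 - Gam \<Gamma>)" using Gam_closed by (simp add: open_Diff)
  show "tent a b (- m) d \<subseteq> interior T2 - Gam \<Gamma>" using tent2 s1 side_sub by blast
  show "tent a b (- (- m)) d \<inter> (interior T2 - Gam \<Gamma>) = {}"
    unfolding minus_minus using tent1 T12_disjoint interior_subset by blast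
qed (use e_Gam in auto)

lemma gtrace1:
  assumes t: "0 < t" "t < 1" and fq: "\<And>y. y \<in> tent a b m d \<Longrightarrow> f y = q y" and q: "continuous_on UNIV q"
  shows "gtrace \<T> \<Gamma> s1 f (X t) = q (X t)"
  unfolding gtrace_def
proof (rule kite_limit[OF t _ _ _ _ _ fq q, of _ m])
  show "open (side_dom \<Gamma> s1 - skeleton \<T>)" using open_side closed_skeleton by (simp add: open_Diff)
  show "tent a b m d \<subseteq> side_dom \<Gamma> s1 - skeleton \<T>" using tent1 s1 interior_skeleton[OF T1] by blast
  show "tent a b (- m) d \<inter> (side_dom \<Gamma> s1 - skeleton \<T>) = {}"
    using s1(2) side_disjoint[OF opp_neq[of s1]] by blast
  show "e \<inter> (side_dom \<Gamma> s1 - skeleton \<T>) = {}" using e_Gam side_sub by blast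
qed auto

lemma gtrace2:
  assumes t: "0 < t" "t < 1" and fq: "\<And>y. y \<in> tent a b (- m) d \<Longrightarrow> f y = q y" and q: "continuous_on UNIV q"
  shows "gtrace \<T> \<Gamma> (opp s1) f (X t) = q (X t)"
  unfolding gtrace_def
proof (rule kite_limit[OF t _ _ _ _ _ fq q, of _ "- m"])
  show "open (side_dom \<Gamma> (opp s1) - skeleton \<T>)" using open_side closed_skeleton by (simp add: open_Diff)
  show "tent a b (- m) d \<subseteq> side_dom \<Gamma> (opp s1) - skeleton \<T>" using tent2 s1 interior_skeleton[OF T2] by blast
  show "tent a b (- (- m)) d \<inter> (side_dom \<Gamma> (opp s1) - skeleton \<T>) = {}"
    using s1(1) side_disjoint[OF opp_neq[of s1]] by auto
  show "e \<inter> (side_dom \<Gamma> (opp s1) - skeleton \<T>) = {}" using e_Gam side_sub by blast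
qed auto

lemma tent_values:
  "y \<in> tent a b m d \<Longrightarrow> dn k v y = dn k (w T1 s1) y"
  "y \<in> tent a b m d \<Longrightarrow> coef \<Gamma> \<beta> y * dnn k v y = \<beta> s1 * dnn k (w T1 s1) y"
  "y \<in> tent a b (- m) d \<Longrightarrow> dn k v y = dn k (w T2 (opp s1)) y"
  "y \<in> tent a b (- m) d \<Longrightarrow> coef \<Gamma> \<beta> y * dnn k v y = \<beta> (opp s1) * dnn k (w T2 (opp s1)) y"
proof -
  assume y: "y \<in> tent a b m d"
  then have y: "y \<in> interior T1" "y \<in> side_dom \<Gamma> s1" using tent1 s1 by auto
  show "dn k v y = dn k (w T1 s1) y" by (rule piece_derivs(1)[OF T1 y])
  show "coef \<Gamma> \<beta> y * dnn k v y = \<beta> s1 * dnn k (w T1 s1) y"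
    using piece_derivs(2)[OF T1 y] coef_side[OF y(2)] by simp
next
  assume y: "y \<in> tent a b (- m) d"
  then have y: "y \<in> interior T2" "y \<in> side_dom \<Gamma> (opp s1)" using tent2 s1 by auto
  show "dn k v y = dn k (w T2 (opp s1)) y" by (rule piece_derivs(1)[OF T2 y])
  show "coef \<Gamma> \<beta> y * dnn k v y = \<beta> (opp s1) * dnn k (w T2 (opp s1)) y"
    using piece_derivs(2)[OF T2 y] coef_side[OF y(2)] by simp
qed

text \<open>The squared jump written with two polynomials and the fixed edge normal, hence
  continuous on the plane; \<open>gjump_n\<close> is identified with it only at inner points of the
  edge.\<close>

definition "P x = (dn n (w T1 s1) x - dn n (w T2 (opp s1)) x)\<^sup>2"

lemma P_cont: "continuous_on S P"
proof -
  have "continuous_on UNIV P" unfolding P_def by (intro continuous_intros dn_w_continuous T1 T2)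
  then show ?thesis by (rule continuous_on_subset) simp
qed

text \<open>Limits from the subdomains and from the elements are taken in the same two tents, so
  they agree up to order, and the two normals agree up to sign. The square removes both
  ambiguities.\<close>

lemma gjump_n_P:
  assumes t: "0 < t" "t < 1" shows "(gjump_n \<T> \<Gamma> v (X t))\<^sup>2 = P (X t)"
proof -
  let ?\<nu> = "gnormal \<Gamma> (X t)"
  have ba: "b - a \<noteq> 0" using ab by simp
  have "norm ?\<nu> = 1" using X_Gam[of t] t by (intro norm_gnormal) auto
  moreover have "?\<nu> \<bullet> (b - a) = 0" by (rule gnormal_segment[OF e_Gam[unfolded e_eq] t])
  ultimately have \<nu>: "?\<nu> = n \<or> ?\<nu> = - n" using perp_unit_unique[OF norm_n _ n_orth _ ba] by blast
  have 1: "gtrace \<T> \<Gamma> s1 (dn ?\<nu> v) (X t) = dn ?\<nu> (w T1 s1) (X t)"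
    by (rule gtrace1[OF t tent_values(1) dn_w_continuous[OF T1]])
  have 2: "gtrace \<T> \<Gamma> (opp s1) (dn ?\<nu> v) (X t) = dn ?\<nu> (w T2 (opp s1)) (X t)"
    by (rule gtrace2[OF t tent_values(3) dn_w_continuous[OF T2]])
  have "(gjump_n \<T> \<Gamma> v (X t))\<^sup>2 = (gtrace \<T> \<Gamma> s1 (dn ?\<nu> v) (X t) - gtrace \<T> \<Gamma> (opp s1) (dn ?\<nu> v) (X t))\<^sup>2"
    unfolding gjump_n_def gjump_def by (cases s1) (simp_all add: power2_commute)
  also have "\<dots> = (dn ?\<nu> (w T1 s1) (X t) - dn ?\<nu> (w T2 (opp s1)) (X t))\<^sup>2" unfolding 1 2 ..
  also have "\<dots> = P (X t)"
    using \<nu>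
  proof
    assume "?\<nu> = - n"
    then show ?thesis by (simp add: P_def dn_uminus power2_commute)
  qed (simp add: P_def)
  finally show ?thesis .
qed

lemma edge_values:
  assumes t: "0 < t" "t < 1"
  shows "(ejump_n \<T> \<Gamma> e v (X t)) = dn n (w T1 s1) (X t) - dn n (w T2 (opp s1)) (X t)"
    "eavg_bnn \<T> \<Gamma> \<beta> e v (X t) = (\<beta> s1 * Q T1 s1 t + \<beta> (opp s1) * Q T2 (opp s1) t) / 2"
proof -
  have 1: "etrace \<Gamma> T1 (dn n v) (X t) = dn n (w T1 s1) (X t)"
    by (rule etrace1[OF t tent_values(1) dn_w_continuous[OF T1]])
  have 2: "etrace \<Gamma> T2 (dn n v) (X t) = dn n (w T2 (opp s1)) (X t)"
    by (rule etrace2[OF t tent_values(3) dn_w_continuous[OF T2]])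
  have 3: "etrace \<Gamma> T1 (\<lambda>y. coef \<Gamma> \<beta> y * dnn n v y) (X t) = \<beta> s1 * dnn n (w T1 s1) (X t)"
    by (rule etrace1[OF t tent_values(2)]) (assumption | intro continuous_intros dnn_w_continuous T1)+
  have 4: "etrace \<Gamma> T2 (\<lambda>y. coef \<Gamma> \<beta> y * dnn n v y) (X t) = \<beta> (opp s1) * dnn n (w T2 (opp s1)) (X t)"
    by (rule etrace2[OF t tent_values(4)]) (assumption | intro continuous_intros dnn_w_continuous T2)+
  show "(ejump_n \<T> \<Gamma> e v (X t)) = dn n (w T1 s1) (X t) - dn n (w T2 (opp s1)) (X t)"
    by (simp add: ejump_n_def ejump_def el 1 2)
  show "eavg_bnn \<T> \<Gamma> \<beta> e v (X t) = (\<beta> s1 * Q T1 s1 t + \<beta> (opp s1) * Q T2 (opp s1) t) / 2"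
    by (simp add: eavg_bnn_def eavg_def el 3 4 Q_def)
qed

lemma on_curve_trace:
  assumes T: "T \<in> \<T>" and m': "(b - a) \<bullet> m' = 0" "norm m' = l" and sub: "tent a b m' d \<subseteq> interior T" "tent a b m' d \<subseteq> side_dom \<Gamma> s"
    and t: "0 < t" "t < 1"
  shows "(Q T s t)\<^sup>2 \<le> 57600 / (pi * d\<^sup>2 * l\<^sup>2) * (energy / \<beta> s)"
  unfolding Q_def
proof (rule tent_trace[OF dnn_w_affine[OF T] m' ab d])
  show "(LINT x:cball c \<rho>|lebesgue. (dnn n (w T s) x)\<^sup>2) \<le> energy / \<beta> s" if "cball c \<rho> \<subseteq> tent a b m' d" for c \<rho>
    by (rule energy_local[OF T _ norm_n]) (use that sub in blast)
qed (use t in auto)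

text \<open>Both traces are controlled over the full edge, so the jump of second derivatives enters
  as 0. The coefficient differs between the two sides and is part of the average;
  \<open>cross_term_bound\<close> is therefore used with coefficient 1.\<close>

lemma on_curve_cross_bound:
  assumes \<delta>: "0 < \<delta>"
  shows "2 * cross \<le> \<delta> * (beta_avg \<beta> * Ktr * energy) + 1 / \<delta> * (1 / l * (LINT t:{0<..<1}|lebesgue. P (X t) * l))"
proof -
  let ?A = "\<lambda>t. (\<beta> s1 * Q T1 s1 t + \<beta> (opp s1) * Q T2 (opp s1) t) / 2"
  let ?j = "\<lambda>t. dn n (w T1 s1) (X t) - dn n (w T2 (opp s1)) (X t)"
  define K where "K = 57600 / (pi * d\<^sup>2 * l\<^sup>2)"
  have K0: "0 \<le> K" by (simp add: K_def)
  have bs: "\<beta> s1 + \<beta> (opp s1) = 2 * beta_avg \<beta>" unfolding beta_avg_def by (cases s1) auto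
  have c: "cross = (LINT t:{0<..<1}|lebesgue. 1 * ?A t * ?j t * l)"
  proof -
    have "cross = (LINT t:{0..1}|lebesgue. indicat_real {0<..<1} t * (1 * ?A t * ?j t * l))"
      unfolding cross_def eint_frame
    proof (rule set_lint_spike[of "{0, 1}"])
      fix t assume "t \<in> {0..1} - {0, 1::real}"
      then have t: "0 < t" "t < 1" by auto
      then show "indicat_real UNIV (X t) * (eavg_bnn \<T> \<Gamma> \<beta> e v (X t) * ejump_n \<T> \<Gamma> e v (X t)) * l =
          indicat_real {0<..<1} t * (1 * ?A t * ?j t * l)"
        unfolding edge_values[OF t] by simp
    qed simp
    also have "\<dots> = (LINT t:{0<..<1}|lebesgue. 1 * ?A t * ?j t * l)"
      unfolding set_lebesgue_integral_def
      by (intro Bochner_Integration.integral_cong) (auto simp: indicator_def)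
    finally show ?thesis .
  qed
  have L: "l = (LINT t:{0<..<1::real}|lebesgue. l)" unfolding set_lebesgue_integral_def by simp
  have A: "(?A t)\<^sup>2 \<le> beta_avg \<beta> * K * energy + 0 * 0\<^sup>2" if t01: "t \<in> {0<..<1}" for t
  proof -
    have t: "0 < t" "t < 1" using t01 by auto
    define x where "x = \<beta> s1 * Q T1 s1 t"
    define y where "y = \<beta> (opp s1) * Q T2 (opp s1) t"
    \<comment> \<open>Multiplying the trace by \<beta> turns the factor \<open>1 / \<beta>\<close>
      of the energy bound into \<beta>; the two sides then add up to twice
      \<open>beta_avg \<beta>\<close>.\<close>
    have q: "(\<beta> s * z)\<^sup>2 \<le> \<beta> s * (K * energy)" if "z\<^sup>2 \<le> K * (energy / \<beta> s)" for z s
    proof -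
      have "(\<beta> s * z)\<^sup>2 = (\<beta> s)\<^sup>2 * z\<^sup>2" by (simp add: power_mult_distrib)
      also have "\<dots> \<le> (\<beta> s)\<^sup>2 * (K * (energy / \<beta> s))" by (rule mult_left_mono[OF that]) simp
      also have "\<dots> = \<beta> s * (K * energy)" using \<beta>_pos[of s] by (simp add: power2_eq_square)
      finally show ?thesis .
    qed
    have x: "x\<^sup>2 \<le> \<beta> s1 * (K * energy)"
      unfolding x_def K_def by (rule q[unfolded K_def]) (rule on_curve_trace[OF T1 orth nm tent1 s1(1) t])
    have y: "y\<^sup>2 \<le> \<beta> (opp s1) * (K * energy)"
      unfolding y_def K_def by (rule q[unfolded K_def]) (rule on_curve_trace[OF T2 orth' nm' tent2 s1(2) t])
    have "0 \<le> (x - y)\<^sup>2" by simp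
    then have "((x + y) / 2)\<^sup>2 \<le> (x\<^sup>2 + y\<^sup>2) / 2" by (simp add: power2_eq_square field_simps)
    also have "\<dots> \<le> (\<beta> s1 * (K * energy) + \<beta> (opp s1) * (K * energy)) / 2" using x y by simp
    also have "\<dots> = (\<beta> s1 + \<beta> (opp s1)) * (K * energy) / 2" by (simp only: distrib_right)
    also have "\<dots> = beta_avg \<beta> * K * energy" unfolding bs by simp
    finally show ?thesis by (simp add: x_def y_def)
  qed
  have Ac: "continuous_on UNIV ?A" and jc: "continuous_on UNIV ?j"
    by (intro continuous_intros Q_cont T1 T2 continuous_on_compose2[OF dn_w_continuous X_cont]; simp)+
  have sets: "{0<..<1::real} \<in> sets lebesgue" "{0<..<1::real} \<subseteq> {0..1}" by auto
  have "2 * cross \<le> \<delta> * (1 * l\<^sup>2 * (beta_avg \<beta> * K * energy)) + \<delta> * 0 * (l * 1 * (LINT t:{0<..<1::real}|lebesgue. 0\<^sup>2 * l))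
      + 1 / \<delta> * (1 / l * (LINT t:{0<..<1}|lebesgue. (?j t)\<^sup>2 * l))"
    unfolding c by (rule cross_term_bound[OF Ac continuous_on_const jc sets l_pos zero_less_one \<delta> l_pos L A])
  moreover have "\<delta> * (1 * l\<^sup>2 * (beta_avg \<beta> * K * energy)) \<le> \<delta> * (beta_avg \<beta> * Ktr * energy)"
  proof -
    have b0: "0 \<le> beta_avg \<beta>" unfolding beta_avg_def using \<beta>_pos[of Plus] \<beta>_pos[of Minus] by simp
    have "l\<^sup>2 * K = 57600 / (pi * d\<^sup>2)" using ab by (simp add: K_def)
    also have "\<dots> \<le> Ktr" unfolding Ktr_def using d by (intro divide_right_mono) auto
    finally have "(l\<^sup>2 * K) * (beta_avg \<beta> * energy) \<le> Ktr * (beta_avg \<beta> * energy)"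
      using b0 energy_nonneg by (intro mult_right_mono) auto
    then show ?thesis using \<delta> by (simp add: mult_ac)
  qed
  ultimately show ?thesis unfolding P_def by simp
qed

end

section \<open>Integrals along the interface\<close>

lemma gnormal_rot: "gnormal \<Gamma> x = rot (gtangent \<Gamma> x)"
  by (simp add: gnormal_def rot_def)

lemma dn_rot: "dn (rot u) f x = u$1 * pd 2 f x - u$2 * pd 1 f x"
  by (simp add: dn_def sum_2 rot_def)

context regular_curve
begin

lemma curve_vimage_lebesgue:
  assumes "B \<in> sets borel" shows "{0..<1} \<inter> g -` B \<in> sets lebesgue"
proof -
  have "g \<in> borel_measurable borel"
    by (rule borel_measurable_continuous_onI[OF curve_continuous])
  then have "g -` B \<in> sets borel" using assms by (rule measurable_sets_borel)
  then have "{0..<1} \<inter> g -` B \<in> sets lborel" by simp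
  then show ?thesis by (rule sets_completionI_sets)
qed

lemma finite_curve_vimage:
  assumes "finite V" shows "finite ({0..<1} \<inter> g -` V)"
proof (rule finite_imageD)
  show "finite (g ` ({0..<1} \<inter> g -` V))" by (rule finite_subset[OF _ assms]) auto
  show "inj_on g ({0..<1} \<inter> g -` V)" by (rule inj_on_subset[OF curve_inj]) auto
qed

end

context ife_edge_on_curve
begin

text \<open>Change of variables from the curve parameter to the edge parameter: \<open>u\<close> is
  injective because the curve is simple, onto because the edge is contained in the curve, and
  \<open>\<bar>u' \<tau>\<bar> * l\<close> is the speed because the tangent is parallel to the
  edge.\<close>

lemma curve_lint_edge:
  defines "S \<equiv> {0..<1} \<inter> curve \<Gamma> -` open_segment a b"
  shows "(LINT t:{0<..<1}|lebesgue. P (X t) * l) = (LINT \<tau>:S|lebesgue. P (curve \<Gamma> \<tau>) * norm (vector_derivative (curve \<Gamma>) (at \<tau>)))"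
    and "S \<in> sets lebesgue"
proof -
  have os: "open_segment a b \<in> sets borel"
    unfolding open_segment_def by (intro sets.Diff) (auto intro: borel_closed)
  show S: "S \<in> sets lebesgue" unfolding S_def by (rule curve_vimage_lebesgue[OF os])
  define u where "u = (\<lambda>\<tau>. ((g \<tau> - a) \<bullet> (b - a)) / l\<^sup>2)"
  define u' where "u' = (\<lambda>\<tau>. (g' \<tau> \<bullet> (b - a)) / l\<^sup>2)"
  have ll: "(b - a) \<bullet> (b - a) = l\<^sup>2" by (simp add: power2_norm_eq_inner)
  have u_X: "u \<tau> = s" if "g \<tau> = X s" for \<tau> s
    unfolding u_def that using l_pos ll by simp
  have param: "\<exists>s. 0 < s \<and> s < 1 \<and> g \<tau> = X s" if "\<tau> \<in> S" for \<tau>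
  proof -
    have "g \<tau> \<in> open_segment a b" using that by (simp add: S_def)
    then obtain s where "0 < s" "s < 1" "g \<tau> = (1 - s) *\<^sub>R a + s *\<^sub>R b" unfolding in_segment by blast
    then show ?thesis by (intro exI[of _ s]) (simp add: algebra_simps)
  qed
  have gX: "g \<tau> = X (u \<tau>)" "0 < u \<tau>" "u \<tau> < 1" if "\<tau> \<in> S" for \<tau>
    using param[OF that] u_X by auto
  have img: "u ` S = {0<..<1}"
  proof (intro equalityI subsetI)
    fix s assume "s \<in> u ` S"
    then show "s \<in> {0<..<1}" using gX by auto
  next
    fix s :: real assume s: "s \<in> {0<..<1}"
    then have "X s \<in> Gam \<Gamma>" by (intro X_Gam) auto
    then obtain \<tau> where \<tau>: "\<tau> \<in> {0..<1}" "g \<tau> = X s" unfolding Gam_unit by force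
    have "X s \<in> open_segment a b"
      unfolding in_segment using s ab by (auto intro!: exI[of _ s] simp: algebra_simps)
    then have "\<tau> \<in> S" using \<tau> by (simp add: S_def)
    moreover have "u \<tau> = s" by (rule u_X[OF \<tau>(2)])
    ultimately show "s \<in> u ` S" by force
  qed
  have inj: "inj_on u S"
  proof (rule inj_onI)
    fix x y assume xy: "x \<in> S" "y \<in> S" "u x = u y"
    then have "g x = g y" using gX(1) by metis
    then show "x = y" using xy(1,2) by (intro inj_onD[OF curve_inj]) (auto simp: S_def)
  qed
  have der: "(u has_field_derivative u' \<tau>) (at \<tau> within S)" for \<tau>
  proof -
    have "((\<lambda>\<tau>. (g \<tau> - a) \<bullet> (b - a)) has_derivative (\<lambda>h. (h *\<^sub>R g' \<tau>) \<bullet> (b - a))) (at \<tau> within S)"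
      using has_vector_derivative_at_within[OF curve_deriv[of \<tau>], of S]
      unfolding has_vector_derivative_def
      by (auto intro!: derivative_eq_intros)
    then have "((\<lambda>\<tau>. (g \<tau> - a) \<bullet> (b - a)) has_field_derivative g' \<tau> \<bullet> (b - a)) (at \<tau> within S)"
      unfolding has_field_derivative_def by (rule has_derivative_eq_rhs) (auto simp: fun_eq_iff)
    then show ?thesis unfolding u_def u'_def by (rule DERIV_cdivide)
  qed
  have speed: "norm (g' \<tau>) = \<bar>u' \<tau>\<bar> * l" if "\<tau> \<in> S" for \<tau>
  proof -
    have \<tau>: "\<tau> \<in> {0..<1}" using that by (simp add: S_def)
    have "gnormal \<Gamma> (g \<tau>) \<bullet> (b - a) = 0"
      unfolding gX(1)[OF that] by (rule gnormal_segment[OF e_Gam[unfolded e_eq] gX(2,3)[OF that]])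
    then have "crs (gtangent \<Gamma> (g \<tau>)) (b - a) = 0" by (simp add: gnormal_rot crs_eq_inner_rot)
    moreover have "crs (g' \<tau> /\<^sub>R norm (g' \<tau>)) (b - a) = crs (g' \<tau>) (b - a) / norm (g' \<tau>)"
      by (simp add: crs_def divide_inverse algebra_simps)
    ultimately have "crs (g' \<tau>) (b - a) = 0"
      unfolding gtangent_curve[OF \<tau>] using curve_deriv_nz[of \<tau>] by simp
    then have c: "crs (b - a) (g' \<tau>) = 0" by (simp add: crs_def algebra_simps)
    have "b - a \<noteq> 0" using ab by simp
    then obtain k where k: "g' \<tau> = k *\<^sub>R (b - a)" using crs_zero_parallel[OF c] by blast
    have "u' \<tau> = k" unfolding u'_def k using ll l_pos by simp
    then show ?thesis unfolding k by simp
  qed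
  define f where "f = (\<lambda>s. P (X s) * l)"
  have fi: "f absolutely_integrable_on {0<..<1}"
    unfolding f_def
  proof (rule set_integrable_continuous_sub[of "{0..1}"])
    show "continuous_on {0..1} (\<lambda>s. P (X s) * l)"
      by (intro continuous_intros continuous_on_compose2[OF P_cont[of UNIV] X_cont]) auto
  qed auto
  have cov: "(\<lambda>x. \<bar>u' x\<bar> * f (u x)) absolutely_integrable_on S \<and>
      integral S (\<lambda>x. \<bar>u' x\<bar> * f (u x)) = integral {0<..<1} f"
    unfolding has_absolute_integral_change_of_variables_1'[OF S der inj, of f] img using fi by simp
  have "(LINT \<tau>:S|lebesgue. P (g \<tau>) * norm (g' \<tau>)) = (LINT \<tau>:S|lebesgue. \<bar>u' \<tau>\<bar> * f (u \<tau>))"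
    by (rule set_lebesgue_integral_cong[OF S]) (simp add: speed gX(1)[symmetric] f_def)
  also have "\<dots> = integral S (\<lambda>x. \<bar>u' x\<bar> * f (u x))"
    by (rule set_lebesgue_integral_eq_integral(2)) (use cov in simp)
  also have "\<dots> = (LINT s:{0<..<1}|lebesgue. f s)"
    using cov set_lebesgue_integral_eq_integral(2)[OF fi] by simp
  finally show "(LINT t:{0<..<1}|lebesgue. P (X t) * l) = (LINT \<tau>:S|lebesgue. P (g \<tau>) * norm (g' \<tau>))"
    by (simp add: f_def)
qed

lemma gint_lower:
  assumes int: "set_integrable lebesgue {0..1} (\<lambda>\<tau>. indicat_real T1 (curve \<Gamma> \<tau>) * (gjump_n \<T> \<Gamma> v (curve \<Gamma> \<tau>))\<^sup>2 *
      norm (vector_derivative (curve \<Gamma>) (at \<tau>)))" (is "set_integrable _ _ ?F")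
  shows "(LINT t:{0<..<1}|lebesgue. P (X t) * l) \<le> gint \<Gamma> T1 (\<lambda>x. (gjump_n \<T> \<Gamma> v x)\<^sup>2)"
proof -
  let ?S = "{0..<1} \<inter> curve \<Gamma> -` open_segment a b"
  have S: "?S \<in> sets lebesgue" by (rule curve_lint_edge(2))
  have FS: "?F \<tau> = P (g \<tau>) * norm (g' \<tau>)" if "\<tau> \<in> ?S" for \<tau>
  proof -
    have "g \<tau> \<in> open_segment a b" using that by simp
    then obtain s where s: "0 < s" "s < 1" "g \<tau> = (1 - s) *\<^sub>R a + s *\<^sub>R b" unfolding in_segment by blast
    have "g \<tau> = X s" unfolding s(3) by (simp add: algebra_simps)
    moreover have "X s \<in> T1" using X_e[of s] s e_T by auto
    ultimately show ?thesis using gjump_n_P[OF s(1,2)] by simp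
  qed
  have "(LINT t:{0<..<1}|lebesgue. P (X t) * l) = (LINT \<tau>:?S|lebesgue. P (g \<tau>) * norm (g' \<tau>))"
    by (rule curve_lint_edge(1))
  also have "\<dots> = (LINT \<tau>:?S|lebesgue. ?F \<tau>)"
    by (rule set_lebesgue_integral_cong[OF S]) (intro allI impI, rule FS[symmetric])
  also have "\<dots> \<le> (LINT \<tau>:{0..1}|lebesgue. ?F \<tau>)"
    unfolding set_lebesgue_integral_def
  proof (rule integral_mono)
    show "integrable lebesgue (\<lambda>\<tau>. indicat_real ?S \<tau> *\<^sub>R ?F \<tau>)"
      using set_integrable_subset[OF int S] unfolding set_integrable_def by force
    show "integrable lebesgue (\<lambda>\<tau>. indicat_real {0..1} \<tau> *\<^sub>R ?F \<tau>)" using int unfolding set_integrable_def .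
    fix \<tau>
    have "0 \<le> ?F \<tau>" by simp
    then show "indicat_real ?S \<tau> *\<^sub>R ?F \<tau> \<le> indicat_real {0..1} \<tau> *\<^sub>R ?F \<tau>"
      by (auto simp: indicator_def)
  qed
  finally show ?thesis unfolding gint_def .
qed

end

context ife
begin

text \<open>An edge on the curve is an interior edge, since the curve lies in the open set \<Omega>,
  and so it has a frame.\<close>

lemma curve_edge_trace:
  assumes d: "0 < d" "d \<le> 1/4" and frames: "\<And>e. e \<in> int_edges \<Omega> \<T> \<Longrightarrow> \<exists>a b m T1 T2. edge_frame d e a b m T1 T2"
    and e: "e \<in> edges \<T>" "e \<subseteq> Gam \<Gamma>"
  shows "\<exists>a b P. e = closed_segment a b \<and> continuous_on UNIV P \<and>
      (\<forall>x\<in>open_segment a b. (gjump_n \<T> \<Gamma> v x)\<^sup>2 = P x)"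
proof -
  have "e \<noteq> {}" using e(1) by (auto simp: edges_def facet_of_def)
  moreover have "e \<inter> frontier \<Omega> = {}"
    using e(2) Gam_sub open_dom by (auto simp: frontier_def interior_open)
  ultimately have ei: "e \<in> int_edges \<Omega> \<T>" using e(1) by (auto simp: int_edges_def)
  obtain a b m T1 T2 where fr: "edge_frame d e a b m T1 T2" using frames[OF ei] by blast
  interpret E: ife_edge_on_curve \<Omega> \<T> \<Gamma> r \<beta> p v w d e a b m T1 T2
    by unfold_locales (use d fr ei e in auto)
  have "(gjump_n \<T> \<Gamma> v x)\<^sup>2 = E.P x" if x: "x \<in> open_segment a b" for x
  proof -
    have "\<exists>s. 0 < s \<and> s < 1 \<and> x = (1 - s) *\<^sub>R a + s *\<^sub>R b" using x unfolding in_segment by blast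
    then obtain s where s: "0 < s" "s < 1" "x = (1 - s) *\<^sub>R a + s *\<^sub>R b" by blast
    have "x = a + s *\<^sub>R (b - a)" unfolding s(3) by (simp add: algebra_simps)
    then show ?thesis using E.gjump_n_P[OF s(1,2)] by simp
  qed
  then show ?thesis using E.P_cont[of UNIV] E.e_eq by blast
qed

text \<open>Both subdomains accumulate at a curve point inside an open element, and the skeleton
  stays away from it.\<close>

lemma gtrace_interior:
  assumes T: "T \<in> \<T>" and x: "x \<in> interior T" "x \<in> Gam \<Gamma>"
  shows "gtrace \<T> \<Gamma> s (dn k v) x = dn k (w T s) x"
  unfolding gtrace_def
proof (rule Lim_within_open_eq[OF _ open_interior x(1) _ dn_w_continuous[OF T]])
  have "x \<in> interior T \<inter> closure (side_dom \<Gamma> s)" using x Gam_closure_side by blast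
  also have "\<dots> \<subseteq> closure (interior T \<inter> side_dom \<Gamma> s)" by (rule open_Int_closure_subset) simp
  also have "\<dots> \<subseteq> closure (side_dom \<Gamma> s - skeleton \<T>)"
    by (rule closure_mono) (use interior_skeleton[OF T] in blast)
  finally show "x islimpt side_dom \<Gamma> s - skeleton \<T>"
    using open_side closed_skeleton by (intro open_islimpt_closure open_Diff)
  show "dn k v y = dn k (w T s) y" if "y \<in> interior T" "y \<in> side_dom \<Gamma> s - skeleton \<T>" for y
    using piece_derivs(1)[OF T] that by blast
qed

lemma frontier_facets:
  assumes T: "T \<in> \<T>" shows "frontier T = \<Union>{e. e facet_of T}"
proof -
  have "rel_frontier T = frontier T"
    by (rule rel_frontier_nonempty_interior[OF interior_mesh_nonempty[OF T]])
  moreover have "rel_frontier T = \<Union>{e. e facet_of T}"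
    by (rule rel_frontier_of_polyhedron[OF polytope_imp_polyhedron[OF polytope_mesh[OF T]]])
  ultimately show ?thesis by simp
qed

text \<open>A non-integrable function has integral \<open>0\<close>, so the lower bound on the penalty along the curve needs
  integrability. The jump is continuous along the curve inside the element and along each of its edges
  contained in the curve; finitely many parameters remain.\<close>

lemma gint_integrable:
  assumes d: "0 < d" "d \<le> 1/4" and frames: "\<And>e. e \<in> int_edges \<Omega> \<T> \<Longrightarrow> \<exists>a b m T1 T2. edge_frame d e a b m T1 T2"
    and T: "T \<in> \<T>"
  shows "set_integrable lebesgue {0..1} (\<lambda>\<tau>. indicat_real T (curve \<Gamma> \<tau>) * (gjump_n \<T> \<Gamma> v (curve \<Gamma> \<tau>))\<^sup>2 *
      norm (vector_derivative (curve \<Gamma>) (at \<tau>)))" (is "set_integrable _ _ ?F")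
proof -
  define I where "I = {e. e facet_of T \<and> e \<subseteq> Gam \<Gamma>}"
  have Ifin: "finite I" unfolding I_def by (rule finite_subset[OF _ finite_polytope_facets[OF polytope_mesh[OF T]]]) auto
  have "\<exists>a b P. e = closed_segment a b \<and> continuous_on UNIV P \<and>
      (\<forall>x\<in>open_segment a b. (gjump_n \<T> \<Gamma> v x)\<^sup>2 = P x)" if e: "e \<in> I" for e
    by (rule curve_edge_trace[OF d frames]) (use e T in \<open>auto simp: I_def edges_def\<close>)
  then obtain aa bb PP where abP: "\<And>e. e \<in> I \<Longrightarrow> e = closed_segment (aa e) (bb e)"
    "\<And>e. e \<in> I \<Longrightarrow> continuous_on UNIV (PP e)"
    "\<And>e x. e \<in> I \<Longrightarrow> x \<in> open_segment (aa e) (bb e) \<Longrightarrow> (gjump_n \<T> \<Gamma> v x)\<^sup>2 = PP e x" by metis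
  have os: "open_segment x y \<in> sets borel" for x y :: "real^2"
    unfolding open_segment_def by (intro sets.Diff) (auto intro: borel_closed)
  define A0 where "A0 = {0..<1} \<inter> g -` interior T"
  define Z where "Z = {0..<1} \<inter> g -` (- T)"
  define A where "A = (\<lambda>e. {0..<1} \<inter> g -` open_segment (aa e) (bb e))"
  have A0m: "A0 \<in> sets lebesgue" unfolding A0_def by (rule curve_vimage_lebesgue) simp
  have Zm: "Z \<in> sets lebesgue"
    unfolding Z_def using closed_mesh[OF T] by (intro curve_vimage_lebesgue) (auto intro: borel_closed)
  have Am: "A e \<in> sets lebesgue" for e unfolding A_def by (rule curve_vimage_lebesgue[OF os])
  have sc: "continuous_on K (\<lambda>\<tau>. norm (g' \<tau>))" for K by (intro continuous_intros curve_deriv_continuous)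
  define tg where "tg = (\<lambda>\<tau>. g' \<tau> /\<^sub>R norm (g' \<tau>))"
  have tc: "continuous_on K tg" for K
    unfolding tg_def using curve_deriv_nz by (intro continuous_intros curve_deriv_continuous) auto
  have i0: "set_integrable lebesgue A0 ?F"
  proof -
    \<comment> \<open>The normal derivative of \<open>w T s\<close> along the curve, expressed by
      the unit tangent, which depends continuously on the parameter.\<close>
    define \<Phi> where "\<Phi> = (\<lambda>s \<tau>. tg \<tau> $ 1 * pd 2 (w T s) (g \<tau>) - tg \<tau> $ 2 * pd 1 (w T s) (g \<tau>))"
    have "continuous_on K (\<Phi> s)" for K s
      unfolding \<Phi>_def
      by (intro continuous_intros tc continuous_on_compose2[OF poly2_continuous[OF poly2_pd[OF w_poly[OF T]]] curve_continuous]) auto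
    then have "continuous_on {0..1} (\<lambda>\<tau>. (\<Phi> Plus \<tau> - \<Phi> Minus \<tau>)\<^sup>2 * norm (g' \<tau>))"
      by (intro continuous_intros sc)
    then have i: "set_integrable lebesgue A0 (\<lambda>\<tau>. (\<Phi> Plus \<tau> - \<Phi> Minus \<tau>)\<^sup>2 * norm (g' \<tau>))"
      by (rule set_integrable_continuous_sub[OF compact_Icc]) (use A0m in \<open>auto simp: A0_def\<close>)
    have eq: "?F \<tau> = (\<Phi> Plus \<tau> - \<Phi> Minus \<tau>)\<^sup>2 * norm (g' \<tau>)" if "\<tau> \<in> A0" for \<tau>
    proof -
      have \<tau>: "\<tau> \<in> {0..<1}" "g \<tau> \<in> interior T" using that by (auto simp: A0_def)
      have gG: "g \<tau> \<in> Gam \<Gamma>" by (simp add: Gam_def)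
      have nr: "gnormal \<Gamma> (g \<tau>) = rot (tg \<tau>)"
        unfolding gnormal_rot gtangent_curve[OF \<tau>(1)] tg_def ..
      have "gjump_n \<T> \<Gamma> v (g \<tau>) = \<Phi> Plus \<tau> - \<Phi> Minus \<tau>"
        unfolding gjump_n_def gjump_def gtrace_interior[OF T \<tau>(2) gG] nr dn_rot \<Phi>_def ..
      moreover have "g \<tau> \<in> T" using \<tau>(2) interior_subset by blast
      ultimately show ?thesis by simp
    qed
    show ?thesis by (rule iffD2[OF set_integrable_cong[OF refl refl eq] i])
  qed
  have iZ: "set_integrable lebesgue Z ?F"
  proof -
    have "(\<lambda>\<tau>. indicat_real Z \<tau> *\<^sub>R ?F \<tau>) = (\<lambda>\<tau>. 0)"
    proof
      fix \<tau>
      show "indicat_real Z \<tau> *\<^sub>R ?F \<tau> = 0"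
      proof (cases "\<tau> \<in> Z")
        case True
        then have "g \<tau> \<notin> T" by (simp add: Z_def)
        then show ?thesis by simp
      qed simp
    qed
    then show ?thesis unfolding set_integrable_def by (simp only: integrable_zero)
  qed
  have iA: "set_integrable lebesgue (A e) ?F" if e: "e \<in> I" for e
  proof -
    have "continuous_on {0..1} (\<lambda>\<tau>. PP e (g \<tau>) * norm (g' \<tau>))"
      by (intro continuous_intros sc continuous_on_compose2[OF abP(2)[OF e] curve_continuous]) auto
    then have i: "set_integrable lebesgue (A e) (\<lambda>\<tau>. PP e (g \<tau>) * norm (g' \<tau>))"
      by (rule set_integrable_continuous_sub[OF compact_Icc]) (use Am in \<open>auto simp: A_def\<close>)
    have eq: "?F \<tau> = PP e (g \<tau>) * norm (g' \<tau>)" if "\<tau> \<in> A e" for \<tau>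
    proof -
      have x: "g \<tau> \<in> open_segment (aa e) (bb e)" using that by (simp add: A_def)
      then have "g \<tau> \<in> e" using abP(1)[OF e] open_closed_segment by blast
      then have "g \<tau> \<in> T" using e facet_of_imp_subset by (auto simp: I_def)
      then show ?thesis using abP(3)[OF e x] by simp
    qed
    show ?thesis by (rule iffD2[OF set_integrable_cong[OF refl refl eq] i])
  qed
  define U where "U = A0 \<union> Z \<union> (\<Union>e\<in>I. A e)"
  have iU: "set_integrable lebesgue U ?F"
    unfolding U_def using Ifin i0 iZ iA A0m Zm Am
    by (intro set_integrable_Un set_integrable_UN sets.Un sets.finite_UN) auto
  have Um: "U \<in> sets lebesgue" unfolding U_def using Ifin A0m Zm Am by (intro sets.Un sets.finite_UN) auto
  \<comment> \<open>A facet not contained in the curve meets it in at most one point; of a contained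
    facet only the end points are exceptional.\<close>
  have "\<exists>V. finite V \<and> e \<inter> Gam \<Gamma> \<subseteq> V \<union> (if e \<in> I then open_segment (aa e) (bb e) else {})" if e: "e facet_of T" for e
  proof (cases "e \<in> I")
    case True
    then show ?thesis using abP(1)[OF True] closed_segment_eq_open by (intro exI[of _ "{aa e, bb e}"]) auto
  next
    case False
    then have "\<not> e \<subseteq> Gam \<Gamma>" "e \<in> edges \<T>" using e T by (auto simp: I_def edges_def)
    then obtain x where "Gam \<Gamma> \<inter> e \<subseteq> {x}" using edge_cut by blast
    then show ?thesis using False by (intro exI[of _ "{x}"]) auto
  qed
  then obtain V where V: "\<And>e. e facet_of T \<Longrightarrow> finite (V e)"
    "\<And>e. e facet_of T \<Longrightarrow> e \<inter> Gam \<Gamma> \<subseteq> V e \<union> (if e \<in> I then open_segment (aa e) (bb e) else {})" by metis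
  define VV where "VV = (\<Union>e\<in>{e. e facet_of T}. V e)"
  have VVfin: "finite VV" unfolding VV_def using V(1) finite_polytope_facets[OF polytope_mesh[OF T]] by blast
  \<comment> \<open>The exceptional parameters; 1 is added because the pieces are taken in the
    half-open period.\<close>
  define R where "R = insert 1 ({0..<1} \<inter> g -` VV)"
  have Rfin: "finite R" unfolding R_def using finite_curve_vimage[OF VVfin] by simp
  have cover: "{0..1} = U \<union> R"
  proof (intro equalityI subsetI)
    fix \<tau> :: real assume \<tau>: "\<tau> \<in> {0..1}"
    show "\<tau> \<in> U \<union> R"
    proof (rule ccontr)
      assume n: "\<tau> \<notin> U \<union> R"
      then have t1: "\<tau> \<in> {0..<1}" using \<tau> by (force simp: R_def)
      have "g \<tau> \<in> T" "g \<tau> \<notin> interior T" using n t1 by (auto simp: U_def A0_def Z_def)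
      then have "g \<tau> \<in> frontier T" using closed_mesh[OF T] by (simp add: frontier_def)
      then obtain e where e: "e facet_of T" "g \<tau> \<in> e" using frontier_facets[OF T] by auto
      have "g \<tau> \<in> e \<inter> Gam \<Gamma>" using e(2) by (simp add: Gam_def)
      then have "g \<tau> \<in> V e \<union> (if e \<in> I then open_segment (aa e) (bb e) else {})" using V(2)[OF e(1)] by blast
      moreover have "g \<tau> \<notin> V e" using n t1 e(1) by (auto simp: R_def VV_def)
      ultimately have "e \<in> I" "g \<tau> \<in> open_segment (aa e) (bb e)" by (auto split: if_splits)
      then have "\<tau> \<in> U" using t1 by (auto simp: U_def A_def)
      then show False using n by blast
    qed
  qed (auto simp: U_def R_def A0_def Z_def A_def)
  have iR: "set_integrable lebesgue R ?F"
    by (rule absolutely_integrable_spike[where f = "\<lambda>_. 0" and S = R])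
      (use Rfin negligible_finite in \<open>auto simp: set_integrable_def\<close>)
  have Rm: "R \<in> sets lebesgue" using negligible_finite[OF Rfin] by (rule negligible_imp_sets)
  show ?thesis unfolding cover by (rule set_integrable_Un[OF iU iR Um Rm])
qed

end

section \<open>Coercivity\<close>

lemma eint_nonneg: "(\<And>x. 0 \<le> f x) \<Longrightarrow> 0 \<le> eint e S f"
  unfolding eint_def Let_def set_lebesgue_integral_def
  by (auto split: prod.split intro!: integral_nonneg_AE)

lemma gint_nonneg: "(\<And>x. 0 \<le> f x) \<Longrightarrow> 0 \<le> gint \<Gamma> S f"
  unfolding gint_def set_lebesgue_integral_def
  by (intro integral_nonneg_AE) auto

lemma elen_nonneg: "0 \<le> elen e S"
  unfolding elen_def by (rule eint_nonneg) simp

context ife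
begin

lemma coef_nonneg: "0 \<le> coef \<Gamma> \<beta> x"
  using \<beta>_pos less_imp_le by (auto simp: coef_def)

lemma beta_avg_pos: "0 < beta_avg \<beta>"
  unfolding beta_avg_def using \<beta>_pos[of Plus] \<beta>_pos[of Minus] by simp

definition edge_cross :: "(real^2) set \<Rightarrow> real" where
  "edge_cross e = eint e UNIV (\<lambda>x. eavg_bnn \<T> \<Gamma> \<beta> e v x * ejump_n \<T> \<Gamma> e v x)"

context
  fixes d R \<sigma>u \<sigma>F \<sigma>n :: real
  assumes d: "0 < d" "d \<le> 1/4" and frames: "\<And>e. e \<in> int_edges \<Omega> \<T> \<Longrightarrow> \<exists>a b m T1 T2. edge_frame d e a b m T1 T2"
    and R: "\<And>e. e \<in> int_edges \<Omega> \<T> \<Longrightarrow> mesh_size \<T> \<le> R * diameter e"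
    and \<sigma>: "0 < \<sigma>u" "0 < \<sigma>F" "0 < \<sigma>n"
begin

definition "pen_n_uncut = (\<Sum>e\<in>int_edges \<Omega> \<T> - iface_edges \<T> \<Gamma>.
  \<sigma>u / diameter e * eint e UNIV (\<lambda>x. coef \<Gamma> \<beta> x * (ejump_n \<T> \<Gamma> e v x)\<^sup>2))"

definition "pen_n_curve = (\<Sum>T\<in>iface_elems \<T> \<Gamma>.
  \<sigma>u * beta_avg \<beta> / diameter T * gint \<Gamma> T (\<lambda>x. (gjump_n \<T> \<Gamma> v x)\<^sup>2))"

definition "pen_n_cut = (\<Sum>e\<in>int_edges \<Omega> \<T> \<inter> iface_edges \<T> \<Gamma>. \<Sum>s\<in>{Plus, Minus}.
  \<sigma>u * \<beta> s / elen e (side_dom \<Gamma> s) * eint e (side_dom \<Gamma> s) (\<lambda>x. (ejump_n \<T> \<Gamma> e v x)\<^sup>2))"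

definition "pen_nn_uncut = (\<Sum>e\<in>(int_edges \<Omega> \<T> - iface_edges \<T> \<Gamma>) \<inter> edges_of_iface_elems \<T> \<Gamma>.
  \<sigma>F * diameter e * eint e UNIV (\<lambda>x. coef \<Gamma> \<beta> x * (ejump_nn \<T> \<Gamma> e v x)\<^sup>2))"

definition "pen_nn_cut = (\<Sum>e\<in>int_edges \<Omega> \<T> \<inter> iface_edges \<T> \<Gamma>. \<Sum>s\<in>{Plus, Minus}.
  \<sigma>F * elen e (side_dom \<Gamma> s) * \<beta> s * eint e (side_dom \<Gamma> s) (\<lambda>x. (ejump_nn \<T> \<Gamma> e v x)\<^sup>2))"

definition "pen_cut = (\<Sum>e\<in>int_edges \<Omega> \<T> \<inter> iface_edges \<T> \<Gamma>.
  \<sigma>n * beta_avg \<beta> / diameter e ^ 3 * eint e UNIV (\<lambda>x. (ejump \<T> \<Gamma> e v x)\<^sup>2))"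

definition "pen_curve = (\<Sum>T\<in>iface_elems \<T> \<Gamma>.
  \<sigma>n * beta_avg \<beta> / diameter T ^ 3 * gint \<Gamma> T (\<lambda>x. (gjump \<T> \<Gamma> v x)\<^sup>2))"

definition "nrm = energy + pen_n_uncut + pen_n_curve + pen_n_cut + pen_nn_uncut + pen_nn_cut + pen_cut + pen_curve"

lemma fin: "finite (int_edges \<Omega> \<T>)" "finite (iface_elems \<T> \<Gamma>)"
  using finite_int_edges finite_mesh by (simp_all add: iface_elems_def)

lemma diameter_edge_nonneg: "e \<in> int_edges \<Omega> \<T> \<Longrightarrow> 0 \<le> diameter e"
proof -
  assume "e \<in> int_edges \<Omega> \<T>"
  then obtain T where "T \<in> \<T>" "e facet_of T" by (auto simp: int_edges_def edges_def)
  then have "bounded e" using bounded_mesh facet_of_imp_subset bounded_subset by metis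
  then show ?thesis by (rule diameter_ge_0)
qed

lemma diameter_elem_nonneg: "T \<in> iface_elems \<T> \<Gamma> \<Longrightarrow> 0 \<le> diameter T"
  using bounded_mesh by (auto simp: iface_elems_def intro: diameter_ge_0)

lemma terms_nonneg:
  "e \<in> int_edges \<Omega> \<T> \<Longrightarrow> 0 \<le> \<sigma>u / diameter e * eint e UNIV (\<lambda>x. coef \<Gamma> \<beta> x * (ejump_n \<T> \<Gamma> e v x)\<^sup>2)"
  "T \<in> iface_elems \<T> \<Gamma> \<Longrightarrow> 0 \<le> \<sigma>u * beta_avg \<beta> / diameter T * gint \<Gamma> T (\<lambda>x. (gjump_n \<T> \<Gamma> v x)\<^sup>2)"
  "0 \<le> \<sigma>u * \<beta> s / elen e (side_dom \<Gamma> s) * eint e (side_dom \<Gamma> s) (\<lambda>x. (ejump_n \<T> \<Gamma> e v x)\<^sup>2)"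
  "e \<in> int_edges \<Omega> \<T> \<Longrightarrow> 0 \<le> \<sigma>F * diameter e * eint e UNIV (\<lambda>x. coef \<Gamma> \<beta> x * (ejump_nn \<T> \<Gamma> e v x)\<^sup>2)"
  "0 \<le> \<sigma>F * elen e (side_dom \<Gamma> s) * \<beta> s * eint e (side_dom \<Gamma> s) (\<lambda>x. (ejump_nn \<T> \<Gamma> e v x)\<^sup>2)"
  "e \<in> int_edges \<Omega> \<T> \<Longrightarrow> 0 \<le> \<sigma>n * beta_avg \<beta> / diameter e ^ 3 * eint e UNIV (\<lambda>x. (ejump \<T> \<Gamma> e v x)\<^sup>2)"
  "T \<in> iface_elems \<T> \<Gamma> \<Longrightarrow> 0 \<le> \<sigma>n * beta_avg \<beta> / diameter T ^ 3 * gint \<Gamma> T (\<lambda>x. (gjump \<T> \<Gamma> v x)\<^sup>2)"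
  by (intro mult_nonneg_nonneg divide_nonneg_nonneg eint_nonneg gint_nonneg elen_nonneg coef_nonneg
    diameter_edge_nonneg diameter_elem_nonneg zero_le_power2 zero_le_power less_imp_le[OF beta_avg_pos]
    less_imp_le[OF \<beta>_pos] \<sigma>[THEN less_imp_le]; assumption)+

lemma pens_nonneg: "0 \<le> pen_n_uncut" "0 \<le> pen_n_curve" "0 \<le> pen_n_cut" "0 \<le> pen_nn_uncut" "0 \<le> pen_nn_cut"
  "0 \<le> pen_cut" "0 \<le> pen_curve"
  unfolding pen_n_uncut_def pen_n_curve_def pen_n_cut_def pen_nn_uncut_def pen_nn_cut_def pen_cut_def pen_curve_def
  by (intro sum_nonneg terms_nonneg; blast)+

lemma le_nrm: "energy \<le> nrm" "pen_n_uncut \<le> nrm" "pen_n_curve \<le> nrm" "pen_n_cut \<le> nrm" "pen_nn_uncut \<le> nrm" "pen_nn_cut \<le> nrm" "0 \<le> nrm"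
  unfolding nrm_def using pens_nonneg energy_nonneg by linarith+

lemma norm_h_sq: "(norm_h \<Omega> \<T> \<Gamma> \<beta> \<sigma>u \<sigma>F \<sigma>n v)\<^sup>2 = nrm"
proof -
  have "norm_h \<Omega> \<T> \<Gamma> \<beta> \<sigma>u \<sigma>F \<sigma>n v = sqrt nrm"
    unfolding norm_h_def nrm_def energy_def pen_n_uncut_def pen_n_curve_def pen_n_cut_def pen_nn_uncut_def
      pen_nn_cut_def pen_cut_def pen_curve_def ..
  then show ?thesis using le_nrm(7) by simp
qed

text \<open>On the diagonal the two consistency sums coincide, and all other terms are those of the
  squared norm. Coercivity thus becomes an upper bound for the cross terms.\<close>

lemma a_h_eq: "a_h \<Omega> \<T> \<Gamma> \<beta> \<sigma>u \<sigma>F \<sigma>n v v = nrm - (\<Sum>e\<in>int_edges \<Omega> \<T>. 2 * edge_cross e)"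
  unfolding a_h_def A_h_def J_hu_def J_hn_def nrm_def energy_def pen_n_uncut_def pen_n_curve_def pen_n_cut_def
    pen_nn_uncut_def pen_nn_cut_def pen_cut_def pen_curve_def edge_cross_def sum_distrib_left[symmetric]
    power2_eq_square mult.assoc
  by simp

text \<open>The same number as \<open>Ktr\<close>, available without fixing an edge.\<close>

definition "Kd = 460800 / (pi * d\<^sup>2)"

lemma Kd_nonneg: "0 \<le> Kd" unfolding Kd_def by simp

text \<open>The constants majorize those of the three kinds of edges. \<open>R\<close> compares the
  diameter of an element with the length of the edge: the penalty along the curve carries the
  former, the cross term the latter.\<close>

lemma edge_estimate:
  assumes e: "e \<in> int_edges \<Omega> \<T>" and \<delta>: "0 < \<delta>"
  shows "2 * edge_cross e \<le> (\<delta> * ((2 + beta_avg \<beta>) * Kd + 1 / (2 * \<sigma>F)) + (1 + R / beta_avg \<beta>) / (\<delta> * \<sigma>u)) * nrm"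
proof -
  obtain a b m T1 T2 where fr: "edge_frame d e a b m T1 T2" using frames[OF e] by blast
  interpret E: ife_edge \<Omega> \<T> \<Gamma> r \<beta> p v w d e a b m T1 T2
    by unfold_locales (use d fr e in auto)
  have cr: "edge_cross e = E.cross" unfolding edge_cross_def E.cross_def ..
  have KE: "E.Ktr = Kd" unfolding E.Ktr_def Kd_def ..
  have e_edge: "e \<in> edges \<T>" using e by (simp add: int_edges_def)
  define b0 where "b0 = beta_avg \<beta>"
  have b0: "0 < b0" unfolding b0_def by (rule beta_avg_pos)
  have R0: "0 \<le> R"
  proof -
    have "0 \<le> mesh_size \<T>"
      using diameter_le_mesh_size[OF E.T1] diameter_ge_0[OF bounded_mesh[OF E.T1]] by linarith
    then have "0 \<le> R * diameter e" using R[OF e] by linarith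
    then show ?thesis using E.l_pos unfolding E.diameter_e by (simp add: zero_le_mult_iff)
  qed
  let ?C1 = "(2 + b0) * Kd + 1 / (2 * \<sigma>F)" and ?C2 = "(1 + R / b0) / (\<delta> * \<sigma>u)"
  have fincut: "finite (int_edges \<Omega> \<T> \<inter> iface_edges \<T> \<Gamma>)" "finite (int_edges \<Omega> \<T> - iface_edges \<T> \<Gamma>)"
    using fin by auto
  have sc: "\<delta> * x \<le> \<delta> * y" if "x \<le> y" for x y using that \<delta> by simp
  \<comment> \<open>Common form of the three cases: \<open>k1\<close> is \<open>b0\<close> on the
    curve, 2 on a cut edge (one for each side) and 1 on an uncut edge; \<open>k2\<close> is
    \<open>R / b0\<close> on the curve and 1 otherwise.\<close>
  have combine: "2 * edge_cross e \<le> (\<delta> * ?C1 + ?C2) * nrm"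
    if bnd: "2 * edge_cross e \<le> \<delta> * k1 * Kd * energy + \<delta> * (1 / (2 * \<sigma>F)) * y + k2 / (\<delta> * \<sigma>u) * z"
      and k: "0 \<le> k1" "k1 \<le> 2 + b0" "0 \<le> k2" "k2 \<le> 1 + R / b0" and yz: "y \<le> nrm" "z \<le> nrm" for k1 k2 y z
  proof -
    have "\<delta> * k1 * Kd * energy \<le> \<delta> * (2 + b0) * Kd * nrm"
      using k \<delta> Kd_nonneg le_nrm(1) energy_nonneg by (intro mult_mono) auto
    moreover have "\<delta> * (1 / (2 * \<sigma>F)) * y \<le> \<delta> * (1 / (2 * \<sigma>F)) * nrm"
      using yz \<delta> \<sigma> by (intro mult_left_mono) auto
    moreover have "k2 / (\<delta> * \<sigma>u) * z \<le> ?C2 * nrm"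
    proof -
      have "k2 / (\<delta> * \<sigma>u) * z \<le> k2 / (\<delta> * \<sigma>u) * nrm"
        using yz k \<delta> \<sigma> by (intro mult_left_mono) auto
      also have "\<dots> \<le> ?C2 * nrm"
        using k \<delta> \<sigma> le_nrm(7) by (intro mult_right_mono divide_right_mono) auto
      finally show ?thesis .
    qed
    moreover have "(\<delta> * ?C1 + ?C2) * nrm = \<delta> * (2 + b0) * Kd * nrm + \<delta> * (1 / (2 * \<sigma>F)) * nrm + ?C2 * nrm"
      by (simp add: algebra_simps)
    ultimately show ?thesis using bnd by linarith
  qed
  have Rb: "0 \<le> R / b0" using R0 b0 by simp
  have "2 * edge_cross e \<le> (\<delta> * ?C1 + ?C2) * nrm"
  proof (cases "e \<subseteq> Gam \<Gamma>")
    case True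
    interpret B: ife_edge_on_curve \<Omega> \<T> \<Gamma> r \<beta> p v w d e a b m T1 T2
      by unfold_locales (rule True)
    let ?G = "gint \<Gamma> T1 (\<lambda>x. (gjump_n \<T> \<Gamma> v x)\<^sup>2)"
    have G: "(LINT t:{0<..<1}|lebesgue. B.P (a + t *\<^sub>R (b - a)) * norm (b - a)) \<le> ?G"
      by (rule B.gint_lower[OF gint_integrable[OF d frames E.T1]])
    have T1i: "T1 \<in> iface_elems \<T> \<Gamma>"
      using E.T1 E.e_T(1) B.X_Gam[of 0] E.X_e[of 0] by (auto simp: iface_elems_def)
    have dT: "0 < diameter T1" using facet_length_le[OF E.T1 E.facet1[unfolded E.e_eq]] E.l_pos by linarith
    have dR: "diameter T1 \<le> R * norm (b - a)"
      using diameter_le_mesh_size[OF E.T1] R[OF e] unfolding E.diameter_e by linarith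
    have "\<sigma>u * b0 / diameter T1 * ?G \<le> pen_n_curve"
      unfolding pen_n_curve_def b0_def
      by (rule member_le_sum[OF T1i]) (use terms_nonneg(2) fin in auto)
    then have "?G \<le> diameter T1 * (pen_n_curve / (\<sigma>u * b0))"
      using dT \<sigma> b0 by (simp add: field_simps)
    also have "\<dots> \<le> (R * norm (b - a)) * (pen_n_curve / (\<sigma>u * b0))"
      using dR pens_nonneg(2) \<sigma> b0 by (intro mult_right_mono) auto
    finally have "1 / norm (b - a) * ?G \<le> R / b0 / \<sigma>u * pen_n_curve"
      using E.l_pos \<sigma> b0 by (simp add: field_simps)
    moreover have "1 / norm (b - a) * (LINT t:{0<..<1}|lebesgue. B.P (a + t *\<^sub>R (b - a)) * norm (b - a)) \<le> 1 / norm (b - a) * ?G"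
      using G by (intro mult_left_mono) auto
    ultimately have "1 / \<delta> * (1 / norm (b - a) * (LINT t:{0<..<1}|lebesgue. B.P (a + t *\<^sub>R (b - a)) * norm (b - a)))
        \<le> 1 / \<delta> * (R / b0 / \<sigma>u * pen_n_curve)" using \<delta> by (intro mult_left_mono) auto
    with B.on_curve_cross_bound[OF \<delta>]
    have "2 * edge_cross e \<le> \<delta> * b0 * Kd * energy + \<delta> * (1 / (2 * \<sigma>F)) * 0 + R / b0 / (\<delta> * \<sigma>u) * pen_n_curve"
      unfolding cr KE b0_def[symmetric] by (simp add: mult_ac)
    then show ?thesis by (rule combine) (use b0 Rb le_nrm in auto)
  next
    case nG: False
    show ?thesis
    proof (cases "e \<in> iface_edges \<T> \<Gamma>")
      case True
      then have ei: "e \<in> int_edges \<Omega> \<T> \<inter> iface_edges \<T> \<Gamma>" using e by blast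
      let ?F = "\<lambda>s. elen e (side_dom \<Gamma> s) * \<beta> s * eint e (side_dom \<Gamma> s) (\<lambda>x. (ejump_nn \<T> \<Gamma> e v x)\<^sup>2)"
      let ?U = "\<lambda>s. \<beta> s / elen e (side_dom \<Gamma> s) * eint e (side_dom \<Gamma> s) (\<lambda>x. (ejump_n \<T> \<Gamma> e v x)\<^sup>2)"
      have "(\<Sum>s\<in>{Plus, Minus}. \<sigma>F * elen e (side_dom \<Gamma> s) * \<beta> s * eint e (side_dom \<Gamma> s) (\<lambda>x. (ejump_nn \<T> \<Gamma> e v x)\<^sup>2)) \<le> pen_nn_cut"
        unfolding pen_nn_cut_def
        by (rule member_le_sum[OF ei _ fincut(1)]) (intro sum_nonneg terms_nonneg(5))
      then have F: "\<sigma>F * (?F Plus + ?F Minus) \<le> pen_nn_cut" by (simp add: algebra_simps)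
      have "(\<Sum>s\<in>{Plus, Minus}. \<sigma>u * \<beta> s / elen e (side_dom \<Gamma> s) * eint e (side_dom \<Gamma> s) (\<lambda>x. (ejump_n \<T> \<Gamma> e v x)\<^sup>2)) \<le> pen_n_cut"
        unfolding pen_n_cut_def
        by (rule member_le_sum[OF ei _ fincut(1)]) (intro sum_nonneg terms_nonneg(3))
      then have U: "\<sigma>u * (?U Plus + ?U Minus) \<le> pen_n_cut" by (simp add: algebra_simps)
      have F': "\<delta> / 2 * (?F Plus + ?F Minus) \<le> \<delta> * (1 / (2 * \<sigma>F)) * pen_nn_cut"
      proof -
        have "\<delta> / 2 * (?F Plus + ?F Minus) = \<delta> * (1 / (2 * \<sigma>F)) * (\<sigma>F * (?F Plus + ?F Minus))" using \<sigma> by simp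
        also have "\<dots> \<le> \<delta> * (1 / (2 * \<sigma>F)) * pen_nn_cut" using F \<delta> \<sigma> by (intro mult_left_mono) auto
        finally show ?thesis .
      qed
      have U': "1 / \<delta> * (?U Plus + ?U Minus) \<le> 1 / (\<delta> * \<sigma>u) * pen_n_cut"
      proof -
        have "1 / \<delta> * (?U Plus + ?U Minus) = 1 / (\<delta> * \<sigma>u) * (\<sigma>u * (?U Plus + ?U Minus))" using \<sigma> by simp
        also have "\<dots> \<le> 1 / (\<delta> * \<sigma>u) * pen_n_cut" using U \<delta> \<sigma> by (intro mult_left_mono) auto
        finally show ?thesis .
      qed
      have "2 * edge_cross e \<le> \<delta> * 2 * Kd * energy + \<delta> / 2 * (?F Plus + ?F Minus) + 1 / \<delta> * (?U Plus + ?U Minus)"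
        using E.cut_edge_bound[OF nG \<delta>] unfolding cr KE
        by (simp add: distrib_left mult_ac)
      then have "2 * edge_cross e \<le> \<delta> * 2 * Kd * energy + \<delta> * (1 / (2 * \<sigma>F)) * pen_nn_cut + 1 / (\<delta> * \<sigma>u) * pen_n_cut"
        using F' U' by linarith
      then show ?thesis by (rule combine) (use b0 Rb le_nrm in auto)
    next
      case False
      then have eu: "e \<in> int_edges \<Omega> \<T> - iface_edges \<T> \<Gamma>" and eG: "e \<inter> Gam \<Gamma> = {}"
        using e e_edge by (auto simp: iface_edges_def)
      let ?F = "diameter e * eint e UNIV (\<lambda>x. coef \<Gamma> \<beta> x * (ejump_nn \<T> \<Gamma> e v x)\<^sup>2)"
      let ?U = "1 / diameter e * eint e UNIV (\<lambda>x. coef \<Gamma> \<beta> x * (ejump_n \<T> \<Gamma> e v x)\<^sup>2)"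
      obtain \<kappa> where \<kappa>: "\<kappa> \<in> {0, 1/2}" "\<kappa> \<noteq> 0 \<Longrightarrow> T1 \<inter> Gam \<Gamma> \<noteq> {} \<or> T2 \<inter> Gam \<Gamma> \<noteq> {}"
        and bnd: "2 * edge_cross e \<le> \<delta> * (Kd * energy) + \<delta> * \<kappa> * ?F + 1 / \<delta> * ?U"
        using E.uncut_edge_bound[OF eG \<delta>] unfolding cr KE by blast
      have "\<sigma>u / diameter e * eint e UNIV (\<lambda>x. coef \<Gamma> \<beta> x * (ejump_n \<T> \<Gamma> e v x)\<^sup>2) \<le> pen_n_uncut"
        unfolding pen_n_uncut_def
        by (rule member_le_sum[OF eu _ fincut(2)]) (rule terms_nonneg(1), blast)
      then have U: "\<sigma>u * ?U \<le> pen_n_uncut" by simp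
      have U': "1 / \<delta> * ?U \<le> 1 / (\<delta> * \<sigma>u) * pen_n_uncut"
      proof -
        have "1 / \<delta> * ?U = 1 / (\<delta> * \<sigma>u) * (\<sigma>u * ?U)" using \<sigma> by simp
        also have "\<dots> \<le> 1 / (\<delta> * \<sigma>u) * pen_n_uncut" using U \<delta> \<sigma> by (intro mult_left_mono) auto
        finally show ?thesis .
      qed
      \<comment> \<open>A nonzero \<kappa> occurs only next to an interface element, where this
        penalty is present.\<close>
      have F': "\<delta> * \<kappa> * ?F \<le> \<delta> * (1 / (2 * \<sigma>F)) * pen_nn_uncut"
      proof (cases "\<kappa> = 0")
        case True
        then show ?thesis using \<delta> \<sigma> pens_nonneg(4) by simp
      next
        case False
        then have \<kappa>2: "\<kappa> = 1/2" using \<kappa>(1) by auto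
        have "T1 \<in> iface_elems \<T> \<Gamma> \<or> T2 \<in> iface_elems \<T> \<Gamma>"
          using \<kappa>(2)[OF False] E.T1 E.T2 by (auto simp: iface_elems_def)
        then have "e \<in> edges_of_iface_elems \<T> \<Gamma>"
          using E.facet1 E.facet2 by (auto simp: edges_of_iface_elems_def edges_def)
        then have em: "e \<in> (int_edges \<Omega> \<T> - iface_edges \<T> \<Gamma>) \<inter> edges_of_iface_elems \<T> \<Gamma>" using eu by blast
        have "\<sigma>F * diameter e * eint e UNIV (\<lambda>x. coef \<Gamma> \<beta> x * (ejump_nn \<T> \<Gamma> e v x)\<^sup>2) \<le> pen_nn_uncut"
          unfolding pen_nn_uncut_def
          by (rule member_le_sum[OF em]) (use terms_nonneg(4) fincut in auto)
        then have F: "\<sigma>F * ?F \<le> pen_nn_uncut" by (simp add: mult.assoc)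
        have "\<delta> * \<kappa> * ?F = \<delta> * (1 / (2 * \<sigma>F)) * (\<sigma>F * ?F)" using \<sigma> unfolding \<kappa>2 by simp
        also have "\<dots> \<le> \<delta> * (1 / (2 * \<sigma>F)) * pen_nn_uncut" using F \<delta> \<sigma> by (intro mult_left_mono) auto
        finally show ?thesis .
      qed
      have "2 * edge_cross e \<le> \<delta> * 1 * Kd * energy + \<delta> * (1 / (2 * \<sigma>F)) * pen_nn_uncut + 1 / (\<delta> * \<sigma>u) * pen_n_uncut"
        using bnd F' U' by (simp only: mult_1_right mult.assoc)
      then show ?thesis by (rule combine) (use b0 Rb le_nrm in auto)
    qed
  qed
  then show ?thesis unfolding b0_def .
qed

text \<open>Every cross term takes at most the share \<open>1 / (2 * (?N + 1))\<close> of the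
  squared norm, so together they leave half of it.\<close>

lemma coercive:
  assumes \<delta>: "0 < \<delta>"
    and small: "\<delta> * ((2 + beta_avg \<beta>) * Kd + 1 / (2 * \<sigma>F)) + (1 + R / beta_avg \<beta>) / (\<delta> * \<sigma>u)
       \<le> 1 / (2 * (real (card (int_edges \<Omega> \<T>)) + 1))"
  shows "1/2 * (norm_h \<Omega> \<T> \<Gamma> \<beta> \<sigma>u \<sigma>F \<sigma>n v)\<^sup>2 \<le> a_h \<Omega> \<T> \<Gamma> \<beta> \<sigma>u \<sigma>F \<sigma>n v v"
proof -
  let ?N = "real (card (int_edges \<Omega> \<T>))"
  have "2 * edge_cross e \<le> 1 / (2 * (?N + 1)) * nrm" if "e \<in> int_edges \<Omega> \<T>" for e
    using edge_estimate[OF that \<delta>] mult_right_mono[OF small le_nrm(7)] by linarith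
  then have "(\<Sum>e\<in>int_edges \<Omega> \<T>. 2 * edge_cross e) \<le> ?N * (1 / (2 * (?N + 1)) * nrm)"
    by (rule sum_bounded_above)
  also have "\<dots> = (?N / (2 * (?N + 1))) * nrm" by simp
  also have "\<dots> \<le> 1/2 * nrm" using le_nrm(7) by (intro mult_right_mono) (auto simp: field_simps)
  finally show ?thesis unfolding a_h_eq norm_h_sq by linarith
qed

end

end

section \<open>Polynomial pieces of immersed finite element functions\<close>

lemma ife_shape_poly2:
  assumes T: "2 simplex T" and p: "p \<in> {2, 3}" and A: "A \<in> nodes p T"
    and \<phi>: "is_ife_shape p \<T> \<Gamma> \<nu> \<beta> \<mu> \<omega> T A \<phi>"
  shows "\<phi> s \<in> poly2 p"
proof -
  have "\<exists>c. \<phi> = (\<lambda>s x. xi \<Gamma> \<nu> p T A s x + (\<Sum>B\<in>nodes p T. c B * eta \<Gamma> \<nu> p T B s x))"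
    using \<phi> unfolding is_ife_shape_def by (rule conjunct1)
  then obtain c where c: "\<phi> = (\<lambda>s x. xi \<Gamma> \<nu> p T A s x + (\<Sum>B\<in>nodes p T. c B * eta \<Gamma> \<nu> p T B s x))"
    by (rule exE)
  have x: "xi \<Gamma> \<nu> p T A s \<in> poly2 p"
    using lagrange_poly2[OF T p A] poly2_const[of 0 p] by (simp add: xi_def)
  have y: "eta \<Gamma> \<nu> p T B s \<in> poly2 p" if "B \<in> nodes p T" for B
    using lagrange_poly2[OF T p that] poly2_const[of 0 p] by (simp add: eta_def)
  show ?thesis unfolding c by (intro poly2_add[OF x] poly2_sum poly2_cmult y)
qed

text \<open>On an interface element the pieces are the two components of the combination of shape
  functions, and \<open>glue\<close> selects the right one because the subdomains are disjoint. On
  any other element one polynomial serves both sides.\<close>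

lemma ife_pieces:
  assumes M: "mesh \<Omega> \<T>" and G: "interface_domain \<Gamma> \<Omega> r" and p: "p \<in> {2, 3}"
    and v: "v \<in> ife_space p \<Omega> \<T> \<Gamma> \<nu> \<beta> \<mu> \<omega>" and T: "T \<in> \<T>"
  shows "\<exists>u. \<forall>s. u s \<in> poly2 p \<and> (\<forall>x. x \<in> interior T \<longrightarrow> x \<in> side_dom \<Gamma> s \<longrightarrow> v x = u s x)"
proof -
  interpret M: mesh \<Omega> \<T> by (rule M)
  interpret G: interface_domain \<Gamma> \<Omega> r by (rule G)
  have "\<forall>T\<in>\<T>. \<exists>u0\<in>local_space p \<T> \<Gamma> \<nu> \<beta> \<mu> \<omega> T. \<forall>x\<in>interior T - Gam \<Gamma>. v x = u0 x"
    using v unfolding ife_space_def by (elim CollectE conjE)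
  from bspec[OF this T]
  obtain u0 where u0: "u0 \<in> local_space p \<T> \<Gamma> \<nu> \<beta> \<mu> \<omega> T" and vu: "\<And>x. x \<in> interior T - Gam \<Gamma> \<Longrightarrow> v x = u0 x"
    by blast
  have vu': "v x = u0 x" if "x \<in> interior T" "x \<in> side_dom \<Gamma> s" for x s
    using vu[of x] that G.side_sub by blast
  show ?thesis
  proof (cases "T \<in> iface_elems \<T> \<Gamma>")
    case True
    have "\<exists>\<phi> c. (\<forall>A\<in>nodes p T. is_ife_shape p \<T> \<Gamma> \<nu> \<beta> \<mu> \<omega> T A (\<phi> A)) \<and>
        u0 = (\<lambda>x. \<Sum>A\<in>nodes p T. c A * glue \<Gamma> (\<phi> A) x)"
      using u0 unfolding local_space_def if_P[OF True] by (rule CollectD)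
    then obtain \<phi> where "\<exists>c. (\<forall>A\<in>nodes p T. is_ife_shape p \<T> \<Gamma> \<nu> \<beta> \<mu> \<omega> T A (\<phi> A)) \<and>
        u0 = (\<lambda>x. \<Sum>A\<in>nodes p T. c A * glue \<Gamma> (\<phi> A) x)" by (rule exE)
    then obtain c where \<phi>c: "(\<forall>A\<in>nodes p T. is_ife_shape p \<T> \<Gamma> \<nu> \<beta> \<mu> \<omega> T A (\<phi> A)) \<and>
        u0 = (\<lambda>x. \<Sum>A\<in>nodes p T. c A * glue \<Gamma> (\<phi> A) x)" by (rule exE)
    have \<phi>: "is_ife_shape p \<T> \<Gamma> \<nu> \<beta> \<mu> \<omega> T A (\<phi> A)" if "A \<in> nodes p T" for A
      by (rule bspec[OF conjunct1[OF \<phi>c] that])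
    have u0_eq: "u0 = (\<lambda>x. \<Sum>A\<in>nodes p T. c A * glue \<Gamma> (\<phi> A) x)" by (rule conjunct2[OF \<phi>c])
    define u where "u = (\<lambda>s x. \<Sum>A\<in>nodes p T. c A * \<phi> A s x)"
    have "u s \<in> poly2 p" for s
      unfolding u_def by (intro poly2_sum poly2_cmult ife_shape_poly2[OF M.simplex_mesh[OF T] p _ \<phi>])
    moreover have "v x = u s x" if "x \<in> interior T" "x \<in> side_dom \<Gamma> s" for x s
    proof -
      have "glue \<Gamma> f x = f s x" for f
        using that(2) G.in_side_unique[of x Minus Plus] by (cases s) (auto simp: glue_def)
      then show ?thesis unfolding vu'[OF that] u0_eq u_def by simp
    qed
    ultimately show ?thesis by blast
  next
    case False
    then have "u0 \<in> poly2 p" using u0 by (simp add: local_space_def)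
    then show ?thesis using vu' by (intro exI[of _ "\<lambda>_. u0"]) blast
  qed
qed

theorem theorem4p2:
  fixes p :: nat
    and \<Omega> :: "(real^2) set"
    and \<T> :: "(real^2) set set"
    and \<kappa> :: real
    and \<beta> :: "side \<Rightarrow> real"
    and \<mu> :: real
    and \<omega> :: "nat \<Rightarrow> real"
    and \<sigma>F \<sigma>n :: real
  assumes "p \<in> {2, 3}"
    and "polygonal_domain \<Omega>"
    and "triangular_mesh \<Omega> \<T>"
    and "shape_regular \<kappa> \<T>"
    and "\<beta> Plus > 0" and "\<beta> Minus > 0"
    and "\<mu> > 1"
    and "\<forall>j\<in>{0, 1, 2, 3}. \<omega> j > 0"
    and "\<sigma>F > 0" and "\<sigma>n > 0"
  shows "\<exists>\<sigma>0>0. \<forall>\<sigma>u\<ge>\<sigma>0. \<exists>c>0. \<forall>\<Gamma>::interface. admissible \<Omega> \<T> \<Gamma> \<longrightarrow>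
           (\<forall>\<nu>. \<forall>v\<in>ife_space p \<Omega> \<T> \<Gamma> \<nu> \<beta> \<mu> \<omega>.
              a_h \<Omega> \<T> \<Gamma> \<beta> \<sigma>u \<sigma>F \<sigma>n v v \<ge> c * (norm_h \<Omega> \<T> \<Gamma> \<beta> \<sigma>u \<sigma>F \<sigma>n v)\<^sup>2)"
proof -
  interpret M: mesh \<Omega> \<T> by unfold_locales (rule assms)+
  have \<beta>s: "0 < \<beta> s" for s using assms(5,6) by (cases s) auto
  obtain d where d: "0 < d" "d \<le> 1/4"
    and frames: "\<And>e. e \<in> int_edges \<Omega> \<T> \<Longrightarrow> \<exists>a b m T1 T2. M.edge_frame d e a b m T1 T2"
    using M.edge_frames by metis
  define N where "N = real (card (int_edges \<Omega> \<T>)) + 1"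
  have N: "0 < N" by (simp add: N_def)
  have pos: "0 < diameter e" if e: "e \<in> int_edges \<Omega> \<T>" for e
  proof -
    have "\<exists>a b. e = closed_segment a b \<and> a \<noteq> b" using frames[OF e] unfolding M.edge_frame_def by blast
    then obtain a b where "e = closed_segment a b" "a \<noteq> b" by blast
    then show ?thesis by (simp add: diameter_segment)
  qed
  \<comment> \<open>A sum of nonnegative ratios bounds each of them and depends on the mesh
    only.\<close>
  define R where "R = (\<Sum>e\<in>int_edges \<Omega> \<T>. \<bar>mesh_size \<T>\<bar> / diameter e)"
  have R: "mesh_size \<T> \<le> R * diameter e" if e: "e \<in> int_edges \<Omega> \<T>" for e
  proof -
    have "\<bar>mesh_size \<T>\<bar> / diameter e \<le> R"
      unfolding R_def by (rule member_le_sum[OF e _ M.finite_int_edges]) (use pos in \<open>auto simp: less_imp_le\<close>)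
    then have "\<bar>mesh_size \<T>\<bar> \<le> R * diameter e" using pos[OF e] by (simp add: pos_divide_le_eq)
    then show ?thesis by linarith
  qed
  have R0: "0 \<le> R" unfolding R_def using pos by (intro sum_nonneg) (auto simp: less_imp_le)
  define b0 where "b0 = beta_avg \<beta>"
  have b0: "0 < b0" using assms(5,6) by (simp add: b0_def beta_avg_def)
  define C1 where "C1 = (2 + b0) * (460800 / (pi * d\<^sup>2)) + 1 / (2 * \<sigma>F)"
  define C2 where "C2 = 1 + R / b0"
  have C1: "0 < C1" unfolding C1_def using b0 assms(9) by (intro add_nonneg_pos) auto
  have C2: "0 < C2" unfolding C2_def using R0 b0 by (intro add_pos_nonneg) auto
  \<comment> \<open>Makes \<open>\<delta> * C1\<close> half of the share \<open>1 / (2 * N)\<close>;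
    \<open>\<sigma>0\<close> is chosen so that \<open>C2 / (\<delta> * \<sigma>u)\<close> takes at
    most the other half.\<close>
  define \<delta> where "\<delta> = 1 / (4 * N * C1)"
  have \<delta>: "0 < \<delta>" using N C1 by (simp add: \<delta>_def)
  define \<sigma>0 where "\<sigma>0 = 4 * N * C2 / \<delta>"
  have \<sigma>0: "0 < \<sigma>0" using N C2 \<delta> by (simp add: \<sigma>0_def)
  show ?thesis
  proof (rule exI[of _ \<sigma>0], intro conjI allI impI \<sigma>0)
    fix \<sigma>u assume \<sigma>u: "\<sigma>0 \<le> \<sigma>u"
    then have \<sigma>u0: "0 < \<sigma>u" using \<sigma>0 by linarith
    have small: "\<delta> * C1 + C2 / (\<delta> * \<sigma>u) \<le> 1 / (2 * N)"
    proof -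
      have "\<delta> * C1 = 1 / (4 * N)" using C1 by (simp add: \<delta>_def)
      moreover have "C2 / (\<delta> * \<sigma>u) \<le> 1 / (4 * N)"
      proof -
        have "4 * N * C2 \<le> \<delta> * \<sigma>u" using \<sigma>u \<delta> by (simp add: \<sigma>0_def pos_divide_le_eq mult.commute)
        then show ?thesis using N \<delta> \<sigma>u0 by (simp add: field_simps)
      qed
      moreover have "1 / (4 * N) + 1 / (4 * N) = 1 / (2 * N)" by simp
      ultimately show ?thesis by linarith
    qed
    show "\<exists>c>0. \<forall>\<Gamma>::interface. admissible \<Omega> \<T> \<Gamma> \<longrightarrow>
           (\<forall>\<nu>. \<forall>v\<in>ife_space p \<Omega> \<T> \<Gamma> \<nu> \<beta> \<mu> \<omega>.
              a_h \<Omega> \<T> \<Gamma> \<beta> \<sigma>u \<sigma>F \<sigma>n v v \<ge> c * (norm_h \<Omega> \<T> \<Gamma> \<beta> \<sigma>u \<sigma>F \<sigma>n v)\<^sup>2)"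
    \<comment> \<open>The constant is 1/2 for every interface, since \<open>d\<close>,
      \<open>R\<close>, \<delta> and \<open>\<sigma>0\<close> are all fixed before \<Gamma> is
      introduced.\<close>
    proof (intro exI[of _ "1/2"] conjI allI impI ballI)
      fix \<Gamma> :: interface and \<nu> v
      assume adm: "admissible \<Omega> \<T> \<Gamma>" and v: "v \<in> ife_space p \<Omega> \<T> \<Gamma> \<nu> \<beta> \<mu> \<omega>"
      note adm' = adm[unfolded admissible_def]
      note geo = adm'[THEN conjunct1] adm'[THEN conjunct2, THEN conjunct1]
        adm'[THEN conjunct2, THEN conjunct2, THEN conjunct1]
        adm'[THEN conjunct2, THEN conjunct2, THEN conjunct2, THEN conjunct1]
        adm'[THEN conjunct2, THEN conjunct2, THEN conjunct2, THEN conjunct2, THEN conjunct1]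
      have "\<exists>r>0. mesh_size \<T> < r / 2 \<and> (\<forall>x\<in>Gam \<Gamma>. \<forall>y\<in>Gam \<Gamma>. x \<noteq> y \<longrightarrow>
           closed_segment (x - r *\<^sub>R gnormal \<Gamma> x) (x + r *\<^sub>R gnormal \<Gamma> x) \<inter>
           closed_segment (y - r *\<^sub>R gnormal \<Gamma> y) (y + r *\<^sub>R gnormal \<Gamma> y) = {})"
        using adm' by (elim conjE)
      then obtain r where r': "0 < r \<and> mesh_size \<T> < r / 2 \<and> (\<forall>x\<in>Gam \<Gamma>. \<forall>y\<in>Gam \<Gamma>. x \<noteq> y \<longrightarrow>
           closed_segment (x - r *\<^sub>R gnormal \<Gamma> x) (x + r *\<^sub>R gnormal \<Gamma> x) \<inter>
           closed_segment (y - r *\<^sub>R gnormal \<Gamma> y) (y + r *\<^sub>R gnormal \<Gamma> y) = {})" by (rule exE)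
      have r: "0 < r" "mesh_size \<T> < r / 2" using r' by simp_all
      have disj: "closed_segment (x - r *\<^sub>R gnormal \<Gamma> x) (x + r *\<^sub>R gnormal \<Gamma> x) \<inter>
           closed_segment (y - r *\<^sub>R gnormal \<Gamma> y) (y + r *\<^sub>R gnormal \<Gamma> y) = {}"
        if "x \<in> Gam \<Gamma>" "y \<in> Gam \<Gamma>" "x \<noteq> y" for x y
        by (rule mp[OF bspec[OF bspec[OF conjunct2[OF conjunct2[OF r']] that(1)] that(2)] that(3)])
      interpret G: interface_domain \<Gamma> \<Omega> r
        by unfold_locales (fact geo M.open_dom r(1) | (rule disj; assumption))+
      have "\<forall>T\<in>\<T>. \<exists>u. \<forall>s. u s \<in> poly2 p \<and> (\<forall>x. x \<in> interior T \<longrightarrow> x \<in> side_dom \<Gamma> s \<longrightarrow> v x = u s x)"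
        using ife_pieces[OF M.mesh_axioms G.interface_domain_axioms assms(1) v] by blast
      then obtain w where w: "\<And>T s. T \<in> \<T> \<Longrightarrow> w T s \<in> poly2 p"
        "\<And>T s x. T \<in> \<T> \<Longrightarrow> x \<in> interior T \<Longrightarrow> x \<in> side_dom \<Gamma> s \<Longrightarrow> v x = w T s x" by metis
      have cut: "e \<subseteq> Gam \<Gamma> \<or> (\<exists>x. Gam \<Gamma> \<inter> e \<subseteq> {x})" if "e \<in> edges \<T>" for e
        by (rule bspec[OF geo(5) that])
      interpret F: ife \<Omega> \<T> \<Gamma> r \<beta> p v w
      proof unfold_locales
        show "p \<le> 3" using assms(1) by auto
        show "2 * mesh_size \<T> < r" using r(2) by simp
      qed (fact \<beta>s w cut | (rule w; assumption) | (rule cut; assumption))+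
      show "1/2 * (norm_h \<Omega> \<T> \<Gamma> \<beta> \<sigma>u \<sigma>F \<sigma>n v)\<^sup>2 \<le> a_h \<Omega> \<T> \<Gamma> \<beta> \<sigma>u \<sigma>F \<sigma>n v v"
        by (rule F.coercive[OF d frames R \<sigma>u0 assms(9,10) \<delta>])
          (use small in \<open>simp_all add: C1_def C2_def N_def b0_def F.Kd_def[OF d frames R \<sigma>u0 assms(9,10)]\<close>)
    qed simp
  qed
qed

end
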